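(* Define \[C=\prod_p\left(1-\frac{3}{p^2}+\frac{2}{p^3}\right)\ (\text{product over all primes}),\qquad C_{\mathrm{I}}=\frac{2C\sqrt3}{15},\qquad C_{\mathrm{II}}=\frac{C\sqrt3}{10}.\] For $?\in\{\mathrm{I},\mathrm{II}\}$ and real numbers $1\le R_1<R_2$, let $[R_1,R_2)_{\mathrm{I}}=\{iy: R_1\le y<R_2\}$ and $[R_1,R_2)_{\mathrm{II}}=\{(1+iy)/3:R_1\le y<R_2\}$. Then for all such $R_1,R_2$, \[\lim_{X\to\infty}\frac{\#\{K\text{ pure cubic of Type }?:\ |\Delta(K)|\le X,\ \operatorname{sh}(K)\in[R_1,R_2)_?\}}{C_?\sqrt X}=\int_{[R_1,R_2)_?}d\mu_?=\log\frac{R_2}{R_1},\] where $K$ ranges over isomorphism classes of pure cubic fields.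
   Context: A pure cubic field is $K=\mathbf{Q}(m^{1/3})$, $m$ a positive non-cube integer; it can be written uniquely as $K=\mathbf{Q}((ab^2)^{1/3})$ with $a,b$ coprime squarefree positive integers, $a>b$, and its ratio is $r_K=a/b$. With $m=ab^2$, $K$ is of Type II if $3\nmid m$ and $r_K\equiv\pm1\pmod 9$, and of Type I otherwise. $\Delta(K)$ denotes the discriminant of $K$. Let $\mathscr{S}_{\mathrm{I}}=\{iy:y\ge1\}$ and $\mathscr{S}_{\mathrm{II}}=\{(1+iy)/3:y\ge1\}$ in the upper half-plane, each equipped with the measure $\mu_?=dy/y$ (in the coordinate $y$; induced by the hyperbolic metric). The shape $\operatorname{sh}(K)$, taken in $\mathscr{S}_?$, is the point $i\,r_K^{1/3}\in\mathscr{S}_{\mathrm{I}}$ if $K$ is of Type I and $(1+i\,r_K^{1/3})/3\in\mathscr{S}_{\mathrm{II}}$ if $K$ is of Type II (these points represent the shape of $K$, i.e. the class of the lattice given by projecting $\mathcal{O}_K$, embedded in $K\otimes\mathbf{R}$ with the form $\sum_\sigma|\sigma(x)|^2$, orthogonally away from $1$, up to scaling, rotations and reflections). *)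

theory Defs
  imports
    "HOL-Analysis.Analysis"
    "HOL-Algebra.Generated_Fields"
    "HOL-Algebra.QuotRing"
    "HOL-Algebra.Algebraic_Closure_Type"
    "HOL-Computational_Algebra.Computational_Algebra"
    "Jordan_Normal_Form.Determinant"
begin

text \<open>
  Number fields are represented as subfields of the complex numbers; every number field is
  isomorphic to such a subfield, so isomorphism classes of number fields are the classes of these
  subfields under abstract ring isomorphism.
\<close>

abbreviation CC :: "complex ring" where
  "CC \<equiv> ring_of_type_algebra"

definition adjoin :: "complex \<Rightarrow> complex set" where
  "adjoin \<alpha> = generate_field CC (insert \<alpha> \<rat>)"

text \<open>
  \<open>K\<close> is the field obtained from the rationals by adjoining a cube root of \<open>m\<close>. Any of the three
  complex cube roots is allowed; they give conjugate, hence isomorphic, subfields.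
\<close>

definition is_cube_root_field :: "nat \<Rightarrow> complex set \<Rightarrow> bool" where
  "is_cube_root_field m K \<longleftrightarrow> (\<exists>\<alpha>. \<alpha> ^ 3 = of_nat m \<and> K = adjoin \<alpha>)"

definition pure_cubic_field :: "complex set \<Rightarrow> bool" where
  "pure_cubic_field K \<longleftrightarrow> (\<exists>m>0. (\<nexists>k::nat. m = k ^ 3) \<and> is_cube_root_field m K)"

definition field_iso :: "complex set \<Rightarrow> complex set \<Rightarrow> bool" where
  "field_iso K L \<longleftrightarrow> CC\<lparr>carrier := K\<rparr> \<simeq> CC\<lparr>carrier := L\<rparr>"

definition pure_cubic_iso :: "complex set rel" where
  "pure_cubic_iso = {(K, L). pure_cubic_field K \<and> pure_cubic_field L \<and> field_iso K L}"


text \<open>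
  Embeddings are made extensional (undefined outside \<open>K\<close>) so that distinct elements of
  \<open>embeddings K\<close> are distinct as maps on \<open>K\<close>.
\<close>

definition embeddings :: "complex set \<Rightarrow> (complex \<Rightarrow> complex) set" where
  "embeddings K = Ring.ring_hom (CC\<lparr>carrier := K\<rparr>) CC \<inter> extensional K"

definition field_trace :: "complex set \<Rightarrow> complex \<Rightarrow> complex" where
  "field_trace K x = (\<Sum>\<sigma>\<in>embeddings K. \<sigma> x)"

definition ring_of_integers :: "complex set \<Rightarrow> complex set" where
  "ring_of_integers K = {x \<in> K. algebraic_int x}"

definition integral_basis :: "complex set \<Rightarrow> complex list \<Rightarrow> bool" where
  "integral_basis K \<omega> \<longleftrightarrow>
     set \<omega> \<subseteq> ring_of_integers K \<and>
     (\<forall>x\<in>ring_of_integers K. \<exists>!c :: int list.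
        length c = length \<omega> \<and> x = (\<Sum>i<length \<omega>. of_int (c ! i) * \<omega> ! i))"

definition discriminant :: "complex set \<Rightarrow> int" where
  "discriminant K = (THE d. \<exists>\<omega>. integral_basis K \<omega> \<and>
     of_int d = Determinant.det (mat (length \<omega>) (length \<omega>)
                  (\<lambda>(i, j). field_trace K (\<omega> ! i * \<omega> ! j))))"


definition cubic_params :: "complex set \<Rightarrow> nat \<times> nat" where
  "cubic_params K = (THE (a, b). 0 < b \<and> b < a \<and> coprime a b \<and> squarefree a \<and> squarefree b \<and>
     is_cube_root_field (a * b ^ 2) K)"

definition ratio :: "complex set \<Rightarrow> rat" where
  "ratio K = (case cubic_params K of (a, b) \<Rightarrow> of_nat a / of_nat b)"

text \<open>
  Congruence of rational numbers modulo \<open>n\<close>, i.e. in the localization of the integers at the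
  denominators prime to \<open>n\<close>.
\<close>

definition rat_cong :: "rat \<Rightarrow> rat \<Rightarrow> int \<Rightarrow> bool" where
  "rat_cong x y n \<longleftrightarrow> (\<exists>c d. coprime d n \<and> x - y = of_int (n * c) / of_int d)"

datatype cubic_type = TypeI | TypeII

definition field_type :: "complex set \<Rightarrow> cubic_type" where
  "field_type K = (case cubic_params K of (a, b) \<Rightarrow>
     if \<not> 3 dvd a * b ^ 2 \<and> (rat_cong (ratio K) 1 9 \<or> rat_cong (ratio K) (- 1) 9)
     then TypeII else TypeI)"


fun shape_point :: "cubic_type \<Rightarrow> real \<Rightarrow> complex" where
  "shape_point TypeI y = \<i> * of_real y"
| "shape_point TypeII y = (1 + \<i> * of_real y) / 3"

definition shape_space :: "cubic_type \<Rightarrow> complex set" where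
  "shape_space t = {shape_point t y |y. 1 \<le> y}"

definition shape_interval :: "cubic_type \<Rightarrow> real \<Rightarrow> real \<Rightarrow> complex set" where
  "shape_interval t R1 R2 = {shape_point t y |y. R1 \<le> y \<and> y < R2}"

text \<open>The measure \<open>dy / y\<close> on \<open>shape_space t\<close>, transported along the coordinate \<open>y\<close>.\<close>

definition shape_measure :: "cubic_type \<Rightarrow> complex measure" where
  "shape_measure t =
     distr (density (restrict_space lborel {1..}) (\<lambda>y. ennreal (1 / y)))
       (restrict_space borel (shape_space t)) (shape_point t)"

text \<open>
  The distinguished representative, in the space attached to the type of \<open>K\<close>, of the class of the
  lattice obtained by projecting the ring of integers orthogonally away from \<open>1\<close>.
\<close>

definition shape :: "complex set \<Rightarrow> complex" where
  "shape K = shape_point (field_type K) (root 3 (of_rat (ratio K)))"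


definition euler_const :: real where
  "euler_const =
     prodinf (\<lambda>p. if Factorial_Ring.prime p then 1 - 3 / real p ^ 2 + 2 / real p ^ 3 else 1)"

fun type_const :: "cubic_type \<Rightarrow> real" where
  "type_const TypeI = 2 * euler_const * sqrt 3 / 15"
| "type_const TypeII = euler_const * sqrt 3 / 10"

definition shape_count :: "cubic_type \<Rightarrow> real \<Rightarrow> real \<Rightarrow> real \<Rightarrow> nat" where
  "shape_count t R1 R2 x =
     card ({K. pure_cubic_field K \<and> field_type K = t \<and> \<bar>real_of_int (discriminant K)\<bar> \<le> x \<and>
               shape K \<in> shape_interval t R1 R2} // pure_cubic_iso)"

end

theory Submission
  imports
    Defs
    "Jordan_Normal_Form.Char_Poly"
    "HOL-Real_Asymp.Real_Asymp"
    "HOL-Number_Theory.Cong"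
begin

text \<open>
  A pure cubic field with parameters \<open>(a, b)\<close> has the rational basis \<open>1\<close>, \<open>t\<close>, \<open>u\<close> where
  \<open>t\<^sup>3 = a b\<^sup>2\<close> and \<open>u = t\<^sup>2 / b\<close>, so that \<open>t u = a b\<close>, \<open>t\<^sup>2 = b u\<close> and \<open>u\<^sup>2 = a t\<close>. The elements whose
  cube is rational are the rational multiples of \<open>1\<close>, \<open>t\<close> and \<open>u\<close>; hence \<open>(a, b)\<close> is an invariant of the
  isomorphism class, and counting fields amounts to counting pairs. An element is integral iff its
  characteristic polynomial is; as \<open>a b\<^sup>2\<close> is cube-free, its coordinates have denominators dividing
  \<open>3\<close>, and a computation modulo \<open>27\<close> yields the discriminants \<open>- 27 a\<^sup>2 b\<^sup>2\<close> (Type I) and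
  \<open>- 3 a\<^sup>2 b\<^sup>2\<close> (Type II).

  One is left with counting coprime squarefree pairs with \<open>a b \<le> N\<close> and \<open>a / b\<close> in
  \<open>[R1\<^sup>3, R2\<^sup>3)\<close>. This region is a dilate of a bounded one of area \<open>(3 / 2) log (R2 / R1)\<close>, so every
  residue class modulo \<open>q\<close> receives the share \<open>1 / q\<^sup>2\<close> of it. Imposing the local conditions
  modulo \<open>p\<^sup>2\<close> for the primes \<open>p \<le> z\<close> gives the partial Euler product, and the larger primes
  contribute at most \<open>O(N / z)\<close>. Of the \<open>60\<close> admissible residue pairs modulo \<open>9\<close>, \<open>48\<close> are of Type I
  and \<open>12\<close> of Type II.
\<close>

section \<open>Subfields generated by a cube root\<close>

text \<open>Discriminant and parameters are specified by \<open>THE\<close>, over integral bases of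
  unspecified length and over all cube roots, so well-definedness has to be proved first. Everything
  is read off coordinates in \<open>1\<close>, \<open>t\<close>, \<open>u\<close>: their
  multiplication table depends on \<open>a\<close> and \<open>b\<close> alone, so every cube root of
  \<open>a b^2\<close> gives the same computations, and embeddings and isomorphisms just keep the
  coordinates and change the root.

  In the count, the obstacle is that infinitely many primes impose conditions, while
  equidistribution is available for one fixed modulus at a time. Hence \<open>N\<close> tends to
  infinity for fixed \<open>z\<close>, and \<open>z\<close> is chosen beforehand from the accuracy
  wanted. This works because the error \<open>3 * r2 * N / z\<close> is valid for every
  \<open>N > 0\<close>. The error is linear in \<open>N\<close>, with no logarithm, because the
  bounded ratio confines both \<open>a\<close> and \<open>b\<close> to constant multiples of
  \<open>sqrt N\<close>.\<close>

lemma CC_simps [simp]: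
  "carrier CC = UNIV" "mult CC = (*)" "one CC = 1" "zero CC = 0" "add CC = (+)"
  by (simp_all add: ring_of_type_algebra_def)

lemma CC_a_inv [simp]: "\<ominus>\<^bsub>CC\<^esub> x = - x"
proof -
  interpret cring CC by (rule cring_from_type_algebra)
  show ?thesis by (rule minus_equality) simp_all
qed

lemma CC_m_inv: "x \<noteq> 0 \<Longrightarrow> inv\<^bsub>CC\<^esub> x = inverse x"
proof -
  assume "x \<noteq> 0"
  interpret cring CC by (rule cring_from_type_algebra)
  show ?thesis by (rule comm_inv_char) (use \<open>x \<noteq> 0\<close> in simp_all)
qed

lemma adjoin_gen [intro, simp]: "\<alpha> \<in> adjoin \<alpha>"
  unfolding adjoin_def by (rule generate_field.incl) simp

lemma adjoin_of_rat [intro, simp]: "of_rat q \<in> adjoin \<alpha>"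
  unfolding adjoin_def by (rule generate_field.incl) simp

lemma adjoin_add [intro]: "x \<in> adjoin \<alpha> \<Longrightarrow> y \<in> adjoin \<alpha> \<Longrightarrow> x + y \<in> adjoin \<alpha>"
  unfolding adjoin_def using generate_field.eng_add[of x CC _ y] by simp

lemma adjoin_mult [intro]: "x \<in> adjoin \<alpha> \<Longrightarrow> y \<in> adjoin \<alpha> \<Longrightarrow> x * y \<in> adjoin \<alpha>"
  unfolding adjoin_def using generate_field.eng_mult[of x CC _ y] by simp

lemma adjoin_power: "x \<in> adjoin \<alpha> \<Longrightarrow> x ^ n \<in> adjoin \<alpha>"
  by (induction n) (auto simp: adjoin_of_rat[of 1, simplified])

lemma adjoin_of_nat [simp]: "of_nat n \<in> adjoin \<alpha>"
  using adjoin_of_rat[of "of_nat n"] by (simp del: adjoin_of_rat)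

lemma adjoin_inverse: "x \<in> adjoin \<alpha> \<Longrightarrow> inverse x \<in> adjoin \<alpha>"
proof (cases "x = 0")
  case False
  assume "x \<in> adjoin \<alpha>"
  thus ?thesis using generate_field.m_inv[of x CC] False CC_m_inv[of x] by (auto simp: adjoin_def)
qed auto

lemma adjoin_divide: "x \<in> adjoin \<alpha> \<Longrightarrow> y \<in> adjoin \<alpha> \<Longrightarrow> x / y \<in> adjoin \<alpha>"
  unfolding divide_inverse by (intro adjoin_mult adjoin_inverse)

lemma adjoin_subset:
  assumes "\<alpha> \<in> S" "\<And>q. of_rat q \<in> S" "\<And>x y. x \<in> S \<Longrightarrow> y \<in> S \<Longrightarrow> x + y \<in> S"
    and "\<And>x y. x \<in> S \<Longrightarrow> y \<in> S \<Longrightarrow> x * y \<in> S" "\<And>x. x \<in> S \<Longrightarrow> x \<noteq> 0 \<Longrightarrow> inverse x \<in> S"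
  shows "adjoin \<alpha> \<subseteq> S"
proof
  fix x assume "x \<in> adjoin \<alpha>"
  thus "x \<in> S" unfolding adjoin_def
  proof (induction rule: generate_field.induct)
    case one thus ?case using assms(2)[of 1] by simp
  next
    case (incl h) thus ?case using assms(1,2) by (auto elim: Rats_cases)
  next
    case (a_inv h) thus ?case using assms(4)[OF assms(2)[of "-1"]] by (auto simp: of_rat_minus)
  next
    case (m_inv h) thus ?case using assms(5) by (simp add: CC_m_inv)
  qed (use assms in auto)
qed

lemma adjoin_mono: "\<beta> \<in> adjoin \<alpha> \<Longrightarrow> adjoin \<beta> \<subseteq> adjoin \<alpha>"
  by (rule adjoin_subset) (auto intro: adjoin_inverse)

section \<open>Cube-free radicands and uniqueness of the parameters\<close>

definition canonical_pair :: "nat \<Rightarrow> nat \<Rightarrow> bool" where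
  "canonical_pair a b \<longleftrightarrow> 0 < b \<and> b < a \<and> coprime a b \<and> squarefree a \<and> squarefree b"

text \<open>A prime divides at most one of \<open>a\<close> and \<open>b\<close>, so its exponent in
  \<open>a * b ^ 2\<close> is at most 1 if it comes from \<open>a\<close> and at most 2 if it comes
  from \<open>b\<close>.\<close>

lemma cubefree_mult_square:
  fixes a b d :: nat
  assumes "coprime a b" "squarefree a" "squarefree b" "d ^ 3 dvd a * b ^ 2"
  shows "d = 1"
proof (rule ccontr)
  assume "d \<noteq> 1"
  then obtain p where p: "Factorial_Ring.prime p" "p dvd d" using prime_factor_nat by blast
  have p3: "p ^ 3 dvd a * b ^ 2"
    using p(2) assms(4) by (meson dvd_power_same dvd_trans)
  have notsq: "\<not> p ^ 2 dvd a" "\<not> p ^ 2 dvd b"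
    using p(1) assms(2,3) squarefreeD not_prime_unit by blast+
  show False
  proof (cases "p dvd a")
    case True
    hence "coprime p b" using assms(1) by (meson coprime_divisors dvd_refl)
    hence "p ^ 3 dvd a" using p3 by (simp add: coprime_dvd_mult_left_iff)
    thus False using notsq by (meson dvd_trans le_imp_power_dvd one_le_numeral eval_nat_numeral numeral_le_iff semiring_norm)
  next
    case False
    hence "coprime p a" using p(1) prime_imp_coprime by blast
    hence pb: "p ^ 3 dvd b ^ 2" using p3 by (simp add: coprime_dvd_mult_right_iff)
    hence "p dvd b ^ 2" by (meson dvd_trans dvd_power zero_less_numeral)
    hence "p dvd b" using p(1) prime_dvd_power by blast
    then obtain c where c: "b = p * c" by blast
    have "p ^ 2 * p dvd p ^ 2 * c ^ 2" using pb by (simp add: c power_mult_distrib power3_eq_cube power2_eq_square)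
    hence "p dvd c ^ 2" using p(1) by (simp add: prime_gt_0_nat)
    hence "p dvd c" using p(1) prime_dvd_power by blast
    hence "p ^ 2 dvd b" by (simp add: c power2_eq_square)
    thus False using notsq by simp
  qed
qed

text \<open>In lowest terms \<open>q = r / s\<close>, the cube of \<open>s\<close> is coprime to
  that of \<open>r\<close> and must divide \<open>n\<close>, which is cube-free.\<close>

lemma Ints_of_cube_mult_Ints:
  fixes q :: rat and n :: nat
  assumes "\<And>d. d ^ 3 dvd n \<Longrightarrow> d = 1" "q ^ 3 * of_nat n \<in> \<int>"
  shows "q \<in> \<int>"
proof -
  obtain r s where rs: "quotient_of q = (r, s)" by fastforce
  have s: "s > 0" and cop: "coprime r s" and q: "q = of_int r / of_int s"
    using quotient_of_denom_pos[OF rs] quotient_of_coprime[OF rs] quotient_of_div[OF rs] by auto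
  obtain k where k: "q ^ 3 * of_nat n = of_int k" using assms(2) by (auto elim: Ints_cases)
  have "of_int (r ^ 3 * int n) = (of_int (k * s ^ 3) :: rat)"
    using k s by (simp add: q field_simps power_divide)
  hence "r ^ 3 * int n = k * s ^ 3" by (simp only: of_int_eq_iff)
  hence "s ^ 3 dvd r ^ 3 * int n" by simp
  hence "s ^ 3 dvd int n" using cop by (simp add: coprime_dvd_mult_right_iff coprime_commute)
  hence "(nat s) ^ 3 dvd n" using s by (metis int_dvd_int_iff of_nat_power nat_0_le order_less_imp_le)
  hence "nat s = 1" by (rule assms(1))
  hence "s = 1" using s by simp
  thus ?thesis by (simp add: q)
qed

lemma canonical_pair_cubefree: "canonical_pair a b \<Longrightarrow> d ^ 3 dvd a * b ^ 2 \<Longrightarrow> d = 1"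
  unfolding canonical_pair_def using cubefree_mult_square by blast

text \<open>After division by the gcd of \<open>b\<close> and \<open>b'\<close>, the square of each
  remaining cofactor divides a squarefree number, so both cofactors are 1.\<close>

lemma squarefree_times_square_unique:
  fixes a b a' b' :: nat
  assumes "squarefree a" "squarefree a'" "b > 0" "a * b ^ 2 = a' * b' ^ 2"
  shows "a' = a" "b' = b"
proof -
  define g where "g = gcd b b'"
  have g: "g > 0" using assms by (simp add: g_def)
  obtain c c' where c: "b = g * c" "b' = g * c'" "coprime c c'"
    using assms(3) unfolding g_def by (metis gcd_coprime_exists mult.commute gcd_eq_0_iff not_less0)
  have eq: "a * c ^ 2 = a' * c' ^ 2" using assms(4) g by (simp add: c power_mult_distrib)
  have "c ^ 2 dvd a' * c' ^ 2" "c' ^ 2 dvd a * c ^ 2" using eq by (metis dvd_triv_right)+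
  hence "c ^ 2 dvd a'" "c' ^ 2 dvd a"
    using c(3) by (simp_all add: coprime_dvd_mult_left_iff coprime_commute)
  hence "c = 1" "c' = 1" using assms(1,2) squarefreeD[of a' c] squarefreeD[of a c'] by simp_all
  thus "a' = a" "b' = b" using eq c by simp_all
qed

lemma canonical_pair_unique:
  fixes q :: rat
  assumes "canonical_pair a b" and "coprime a' b'" "squarefree a'" "squarefree b'"
    and "q ^ 3 * of_nat (a * b ^ 2) = of_nat (a' * b' ^ 2)"
  shows "a' = a" "b' = b"
proof -
  have pos: "a > 0" "b > 0" "a' > 0" "b' > 0"
    using assms unfolding canonical_pair_def by (auto intro!: Nat.gr0I)
  have q0: "q \<noteq> 0" using assms(5) pos by auto
  have "q \<in> \<int>" using assms canonical_pair_cubefree Ints_of_cube_mult_Ints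
    by (metis Ints_of_nat)
  moreover have "(1 / q) ^ 3 * of_nat (a' * b' ^ 2) = of_nat (a * b ^ 2)"
    using assms(5)[symmetric] q0 by (simp add: field_simps power_divide)
  hence "1 / q \<in> \<int>" using assms cubefree_mult_square Ints_of_cube_mult_Ints
    by (metis Ints_of_nat)
  ultimately obtain m n :: int where mn: "q = of_int m" "1 / q = of_int n" by (auto elim!: Ints_cases)
  have "of_int (m * n) = (1 :: rat)" using mn q0 by (metis of_int_mult nonzero_mult_div_cancel_left mult.right_neutral times_divide_eq_right)
  hence "m * n = 1" by (simp only: of_int_eq_1_iff)
  hence "m = 1 \<or> m = -1" by (simp add: zmult_eq_1_iff) blast
  moreover have "m \<noteq> -1"
  proof
    assume "m = -1"
    hence "of_int (- int (a * b ^ 2)) = (of_int (int (a' * b' ^ 2)) :: rat)"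
      using assms(5) mn by simp
    hence "- int (a * b ^ 2) = int (a' * b' ^ 2)" by (simp only: of_int_eq_iff)
    thus False using pos by (metis nat_0_less_mult_iff neg_less_0_iff_less not_less_iff_gr_or_eq of_nat_0_less_iff zero_less_power)
  qed
  ultimately have "of_nat (a * b ^ 2) = (of_nat (a' * b' ^ 2) :: rat)" using assms(5) mn by simp
  hence *: "a * b ^ 2 = a' * b' ^ 2" by (simp only: of_nat_eq_iff)
  thus "a' = a" "b' = b"
    using squarefree_times_square_unique[OF _ assms(3) pos(2) *] assms(1)
    unfolding canonical_pair_def by blast+
qed

lemma canonical_pair_no_rat_root:
  fixes q :: rat
  assumes "canonical_pair a b"
  shows "q ^ 3 \<noteq> of_nat (a * b ^ 2)"
proof
  assume *: "q ^ 3 = of_nat (a * b ^ 2)"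
  have "q \<noteq> 0" using * assms by (auto simp: canonical_pair_def)
  hence "(1 / q) ^ 3 * of_nat (a * b ^ 2) = of_nat (1 * 1 ^ 2)" unfolding * [symmetric] by (simp add: power_divide)
  from canonical_pair_unique[OF assms _ _ _ this] assms show False
    by (auto simp: canonical_pair_def)
qed

text \<open>Otherwise \<open>b * y / z\<close> would be a rational cube root of
  \<open>a * b ^ 2\<close>. Eliminations in the coordinates \<open>x, y, z\<close> repeatedly end in
  this equation.\<close>

lemma canonical_pair_no_rat_ratio:
  fixes y z :: rat
  assumes "canonical_pair a b" "of_nat b * y ^ 3 = of_nat a * z ^ 3"
  shows "y = 0" "z = 0"
proof -
  have pos: "a > 0" "b > 0" using assms by (auto simp: canonical_pair_def)
  show "z = 0"
  proof (rule ccontr)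
    assume "z \<noteq> 0"
    hence "(of_nat b * y / z) ^ 3 = of_nat (a * b ^ 2)" using assms(2)
      by (simp add: field_simps power3_eq_cube power2_eq_square)
    thus False using canonical_pair_no_rat_root[OF assms(1)] by blast
  qed
  thus "y = 0" using assms(2) pos by simp
qed

section \<open>Arithmetic in the basis \<open>1\<close>, \<open>t\<close>, \<open>u\<close>\<close>

locale cubic_root =
  fixes a b :: nat and t :: complex
  assumes canon: "canonical_pair a b" and cube: "t ^ 3 = of_nat (a * b ^ 2)"
begin

definition u :: complex where "u = t ^ 2 / of_nat b"

definition lin :: "rat \<Rightarrow> rat \<Rightarrow> rat \<Rightarrow> complex" where
  "lin x y z = of_rat x + of_rat y * t + of_rat z * u"

lemma ab_pos [simp]: "a > 0" "b > 0" "a \<noteq> 0" "b \<noteq> 0"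
  using canon by (auto simp: canonical_pair_def)

lemma tt: "t * t = of_nat b * u"
  by (simp add: u_def power2_eq_square)

lemma tu: "t * u = of_nat a * of_nat b"
proof -
  have "t * u = t ^ 3 / of_nat b" by (simp add: u_def power2_eq_square power3_eq_cube)
  also have "\<dots> = of_nat a * of_nat b" unfolding cube by (simp add: power2_eq_square)
  finally show ?thesis .
qed

lemma uu: "u * u = of_nat a * t"
proof -
  have "of_nat b * (u * u) = (t * t) * u" unfolding tt by (simp only: mult.assoc)
  also have "\<dots> = (t * u) * t" by (simp only: ac_simps)
  also have "\<dots> = of_nat b * (of_nat a * t)" unfolding tu by (simp only: ac_simps)
  finally show ?thesis using ab_pos(4) by simp
qed

lemma lin_add: "lin x y z + lin x' y' z' = lin (x + x') (y + y') (z + z')"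
  by (simp add: lin_def of_rat_add algebra_simps)

lemma lin_diff: "lin x y z - lin x' y' z' = lin (x - x') (y - y') (z - z')"
  by (simp add: lin_def of_rat_diff algebra_simps)

lemma lin_mult: "lin x y z * lin x' y' z' =
    lin (x * x' + of_nat a * of_nat b * (y * z' + z * y')) (x * y' + y * x' + of_nat a * z * z')
      (x * z' + z * x' + of_nat b * y * y')"
proof -
  have "lin x y z * lin x' y' z' =
     of_rat x * of_rat x' + of_rat (y * z' + z * y') * (t * u) + of_rat (x * y' + y * x') * t
     + of_rat (x * z' + z * x') * u + of_rat (z * z') * (u * u) + of_rat (y * y') * (t * t)"
    by (simp add: lin_def of_rat_add of_rat_mult algebra_simps)
  also have "\<dots> = lin (x * x' + of_nat a * of_nat b * (y * z' + z * y')) (x * y' + y * x' + of_nat a * z * z')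
      (x * z' + z * x' + of_nat b * y * y')"
    by (simp add: tt tu uu lin_def of_rat_add of_rat_mult algebra_simps)
  finally show ?thesis .
qed

lemma of_rat_eq_lin: "of_rat x = lin x 0 0" and t_eq_lin: "t = lin 0 1 0" and u_eq_lin: "u = lin 0 0 1"
  by (simp_all add: lin_def)

lemma lin_0_0_0 [simp]: "lin 0 0 0 = 0"
  by (simp add: lin_def)

text \<open>Linear independence by elimination: a relation and its multiple by \<open>t\<close>
  combine to a relation without \<open>u\<close>, which the irrationality of \<open>t\<close> makes
  trivial.\<close>

lemma lin_eq_0D:
  assumes "lin x y z = 0"
  shows "x = 0" "y = 0" "z = 0"
proof -
  define P where "P = y * of_nat b * x - z ^ 2 * of_nat a * of_nat b"
  define Q where "Q = y ^ 2 * of_nat b - z * x"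
  have "lin 0 1 0 * lin x y z = 0" using assms by simp
  hence 1: "lin (of_nat a * of_nat b * z) x (of_nat b * y) = 0"
    by (simp add: lin_mult algebra_simps)
  \<comment> \<open>The multipliers \<open>y * b\<close> and \<open>z\<close> are chosen to cancel
    the coefficients of \<open>u\<close>.\<close>
  have "lin (y * of_nat b) 0 0 * lin x y z - lin z 0 0 * lin (of_nat a * of_nat b * z) x (of_nat b * y) = 0"
    using assms 1 by simp
  hence "lin P Q 0 = 0"
    by (simp add: lin_mult lin_diff P_def Q_def power2_eq_square algebra_simps)
  hence PQ: "of_rat P + of_rat Q * t = 0" by (simp add: lin_def)
  have "Q = 0"
  proof (rule ccontr)
    assume "Q \<noteq> 0"
    hence "t = of_rat (- P / Q)" using PQ
      by (simp add: of_rat_divide of_rat_minus field_simps eq_neg_iff_add_eq_0)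
    hence "of_rat ((- P / Q) ^ 3) = t ^ 3" by (simp only: of_rat_power)
    hence "of_rat ((- P / Q) ^ 3) = (of_rat (of_nat (a * b ^ 2)) :: complex)"
      by (simp only: cube of_rat_of_nat_eq)
    thus False using canonical_pair_no_rat_root[OF canon] unfolding of_rat_eq_iff by blast
  qed
  with PQ have P: "P = 0" by simp
  have yx: "y * x = z ^ 2 * of_nat a" using P by (simp add: P_def)
  have zx: "z * x = y ^ 2 * of_nat b" using \<open>Q = 0\<close> by (simp add: Q_def)
  have "of_nat b * y ^ 3 = of_nat a * z ^ 3"
  proof -
    have "of_nat b * y ^ 3 = y * (z * x)" by (simp add: zx power3_eq_cube power2_eq_square)
    also have "\<dots> = z * (y * x)" by simp
    also have "\<dots> = of_nat a * z ^ 3" by (simp add: yx power3_eq_cube power2_eq_square)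
    finally show ?thesis .
  qed
  from canonical_pair_no_rat_ratio[OF canon this] show "y = 0" "z = 0" .
  with assms show "x = 0" by (simp add: lin_def)
qed

lemma lin_eq_iff [simp]: "lin x y z = lin x' y' z' \<longleftrightarrow> x = x' \<and> y = y' \<and> z = z'"
proof
  assume "lin x y z = lin x' y' z'"
  hence "lin x y z - lin x' y' z' = 0" by simp
  hence "lin (x - x') (y - y') (z - z') = 0" unfolding lin_diff .
  from lin_eq_0D[OF this] show "x = x' \<and> y = y' \<and> z = z'" by simp
qed simp

text \<open>The second factor is the product of the two other conjugates of the first.\<close>

lemma lin_mult_adj:
  "lin x y z * lin (x ^ 2 - of_nat a * of_nat b * y * z) (of_nat a * z ^ 2 - x * y) (of_nat b * y ^ 2 - x * z)
   = of_rat (x ^ 3 + of_nat a * of_nat b ^ 2 * y ^ 3 + of_nat a ^ 2 * of_nat b * z ^ 3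
             - 3 * of_nat a * of_nat b * x * y * z)"
  unfolding of_rat_eq_lin lin_mult lin_eq_iff
  by (simp add: algebra_simps power2_eq_square power3_eq_cube)

text \<open>The inverse is the product of the two other conjugates divided by the norm
  \<open>N\<close>, so the point is that \<open>N\<close> is nonzero.\<close>

lemma inverse_lin: "\<exists>x' y' z'. inverse (lin x y z) = lin x' y' z'"
proof (cases "lin x y z = 0")
  case True
  hence "inverse (lin x y z) = lin 0 0 0" by simp
  thus ?thesis by blast
next
  case False
  define p where "p = x ^ 2 - of_nat a * of_nat b * y * z"
  define q where "q = of_nat a * z ^ 2 - x * y"
  define r where "r = of_nat b * y ^ 2 - x * z"
  define N where "N = x ^ 3 + of_nat a * of_nat b ^ 2 * y ^ 3 + of_nat a ^ 2 * of_nat b * z ^ 3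
             - 3 * of_nat a * of_nat b * x * y * z"
  have eq: "lin x y z * lin p q r = of_rat N"
    unfolding p_def q_def r_def N_def by (rule lin_mult_adj)
  have "N \<noteq> 0"
  proof
    assume "N = 0"
    \<comment> \<open>A vanishing norm forces the cofactor to vanish, because complex numbers have
      no zero divisors; its three coordinates then lead to
      \<open>b * y ^ 3 = a * z ^ 3\<close>.\<close>
    have "lin p q r = 0" using eq False unfolding \<open>N = 0\<close> of_rat_0 mult_eq_0_iff by blast
    from lin_eq_0D[OF this] have *: "x ^ 2 = of_nat a * of_nat b * y * z" "of_nat a * z ^ 2 = x * y" "of_nat b * y ^ 2 = x * z"
      unfolding p_def q_def r_def by linarith+
    have "of_nat b * y ^ 3 = (of_nat b * y ^ 2) * y" by (simp add: power3_eq_cube power2_eq_square)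
    also have "\<dots> = (of_nat a * z ^ 2) * z" unfolding * by (simp add: algebra_simps)
    also have "\<dots> = of_nat a * z ^ 3" by (simp add: power3_eq_cube power2_eq_square)
    finally have yz: "y = 0" "z = 0" using canonical_pair_no_rat_ratio[OF canon] by blast+
    have "x = 0" using *(1) unfolding yz by simp
    thus False using False unfolding yz by simp
  qed
  have "lin x y z * (lin (1 / N) 0 0 * lin p q r) = of_rat (1 / N) * of_rat N"
    unfolding eq[symmetric] of_rat_eq_lin[symmetric] by (simp only: ac_simps)
  also have "\<dots> = 1" using \<open>N \<noteq> 0\<close> by (simp flip: of_rat_mult)
  finally have "inverse (lin x y z) = lin (1 / N) 0 0 * lin p q r" by (rule inverse_unique)
  thus ?thesis unfolding lin_mult by blast
qed

lemma adjoin_eq: "adjoin t = {lin x y z | x y z. True}"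
proof
  show "adjoin t \<subseteq> {lin x y z | x y z. True}"
  proof (rule adjoin_subset)
    show "t \<in> {lin x y z | x y z. True}" by (subst t_eq_lin) blast
    show "of_rat q \<in> {lin x y z | x y z. True}" for q by (subst of_rat_eq_lin) blast
  next
    fix v w assume "v \<in> {lin x y z | x y z. True}" "w \<in> {lin x y z | x y z. True}"
    then obtain x y z x' y' z' where vw: "v = lin x y z" "w = lin x' y' z'" by blast
    show "v + w \<in> {lin x y z | x y z. True}" unfolding vw lin_add by blast
    show "v * w \<in> {lin x y z | x y z. True}" unfolding vw lin_mult by blast
  next
    fix v assume "v \<in> {lin x y z | x y z. True}"
    then obtain x y z where v: "v = lin x y z" by blast
    obtain x' y' z' where "inverse v = lin x' y' z'" using inverse_lin v by metis
    thus "inverse v \<in> {lin x y z | x y z. True}" by blast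
  qed
  have "u \<in> adjoin t" unfolding u_def by (intro adjoin_divide adjoin_power adjoin_gen adjoin_of_nat)
  hence "lin x y z \<in> adjoin t" for x y z
    unfolding lin_def by (intro adjoin_add adjoin_mult adjoin_gen adjoin_of_rat)
  thus "{lin x y z | x y z. True} \<subseteq> adjoin t" by blast
qed

lemma lin_in_adjoin [simp]: "lin x y z \<in> adjoin t"
  unfolding adjoin_eq by blast

lemma adjoin_cases:
  assumes "v \<in> adjoin t" obtains x y z where "v = lin x y z"
  using assms unfolding adjoin_eq by blast

end

lemma hom_of_rat:
  fixes h :: "complex \<Rightarrow> complex"
  assumes "\<And>q. of_rat q \<in> K"
    and add: "\<And>x y. x \<in> K \<Longrightarrow> y \<in> K \<Longrightarrow> h (x + y) = h x + h y"
    and mult: "\<And>x y. x \<in> K \<Longrightarrow> y \<in> K \<Longrightarrow> h (x * y) = h x * h y"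
    and one: "h 1 = 1"
  shows "h (of_rat q) = of_rat q"
proof -
  have K: "of_nat n \<in> K" "of_int i \<in> K" for n i
    using assms(1)[of "of_nat n"] assms(1)[of "of_int i"] by simp_all
  have "h (0 + 0) = h 0 + h 0" using K(1)[of 0] by (intro add) simp_all
  hence zero: "h 0 = 0" by simp
  have nat: "h (of_nat n) = of_nat n" for n
  proof (induction n)
    case (Suc n)
    have "h (1 + of_nat n) = h 1 + h (of_nat n)" using K(1)[of 1] K(1)[of n] by (intro add) simp_all
    thus ?case by (simp add: one Suc)
  qed (simp add: zero)
  have int: "h (of_int i) = of_int i" for i
  proof -
    obtain m n where i: "i = int m - int n" by (metis int_diff_cases)
    have "h (of_int i + of_nat n) = h (of_int i) + h (of_nat n)" by (intro add K)
    moreover have "of_int i + of_nat n = (of_nat m :: complex)" by (simp add: i)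
    ultimately show ?thesis by (simp add: nat i eq_diff_eq)
  qed
  obtain r s where rs: "quotient_of q = (r, s)" by fastforce
  have s: "s > 0" and q: "q = of_int r / of_int s"
    using quotient_of_denom_pos[OF rs] quotient_of_div[OF rs] by auto
  have "h (of_int s) * h (of_rat q) = h (of_int s * of_rat q)" by (simp add: mult K assms(1))
  also have "of_int s * of_rat q = (of_int r :: complex)" using s by (simp add: q of_rat_divide)
  finally have "of_int s * h (of_rat q) = of_int r" by (simp add: int)
  thus ?thesis using s by (simp add: q of_rat_divide field_simps)
qed

section \<open>Embeddings, isomorphisms and parameters\<close>

text \<open>This is the trace: the summands are the conjugates of \<open>lin x y z\<close>, with
  \<open>c\<close> in the role of \<open>b\<close>. The conjugates of \<open>t\<close> are its
  multiples by cube roots of unity, whose sum is 0, and likewise for \<open>u\<close>.\<close>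

lemma sum_cube_roots:
  fixes t :: complex
  assumes "t \<noteq> 0"
  shows "(\<Sum>s | s ^ 3 = t ^ 3. of_rat x + of_rat y * s + of_rat z * (s ^ 2 / c)) = 3 * of_rat x"
proof -
  \<comment> \<open>A primitive cube root of unity.\<close>
  define w where "w = Complex (-1/2) (sqrt 3 / 2)"
  have w: "w ^ 2 = - 1 - w" by (simp add: w_def complex_eq_iff power2_eq_square)
  have ne: "w \<noteq> 1" "w ^ 2 \<noteq> 1" "w ^ 2 \<noteq> w" "w \<noteq> 0"
    unfolding w by (simp_all add: w_def complex_eq_iff)
  have "s ^ 3 = t ^ 3 \<longleftrightarrow> s = t \<or> s = w * t \<or> s = w ^ 2 * t" for s
  proof -
    have "(s - t) * (s - w * t) * (s - w ^ 2 * t) = s ^ 3 - (1 + w + w ^ 2) * s ^ 2 * t + (w + w ^ 2 + w * w ^ 2) * s * t ^ 2 - (w * w ^ 2) * t ^ 3"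
      by (simp add: algebra_simps power2_eq_square power3_eq_cube)
    moreover have "w * w ^ 2 = 1" by (simp add: w_def complex_eq_iff power2_eq_square)
    moreover have "1 + w + w ^ 2 = 0" "w + w ^ 2 + 1 = 0" by (simp_all add: w)
    ultimately have "(s - t) * (s - w * t) * (s - w ^ 2 * t) = s ^ 3 - t ^ 3" by simp
    thus ?thesis by (metis eq_iff_diff_eq_0 mult_eq_0_iff)
  qed
  hence roots: "{s. s ^ 3 = t ^ 3} = {t, w * t, w ^ 2 * t}" by blast
  have "t \<noteq> w * t" "t \<noteq> w ^ 2 * t" "w * t \<noteq> w ^ 2 * t"
    using ne assms by simp_all
  hence "(\<Sum>s | s ^ 3 = t ^ 3. of_rat x + of_rat y * s + of_rat z * (s ^ 2 / c)) =
     3 * of_rat x + of_rat y * ((1 + w + w ^ 2) * t) + of_rat z * ((1 + w ^ 2 + (w ^ 2) ^ 2) * (t ^ 2 / c))"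
    unfolding roots by (simp add: algebra_simps power_mult_distrib add_divide_distrib)
  moreover have "1 + w + w ^ 2 = 0" by (simp add: w)
  moreover have "1 + w ^ 2 + (w ^ 2) ^ 2 = 0"
    by (simp add: w_def complex_eq_iff power2_eq_square power4_eq_xxxx)
  ultimately show ?thesis by simp
qed

context cubic_root
begin

lemma t_nonzero: "t \<noteq> 0"
  using cube by auto

text \<open>Such a map fixes the rationals and satisfies \<open>b * h u = (h t) ^ 2\<close>, so
  \<open>h t\<close> determines it. Stating bare hypotheses on \<open>h\<close> makes the result
  serve both embeddings and isomorphisms onto another subfield.\<close>

lemma hom_lin:
  assumes add: "\<And>x y. x \<in> adjoin t \<Longrightarrow> y \<in> adjoin t \<Longrightarrow> h (x + y) = h x + h y"
    and mult: "\<And>x y. x \<in> adjoin t \<Longrightarrow> y \<in> adjoin t \<Longrightarrow> h (x * y) = h x * h y"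
    and one: "h 1 = (1 :: complex)"
  shows "h (lin x y z) = of_rat x + of_rat y * h t + of_rat z * ((h t) ^ 2 / of_nat b)"
    and "h t ^ 3 = of_nat (a * b ^ 2)"
proof -
  have rat: "h (of_rat q) = of_rat q" for q
    by (rule hom_of_rat[of "adjoin t"]) (simp_all add: add mult one)
  have u: "u \<in> adjoin t" by (subst u_eq_lin) simp
  have "h (of_rat (of_nat b) * u) = of_rat (of_nat b) * h u"
    unfolding mult[OF adjoin_of_rat u] rat ..
  also have "of_rat (of_nat b) * u = t * t" by (simp add: tt)
  finally have hu: "h u = (h t) ^ 2 / of_nat b"
    unfolding mult[OF adjoin_gen adjoin_gen] by (simp add: field_simps power2_eq_square)
  show "h (lin x y z) = of_rat x + of_rat y * h t + of_rat z * ((h t) ^ 2 / of_nat b)"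
    unfolding lin_def using u
    by (simp add: add mult rat hu adjoin_add adjoin_mult)
  have "h (t * (t * t)) = h t * (h t * h t)" by (simp add: mult adjoin_mult)
  also have "t * (t * t) = of_rat (of_nat (a * b ^ 2))"
    unfolding of_rat_of_nat_eq cube[symmetric] by (simp add: power3_eq_cube)
  finally show "h t ^ 3 = of_nat (a * b ^ 2)"
    unfolding rat unfolding of_rat_of_nat_eq by (simp only: power3_eq_cube mult.assoc)
qed

text \<open>The embedding with \<open>t\<close> mapped to \<open>s\<close>. The \<open>THE\<close>
  reads off the coordinates, unique by \<open>lin_eq_iff\<close>; \<open>restrict\<close> makes the
  map extensional, as membership in \<open>embeddings\<close> demands.\<close>

definition emb :: "complex \<Rightarrow> complex \<Rightarrow> complex" where
  "emb s = restrict (\<lambda>v. case (THE (x, y, z). v = lin x y z) of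
      (x, y, z) \<Rightarrow> of_rat x + of_rat y * s + of_rat z * (s ^ 2 / of_nat b)) (adjoin t)"

lemma emb_lin: "emb s (lin x y z) = of_rat x + of_rat y * s + of_rat z * (s ^ 2 / of_nat b)"
proof -
  have "(THE (x', y', z'). lin x y z = lin x' y' z') = (x, y, z)"
    by (rule the_equality) auto
  thus ?thesis by (simp add: emb_def)
qed

lemma emb_t: "emb s t = s"
  by (subst (2) t_eq_lin) (simp add: emb_lin)

lemma other_root: "s ^ 3 = of_nat (a * b ^ 2) \<Longrightarrow> cubic_root a b s"
  using canon by unfold_locales

text \<open>The map keeps the coordinates, and sums and products have the same coordinate formulas
  for every cube root of \<open>a * b ^ 2\<close>.\<close>

lemma emb_hom:
  assumes "s ^ 3 = of_nat (a * b ^ 2)"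
  shows "v \<in> adjoin t \<Longrightarrow> w \<in> adjoin t \<Longrightarrow> emb s (v + w) = emb s v + emb s w"
    and "v \<in> adjoin t \<Longrightarrow> w \<in> adjoin t \<Longrightarrow> emb s (v * w) = emb s v * emb s w"
    and "emb s 1 = 1"
proof -
  interpret s: cubic_root a b s using other_root[OF assms] .
  have eq: "emb s (lin x y z) = s.lin x y z" for x y z
    by (simp add: emb_lin s.lin_def s.u_def)
  show "emb s (v + w) = emb s v + emb s w" if vw: "v \<in> adjoin t" "w \<in> adjoin t"
    using adjoin_cases[OF vw(1)] adjoin_cases[OF vw(2)] by (metis eq lin_add s.lin_add)
  show "emb s (v * w) = emb s v * emb s w" if vw: "v \<in> adjoin t" "w \<in> adjoin t"
    using adjoin_cases[OF vw(1)] adjoin_cases[OF vw(2)] by (metis eq lin_mult s.lin_mult)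
  show "emb s 1 = 1" using emb_lin[of s 1 0 0] by (simp add: lin_def)
qed

lemma embeddings_eq: "embeddings (adjoin t) = emb ` {s. s ^ 3 = of_nat (a * b ^ 2)}"
proof (intro equalityI subsetI)
  fix h assume "h \<in> embeddings (adjoin t)"
  hence h: "h \<in> Ring.ring_hom (CC\<lparr>carrier := adjoin t\<rparr>) CC" "h \<in> extensional (adjoin t)"
    by (simp_all add: embeddings_def)
  have hom: "x \<in> adjoin t \<Longrightarrow> y \<in> adjoin t \<Longrightarrow> h (x + y) = h x + h y"
    "x \<in> adjoin t \<Longrightarrow> y \<in> adjoin t \<Longrightarrow> h (x * y) = h x * h y" "h 1 = 1" for x y
    using h(1) by (simp_all add: Ring.ring_hom_def)
  have "h = emb (h t)"
  proof (rule extensionalityI[OF h(2)])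
    show "emb (h t) \<in> extensional (adjoin t)" by (simp add: emb_def)
    fix v assume "v \<in> adjoin t"
    then obtain x y z where v: "v = lin x y z" by (rule adjoin_cases)
    show "h v = emb (h t) v" unfolding v emb_lin by (rule hom_lin(1)[OF hom])
  qed
  moreover have "h t ^ 3 = of_nat (a * b ^ 2)" by (rule hom_lin(2)[OF hom])
  ultimately show "h \<in> emb ` {s. s ^ 3 = of_nat (a * b ^ 2)}" by blast
next
  fix h assume "h \<in> emb ` {s. s ^ 3 = of_nat (a * b ^ 2)}"
  then obtain s where s: "s ^ 3 = of_nat (a * b ^ 2)" and h: "h = emb s" by blast
  show "h \<in> embeddings (adjoin t)"
    unfolding h embeddings_def Ring.ring_hom_def using emb_hom[OF s] by (simp add: emb_def)
qed

lemma field_trace_lin: "field_trace (adjoin t) (lin x y z) = 3 * of_rat x"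
proof -
  have "inj_on emb {s. s ^ 3 = of_nat (a * b ^ 2)}"
    by (rule inj_onI) (metis emb_t)
  hence "field_trace (adjoin t) (lin x y z) = (\<Sum>s | s ^ 3 = of_nat (a * b ^ 2). emb s (lin x y z))"
    unfolding field_trace_def embeddings_eq by (simp add: sum.reindex)
  thus ?thesis unfolding cube[symmetric] emb_lin using sum_cube_roots[OF t_nonzero] by simp
qed

lemma adjoin_iso:
  assumes "cubic_root a b s"
  shows "field_iso (adjoin t) (adjoin s)"
proof -
  interpret s: cubic_root a b s by fact
  have eq: "emb s (lin x y z) = s.lin x y z" for x y z
    by (simp add: emb_lin s.lin_def s.u_def)
  have "bij_betw (emb s) (adjoin t) (adjoin s)"
  proof (rule bij_betwI')
    fix v w assume "v \<in> adjoin t" "w \<in> adjoin t"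
    thus "(emb s v = emb s w) = (v = w)"
      by (metis adjoin_cases eq lin_eq_iff s.lin_eq_iff)
  next
    fix v assume "v \<in> adjoin t"
    thus "emb s v \<in> adjoin s" by (metis adjoin_cases eq s.lin_in_adjoin)
  next
    fix v assume "v \<in> adjoin s"
    thus "\<exists>x\<in>adjoin t. v = emb s x" by (metis s.adjoin_cases eq lin_in_adjoin)
  qed
  hence "emb s \<in> ring_iso (CC\<lparr>carrier := adjoin t\<rparr>) (CC\<lparr>carrier := adjoin s\<rparr>)"
    unfolding ring_iso_def Ring.ring_hom_def using emb_hom[OF s.cube]
    by (auto simp: bij_betw_def)
  thus ?thesis unfolding field_iso_def is_ring_iso_def by blast
qed

text \<open>An abstract isomorphism sends \<open>t\<close> to another root of the same equation, and
  its image consists of the same coordinate expressions in that root.\<close>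

lemma iso_adjoin:
  assumes "field_iso (adjoin t) L"
  shows "\<exists>s. cubic_root a b s \<and> L = adjoin s"
proof -
  obtain h where h: "h \<in> ring_iso (CC\<lparr>carrier := adjoin t\<rparr>) (CC\<lparr>carrier := L\<rparr>)"
    using assms unfolding field_iso_def is_ring_iso_def by blast
  have hom: "x \<in> adjoin t \<Longrightarrow> y \<in> adjoin t \<Longrightarrow> h (x + y) = h x + h y"
    "x \<in> adjoin t \<Longrightarrow> y \<in> adjoin t \<Longrightarrow> h (x * y) = h x * h y" "h 1 = 1" for x y
    using h by (simp_all add: ring_iso_def Ring.ring_hom_def)
  have bij: "bij_betw h (adjoin t) L" using h by (simp add: ring_iso_def)
  interpret s: cubic_root a b "h t" by (rule other_root) (rule hom_lin(2)[OF hom])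
  have eq: "h (lin x y z) = s.lin x y z" for x y z
    unfolding s.lin_def s.u_def by (rule hom_lin(1)[OF hom])
  have "h ` adjoin t = adjoin (h t)"
  proof (intro equalityI subsetI)
    fix v assume "v \<in> h ` adjoin t"
    thus "v \<in> adjoin (h t)" by (metis adjoin_cases eq imageE s.lin_in_adjoin)
  next
    fix v assume "v \<in> adjoin (h t)"
    thus "v \<in> h ` adjoin t" by (metis s.adjoin_cases eq imageI lin_in_adjoin)
  qed
  thus ?thesis using bij s.cubic_root_axioms by (auto simp: bij_betw_def)
qed

text \<open>Writing \<open>s = lin x y z\<close>, rationality of \<open>s ^ 3\<close> leaves only
  \<open>s = y t\<close> or \<open>s = z u\<close>. The first gives the pair \<open>(a, b)\<close>,
  the second \<open>(b, a)\<close>, which the ordering of canonical pairs rules out.\<close>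

lemma params_unique:
  assumes "cubic_root a' b' s" "adjoin s = adjoin t"
  shows "a' = a" "b' = b"
proof -
  interpret s: cubic_root a' b' s by fact
  obtain x y z where sxyz: "s = lin x y z" using assms(2) adjoin_cases adjoin_gen by metis
  define X1 where "X1 = x * x + of_nat a * of_nat b * (y * z + z * y)"
  define Y1 where "Y1 = x * y + y * x + of_nat a * z * z"
  define Z1 where "Z1 = x * z + z * x + of_nat b * y * y"
  have "lin x y z * (lin x y z * lin x y z) = s ^ 3" unfolding sxyz by (simp add: power3_eq_cube)
  hence "lin x y z * (lin X1 Y1 Z1) = lin (of_nat (a' * b' ^ 2)) 0 0"
    unfolding s.cube lin_mult[of x y z x y z] X1_def Y1_def Z1_def of_rat_eq_lin[symmetric]
      of_rat_of_nat_eq .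
  hence *: "x * X1 + of_nat a * of_nat b * (y * Z1 + z * Y1) = of_nat (a' * b' ^ 2)"
     "x * Y1 + y * X1 + of_nat a * z * Z1 = 0" "x * Z1 + z * X1 + of_nat b * y * Y1 = 0"
    unfolding lin_mult by simp_all
  have E1: "x ^ 2 * y + of_nat a * of_nat b * y ^ 2 * z + of_nat a * x * z ^ 2 = 0"
    using *(2) unfolding X1_def Y1_def Z1_def by (simp add: algebra_simps power2_eq_square)
  have E2: "x ^ 2 * z + of_nat a * of_nat b * y * z ^ 2 + of_nat b * x * y ^ 2 = 0"
    using *(3) unfolding X1_def Y1_def Z1_def by (simp add: algebra_simps power2_eq_square)
  \<comment> \<open>\<open>E1\<close> and \<open>E2\<close> are the \<open>t\<close>- and
    \<open>u\<close>-coordinates of \<open>s ^ 3\<close> divided by 3; this combination eliminates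
    all terms except those with a factor \<open>x\<close>.\<close>
  have "x * (of_nat b * y ^ 3 - of_nat a * z ^ 3) = 
     y * (x ^ 2 * z + of_nat a * of_nat b * y * z ^ 2 + of_nat b * x * y ^ 2)
     - z * (x ^ 2 * y + of_nat a * of_nat b * y ^ 2 * z + of_nat a * x * z ^ 2)"
    by (simp add: algebra_simps power2_eq_square power3_eq_cube)
  hence "x = 0 \<or> of_nat b * y ^ 3 = of_nat a * z ^ 3" unfolding E1 E2 by simp
  moreover have "\<not> of_nat b * y ^ 3 = of_nat a * z ^ 3"
  proof
    assume "of_nat b * y ^ 3 = of_nat a * z ^ 3"
    hence "y = 0" "z = 0" using canonical_pair_no_rat_ratio[OF canon] by blast+
    hence "x ^ 3 = of_nat (a' * b' ^ 2)" using *(1) unfolding X1_def by (simp add: power3_eq_cube)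
    thus False using canonical_pair_no_rat_root[OF s.canon] by blast
  qed
  ultimately have x: "x = 0" by blast
  \<comment> \<open>With \<open>x = 0\<close>, \<open>E1\<close> reduces to
    \<open>a * b * y ^ 2 * z = 0\<close>.\<close>
  have "y = 0 \<or> z = 0" using E1 unfolding x by simp
  hence "a' = a \<and> b' = b"
  proof
    assume "z = 0"
    hence "y ^ 3 * of_nat (a * b ^ 2) = of_nat (a' * b' ^ 2)"
      using *(1) unfolding X1_def Y1_def Z1_def x by (simp add: power3_eq_cube power2_eq_square algebra_simps)
    thus ?thesis using canonical_pair_unique[OF canon, of a' b' y] s.canon
      unfolding canonical_pair_def by blast
  next
    assume y: "y = 0"
    hence eq: "z ^ 3 * of_nat (b * a ^ 2) = of_nat (a' * b' ^ 2)"
      using *(1) unfolding X1_def Y1_def Z1_def x by (simp add: power3_eq_cube power2_eq_square algebra_simps)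
    have "z \<noteq> 0"
    proof
      assume "z = 0"
      hence "of_nat (a' * b' ^ 2) = (0 :: rat)" using eq by simp
      thus False using s.ab_pos by (simp only: of_nat_eq_0_iff) simp
    qed
    hence "(1 / z) ^ 3 * of_nat (a' * b' ^ 2) = of_nat (b * a ^ 2)"
      unfolding eq[symmetric] by (simp add: power_divide)
    moreover have "coprime b a" "squarefree b" "squarefree a" "b < a" "b' < a'"
      using canon s.canon by (auto simp: canonical_pair_def coprime_commute)
    ultimately show ?thesis using canonical_pair_unique[OF s.canon, of b a] by fastforce
  qed
  thus "a' = a" "b' = b" by blast+
qed

lemma cubic_params_adjoin: "cubic_params (adjoin t) = (a, b)"
  unfolding cubic_params_def
proof (rule the_equality, safe)
  have "is_cube_root_field (a * b ^ 2) (adjoin t)"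
    unfolding is_cube_root_field_def using cube by blast
  thus "0 < b" "b < a" "coprime a b" "squarefree a" "squarefree b"
    "is_cube_root_field (a * b ^ 2) (adjoin t)"
    using canon by (simp_all add: canonical_pair_def)
next
  fix a' b' :: nat
  assume "0 < b'" "b' < a'" "coprime a' b'" "squarefree a'" "squarefree b'"
    and "is_cube_root_field (a' * b' ^ 2) (adjoin t)"
  then obtain s where "cubic_root a' b' s" "adjoin s = adjoin t"
    by (auto simp: is_cube_root_field_def cubic_root_def canonical_pair_def)
  thus "a' = a" "b' = b" by (rule params_unique)+
qed

lemma pure_cubic_field_adjoin: "pure_cubic_field (adjoin t)"
  unfolding pure_cubic_field_def is_cube_root_field_def
proof (intro exI conjI)
  show "\<nexists>k. a * b ^ 2 = k ^ 3"
    using canonical_pair_no_rat_root[OF canon] by (metis of_nat_power)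
qed (use cube in auto)

end

text \<open>Induction on the radicand: a cube factor \<open>d ^ 3\<close> is removed by passing to
  \<open>\<alpha> / d\<close>. Once \<open>m\<close> is cube-free, its decomposition into squarefree
  part times a square has coprime squarefree ingredients, which are distinct because
  \<open>m\<close> is not a cube.\<close>

lemma exists_canonical_root:
  fixes \<alpha> :: complex
  assumes "m > 0" "\<nexists>k::nat. m = k ^ 3" "\<alpha> ^ 3 = of_nat m"
  shows "\<exists>a b t. cubic_root a b t \<and> adjoin t = adjoin \<alpha>"
  using assms
proof (induction m arbitrary: \<alpha> rule: less_induct)
  case (less m)
  have \<alpha>0: "\<alpha> \<noteq> 0" using less.prems by auto
  show ?case
  proof (cases "\<exists>d>1. d ^ 3 dvd m")
    case True
    then obtain d m' where d: "d > 1" "m = d ^ 3 * m'" by blast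
    have "m' > 0" using less.prems(1) d by (auto intro: Nat.gr0I)
    moreover have "m' < m" using one_less_power[OF d(1), of 3] \<open>m' > 0\<close> by (simp add: d(2))
    moreover have "\<nexists>k::nat. m' = k ^ 3" using less.prems(2) d(2) by (metis power_mult_distrib)
    moreover have "(\<alpha> / of_nat d) ^ 3 = of_nat m'" using less.prems(3) d
      by (simp add: power_divide)
    ultimately obtain a b t where "cubic_root a b t" "adjoin t = adjoin (\<alpha> / of_nat d)"
      using less.IH by blast
    moreover have "adjoin (\<alpha> / of_nat d) = adjoin \<alpha>"
    proof (rule antisym; rule adjoin_mono)
      show "\<alpha> / of_nat d \<in> adjoin \<alpha>" by (intro adjoin_divide adjoin_gen adjoin_of_nat)
      have "\<alpha> / of_nat d * of_nat d \<in> adjoin (\<alpha> / of_nat d)"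
        by (intro adjoin_mult adjoin_gen adjoin_of_nat)
      thus "\<alpha> \<in> adjoin (\<alpha> / of_nat d)" using d by simp
    qed
    ultimately show ?thesis by auto
  next
    case False
    define s f where "s = square_part m" and "f = squarefree_part m"
    have m: "m = f * s ^ 2" unfolding s_def f_def by (rule squarefree_decompose)
    have pos: "f > 0" "s > 0" using less.prems(1) m by (auto intro!: Nat.gr0I)
    have nop: "\<not> p ^ 3 dvd f * s ^ 2" if "Factorial_Ring.prime p" for p
      using that False m prime_gt_1_nat by blast
    have sqf: "squarefree f" unfolding f_def by simp
    have sqs: "squarefree s"
    proof (rule ccontr)
      assume "\<not> squarefree s"
      then obtain p where p: "Factorial_Ring.prime p" "p ^ 2 dvd s"
        using pos by (auto simp: squarefree_factorial_semiring)
      have "p ^ 3 dvd p ^ 4" by (simp add: le_imp_power_dvd)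
      also have "p ^ 4 = (p ^ 2) ^ 2" by simp
      also have "\<dots> dvd s ^ 2" using p(2) by (rule dvd_power_same)
      also have "\<dots> dvd f * s ^ 2" by simp
      finally show False using nop[OF p(1)] by simp
    qed
    have cop: "coprime f s"
    proof (rule ccontr)
      assume "\<not> coprime f s"
      then obtain p where p: "Factorial_Ring.prime p" "p dvd f" "p dvd s"
        using pos by (metis coprime_iff_gcd_eq_1 gcd_nat.boundedE prime_factor_nat)
      have "p * p ^ 2 dvd f * s ^ 2" using p by (intro mult_dvd_mono dvd_power_same)
      thus False using nop[OF p(1)] by (simp add: power3_eq_cube power2_eq_square mult.assoc)
    qed
    have "f \<noteq> s"
    proof
      assume "f = s"
      hence "m = s ^ 3" using m by (simp add: power3_eq_cube power2_eq_square)
      thus False using less.prems(2) by blast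
    qed
    then consider "s < f" | "f < s" by linarith
    thus ?thesis
    proof cases
      case 1
      hence "cubic_root f s \<alpha>" using less.prems(3) m sqf sqs cop pos
        by unfold_locales (simp_all add: canonical_pair_def)
      thus ?thesis by blast
    next
      case 2
      \<comment> \<open>If the pair comes out in the wrong order, this companion root, with cube
        \<open>s * f ^ 2\<close>, generates the same field: \<open>\<alpha>\<close> is recovered as
        \<open>t ^ 2 / f\<close>.\<close>
      define t where "t = \<alpha> ^ 2 / of_nat s"
      have \<alpha>3: "\<alpha> ^ 3 = of_nat f * of_nat s ^ 2" using less.prems(3) m by simp
      have "t ^ 3 = (\<alpha> ^ 3) ^ 2 / of_nat s ^ 3" by (simp add: t_def power_divide flip: power_mult)
      also have "\<dots> = of_nat (s * f ^ 2)" unfolding \<alpha>3 using pos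
        by (simp add: field_simps power2_eq_square power3_eq_cube)
      finally have "cubic_root s f t" using 2 sqf sqs cop pos
        by unfold_locales (simp_all add: canonical_pair_def coprime_commute)
      moreover have "adjoin t = adjoin \<alpha>"
      proof (rule antisym; rule adjoin_mono)
        show "t \<in> adjoin \<alpha>" unfolding t_def by (intro adjoin_divide adjoin_power adjoin_gen adjoin_of_nat)
        have "t ^ 2 = \<alpha> * \<alpha> ^ 3 / of_nat s ^ 2"
          by (simp add: t_def power_divide power2_eq_square power3_eq_cube)
        hence "t ^ 2 / of_nat f = \<alpha>" unfolding \<alpha>3 using pos by simp
        moreover have "t ^ 2 / of_nat f \<in> adjoin t" by (intro adjoin_divide adjoin_power adjoin_gen adjoin_of_nat)
        ultimately show "\<alpha> \<in> adjoin t" by simp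
      qed
      ultimately show ?thesis by blast
    qed
  qed
qed

lemma pure_cubic_field_iff: "pure_cubic_field K \<longleftrightarrow> (\<exists>a b t. cubic_root a b t \<and> K = adjoin t)"
  using exists_canonical_root cubic_root.pure_cubic_field_adjoin
  unfolding pure_cubic_field_def is_cube_root_field_def by metis

lemma ex_cubic_root: "canonical_pair a b \<Longrightarrow> \<exists>t. cubic_root a b t"
proof (intro exI)
  assume "canonical_pair a b"
  moreover have "complex_of_real (root 3 (real (a * b ^ 2))) ^ 3 = of_nat (a * b ^ 2)"
    unfolding of_real_power[symmetric] by (subst odd_real_root_pow) simp_all
  ultimately show "cubic_root a b (complex_of_real (root 3 (real (a * b ^ 2))))"
    by unfold_locales
qed

lemma pure_cubic_iso_class:
  assumes "pure_cubic_field K"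
  shows "pure_cubic_iso `` {K} = {L. pure_cubic_field L \<and> cubic_params L = cubic_params K}"
proof -
  obtain a b t where t: "cubic_root a b t" "K = adjoin t" using assms pure_cubic_field_iff by blast
  interpret cubic_root a b t by fact
  have "field_iso K L \<longleftrightarrow> cubic_params L = (a, b)" if L: "pure_cubic_field L" for L
  proof
    assume "field_iso K L"
    then obtain s where "cubic_root a b s" "L = adjoin s" using iso_adjoin t(2) by blast
    thus "cubic_params L = (a, b)" by (simp add: cubic_root.cubic_params_adjoin)
  next
    assume *: "cubic_params L = (a, b)"
    obtain a' b' s where s: "cubic_root a' b' s" "L = adjoin s" using L pure_cubic_field_iff by blast
    hence "cubic_root a b s" using * cubic_root.cubic_params_adjoin[OF s(1)] by simp
    thus "field_iso K L" using adjoin_iso s(2) t(2) by blast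
  qed
  thus ?thesis using assms by (auto simp: pure_cubic_iso_def t(2) cubic_params_adjoin)
qed

text \<open>Isomorphism classes are the fibres of \<open>cubic_params\<close>, and every canonical
  pair has a nonempty fibre, so distinct pairs give distinct classes.\<close>

lemma card_pure_cubic_quotient:
  "card ({K. pure_cubic_field K \<and> P (cubic_params K)} // pure_cubic_iso) =
   card {(a, b). canonical_pair a b \<and> P (a, b)}"
proof -
  define F where "F ab = {L. pure_cubic_field L \<and> cubic_params L = ab}" for ab
  have ex: "\<exists>K. pure_cubic_field K \<and> cubic_params K = (a, b)" if "canonical_pair a b" for a b
    using ex_cubic_root[OF that] cubic_root.cubic_params_adjoin cubic_root.pure_cubic_field_adjoin by blast
  have can: "canonical_pair a b" if "pure_cubic_field K" "cubic_params K = (a, b)" for K a b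
    using that pure_cubic_field_iff[of K] cubic_root.cubic_params_adjoin cubic_root.canon by fastforce
  have "{K. pure_cubic_field K \<and> P (cubic_params K)} // pure_cubic_iso =
      (\<lambda>K. F (cubic_params K)) ` {K. pure_cubic_field K \<and> P (cubic_params K)}"
    unfolding quotient_def F_def using pure_cubic_iso_class by blast
  also have "\<dots> = F ` {(a, b). canonical_pair a b \<and> P (a, b)}"
  proof -
    have "cubic_params ` {K. pure_cubic_field K \<and> P (cubic_params K)} = {(a, b). canonical_pair a b \<and> P (a, b)}"
    proof (intro equalityI subsetI)
      fix ab assume "ab \<in> {(a, b). canonical_pair a b \<and> P (a, b)}"
      then obtain K where "pure_cubic_field K" "cubic_params K = ab" "P ab" using ex by blast
      thus "ab \<in> cubic_params ` {K. pure_cubic_field K \<and> P (cubic_params K)}" by blast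
    next
      fix ab assume "ab \<in> cubic_params ` {K. pure_cubic_field K \<and> P (cubic_params K)}"
      then obtain K where "pure_cubic_field K" "cubic_params K = ab" "P ab" by blast
      thus "ab \<in> {(a, b). canonical_pair a b \<and> P (a, b)}" using can by (cases ab) auto
    qed
    thus ?thesis by (simp flip: image_image)
  qed
  finally have "{K. pure_cubic_field K \<and> P (cubic_params K)} // pure_cubic_iso =
    F ` {(a, b). canonical_pair a b \<and> P (a, b)}" .
  moreover have "inj_on F {(a, b). canonical_pair a b \<and> P (a, b)}"
  proof (rule inj_onI)
    fix p q assume "p \<in> {(a, b). canonical_pair a b \<and> P (a, b)}" and eq: "F p = F q"
    then obtain K where "K \<in> F p" using ex unfolding F_def by blast
    thus "p = q" using eq unfolding F_def by blast
  qed
  ultimately show ?thesis by (simp add: card_image)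
qed

section \<open>Integral elements\<close>

lemma common_denominator:
  fixes g :: "rat poly"
  shows "\<exists>c::int. c > 0 \<and> (\<forall>i. of_int c * poly.coeff g i \<in> \<int>)"
proof (induction g rule: pCons_induct)
  case (pCons q g)
  then obtain c :: int where c: "c > 0" "\<And>i. of_int c * poly.coeff g i \<in> \<int>" by blast
  obtain r s where rs: "quotient_of q = (r, s)" by fastforce
  have s: "s > 0" "of_int s * q = of_int r"
    using quotient_of_denom_pos[OF rs] quotient_of_div[OF rs] by (auto simp: field_simps)
  show ?case
  proof (intro exI[of _ "c * s"] conjI allI)
    fix i show "of_int (c * s) * poly.coeff (pCons q g) i \<in> \<int>"
    proof (cases i)
      case 0
      have "of_int (c * s) * q = (of_int (c * r) :: rat)" using s(2) by (simp add: mult.assoc)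
      thus ?thesis using 0 by (metis Ints_of_int coeff_pCons_0)
    next
      case (Suc j)
      have "of_int s * (of_int c * poly.coeff g j) \<in> \<int>" using c(2) by simp
      thus ?thesis using Suc by (simp add: ac_simps)
    qed
  qed (use c s in simp)
qed (auto intro: exI[of _ 1])

text \<open>Gauss's lemma. Clearing denominators gives \<open>c * d * p = G * H\<close> with leading
  coefficients \<open>c\<close> of \<open>G\<close> and \<open>d\<close> of \<open>H\<close>. As
  \<open>p\<close> has content 1, the contents of \<open>G\<close> and \<open>H\<close> multiply to
  \<open>c * d\<close>, while they divide \<open>c\<close> and \<open>d\<close> respectively. Hence
  \<open>c\<close> divides every coefficient of \<open>G\<close>.\<close>

lemma monic_factor_of_int_poly:
  fixes p :: "int poly" and g h :: "rat poly"
  assumes p: "map_poly of_int p = g * h" "Polynomial.lead_coeff p = 1" and g: "Polynomial.lead_coeff g = 1"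
  shows "poly.coeff g i \<in> \<int>"
proof -
  have h: "Polynomial.lead_coeff h = 1"
    using arg_cong[OF p(1), of Polynomial.lead_coeff] p(2) g by (simp add: lead_coeff_mult)
  have ex: "\<exists>c q'. c > 0 \<and> Polynomial.smult (of_int c) q = map_poly of_int q' \<and> Polynomial.lead_coeff q' = c"
    if "Polynomial.lead_coeff q = 1" for q :: "rat poly"
  proof -
    obtain c :: int where c: "c > 0" "\<And>i. of_int c * poly.coeff q i \<in> \<int>" using common_denominator by blast
    define q' where "q' = map_poly floor (Polynomial.smult (of_int c) q)"
    have q': "Polynomial.smult (of_int c) q = map_poly of_int q'"
      by (rule poly_eqI) (use c(2) in \<open>auto simp: q'_def coeff_map_poly elim!: Ints_cases\<close>)
    have "Polynomial.degree q' = Polynomial.degree q"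
      using arg_cong[OF q', of Polynomial.degree] c(1) by simp
    moreover have "of_int (poly.coeff q' (Polynomial.degree q)) = (of_int c :: rat)"
      using arg_cong[OF q', of "\<lambda>f. poly.coeff f (Polynomial.degree q)"] that by (simp add: coeff_map_poly)
    ultimately show ?thesis using c(1) q' by (metis of_int_eq_iff)
  qed
  obtain c G where G: "c > 0" "Polynomial.smult (of_int c) g = map_poly of_int G" "Polynomial.lead_coeff G = c"
    using ex[OF g] by blast
  obtain d H where H: "d > 0" "Polynomial.smult (of_int d) h = map_poly of_int H" "Polynomial.lead_coeff H = d"
    using ex[OF h] by blast
  have "map_poly of_int (Polynomial.smult (c * d) p) = (map_poly of_int (G * H) :: rat poly)"
    unfolding of_int_hom.map_poly_hom_smult of_int_poly_hom.hom_mult G(2)[symmetric] H(2)[symmetric] p(1)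
    by (simp add: mult.commute of_int_hom.hom_mult)
  hence eq: "Polynomial.smult (c * d) p = G * H" by (simp only: of_int_poly_hom.eq_iff)
  have "Polynomial.content p dvd 1" using content_dvd_coeff[of p] p(2) by metis
  hence "Polynomial.content p = 1" by (metis is_unit_normalize normalize_content)
  hence cd: "Polynomial.content G * Polynomial.content H = c * d"
    using arg_cong[OF eq, of Polynomial.content] G(1) H(1) by (simp add: content_mult)
  have dvd: "Polynomial.content G dvd c" "Polynomial.content H dvd d"
    using content_dvd_coeff[of G] content_dvd_coeff[of H] G(3) H(3) by metis+
  then obtain k l where kl: "c = Polynomial.content G * k" "d = Polynomial.content H * l" by blast
  have "Polynomial.content G * Polynomial.content H * 1 = Polynomial.content G * Polynomial.content H * (k * l)"
    using cd kl by (simp add: ac_simps)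
  hence "k * l = 1" using cd G(1) H(1) by (subst (asm) mult_cancel_left) auto
  hence "k dvd 1" by (metis dvd_triv_left)
  hence "c dvd Polynomial.content G" using kl(1) by (metis dvd_refl mult_dvd_mono mult.right_neutral dvd_mult_unit_iff')
  hence "c dvd poly.coeff G i" using content_dvd_coeff dvd_trans by blast
  then obtain m where m: "poly.coeff G i = c * m" by blast
  have "of_int c * poly.coeff g i = of_int (poly.coeff G i)"
    using arg_cong[OF G(2), of "\<lambda>f. poly.coeff f i"] by (simp add: coeff_map_poly)
  hence "poly.coeff g i = of_int m" using G(1) by (simp add: m)
  thus ?thesis by simp
qed

section \<open>Divisibility by powers of 3 for the norm form\<close>

lemma three_dvd_cube: "(3::int) dvd x ^ 3 \<longleftrightarrow> 3 dvd x"
  by (simp add: prime_dvd_power_iff)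

lemma three_dvd_mult: "(3::int) dvd x * y \<longleftrightarrow> 3 dvd x \<or> 3 dvd y"
  by (rule prime_dvd_mult_iff) simp

text \<open>For nonzero \<open>v\<close> and \<open>w\<close> the 3-adic valuations of the two
  summands are 1 and 2 modulo 3, hence different. No cancellation can occur, and each summand must
  itself be divisible by 27.\<close>

lemma three_dvd_sum_cubes_aux:
  fixes a b v w :: int
  assumes "3 dvd a" "\<not> 9 dvd a" "\<not> 3 dvd b" "27 dvd a * b ^ 2 * v ^ 3 + a ^ 2 * b * w ^ 3"
  shows "3 dvd v \<and> 3 dvd w"
proof -
  obtain a' where a: "a = 3 * a'" using assms(1) by blast
  have a': "\<not> 3 dvd a'" using assms(2) a by auto
  have "3 * 9 dvd 3 * (a' * b ^ 2 * v ^ 3 + 3 * a' ^ 2 * b * w ^ 3)"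
    using assms(4) by (simp add: a power2_eq_square algebra_simps)
  hence 9: "9 dvd a' * b ^ 2 * v ^ 3 + 3 * (a' ^ 2 * b * w ^ 3)"
    by (simp only: dvd_mult_cancel_left mult.assoc) simp
  hence "3 dvd a' * b ^ 2 * v ^ 3 + 3 * (a' ^ 2 * b * w ^ 3)" by (rule dvd_trans[rotated]) simp
  hence "3 dvd a' * b ^ 2 * v ^ 3" by (simp only: dvd_add_left_iff dvd_triv_left)
  hence v: "3 dvd v" using a' assms(3) by (simp add: three_dvd_mult three_dvd_cube power2_eq_square)
  then obtain v' where v': "v = 3 * v'" by blast
  have "a' * b ^ 2 * v ^ 3 = 9 * (3 * a' * b ^ 2 * v' ^ 3)" by (simp add: v' power3_eq_cube)
  hence "9 dvd a' * b ^ 2 * v ^ 3" by (rule dvdI)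
  hence "3 * 3 dvd 3 * (a' ^ 2 * b * w ^ 3)" using 9 by (simp only: dvd_add_right_iff) simp
  hence "3 dvd a' ^ 2 * b * w ^ 3" by (simp only: dvd_mult_cancel_left) simp
  hence "3 dvd w" using a' assms(3) by (simp add: three_dvd_mult three_dvd_cube power2_eq_square)
  with v show ?thesis ..
qed

text \<open>If 3 divides \<open>a\<close> or \<open>b\<close>, the valuation argument applies, with
  the roles exchanged for \<open>b\<close>. Otherwise \<open>3 dvd a * b * v * w\<close> gives one
  of the two divisibilities, and the sum of cubes gives the other.\<close>

lemma three_dvd_sum_cubes:
  fixes a b v w :: int
  assumes "\<not> 9 dvd a" "\<not> 9 dvd b" "\<not> (3 dvd a \<and> 3 dvd b)" "3 dvd a * b * v * w"
    and 27: "27 dvd a * b ^ 2 * v ^ 3 + a ^ 2 * b * w ^ 3"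
  shows "3 dvd v \<and> 3 dvd w"
proof -
  consider "3 dvd a" | "3 dvd b" | "\<not> 3 dvd a" "\<not> 3 dvd b" by blast
  thus ?thesis
  proof cases
    case 1 thus ?thesis using assms three_dvd_sum_cubes_aux by blast
  next
    case 2 
    have "27 dvd b * a ^ 2 * w ^ 3 + b ^ 2 * a * v ^ 3" using 27 by (simp add: algebra_simps)
    thus ?thesis using 2 assms three_dvd_sum_cubes_aux by blast
  next
    case 3
    have cube: "27 dvd x ^ 3" if "3 dvd x" for x :: int using dvd_power_same[OF that, of 3] by simp
    have vw: "3 dvd v \<or> 3 dvd w" using assms(4) 3 by (simp add: three_dvd_mult)
    have "3 dvd w" if "3 dvd v"
    proof -
      have "27 dvd a ^ 2 * b * w ^ 3" using 27 cube[OF that] by (simp add: dvd_add_right_iff)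
      hence "3 dvd a ^ 2 * b * w ^ 3" by (rule dvd_trans[rotated]) simp
      thus ?thesis using 3 by (simp add: three_dvd_mult three_dvd_cube power2_eq_square)
    qed
    moreover have "3 dvd v" if "3 dvd w"
    proof -
      have "27 dvd a * b ^ 2 * v ^ 3" using 27 cube[OF that] by (simp add: dvd_add_left_iff)
      hence "3 dvd a * b ^ 2 * v ^ 3" by (rule dvd_trans[rotated]) simp
      thus ?thesis using 3 by (simp add: three_dvd_mult three_dvd_cube power2_eq_square)
    qed
    ultimately show ?thesis using vw by blast
  qed
qed

text \<open>The last two hypotheses say that the second symmetric function and the norm of an
  element with coordinates \<open>u / 3\<close>, \<open>v / 3\<close>, \<open>w / 3\<close> are
  integers. The second alternative of the conclusion is what permits a genuine denominator
  3.\<close>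

lemma cubic_norm_mod_27:
  fixes a b u v w :: int
  assumes ab: "\<not> 9 dvd a" "\<not> 9 dvd b" "\<not> (3 dvd a \<and> 3 dvd b)"
    and e2: "3 dvd u ^ 2 - a * b * v * w"
    and N: "27 dvd u ^ 3 + a * b ^ 2 * v ^ 3 + a ^ 2 * b * w ^ 3 - 3 * a * b * u * v * w"
  shows "3 dvd u \<and> 3 dvd v \<and> 3 dvd w \<or>
    \<not> 3 dvd a * b \<and> \<not> 3 dvd u \<and> \<not> 3 dvd v \<and> \<not> 3 dvd w \<and>
      9 dvd a * b ^ 2 * v ^ 3 - u ^ 3 \<and> 9 dvd a ^ 2 * b * w ^ 3 - u ^ 3"
proof (cases "3 dvd u")
  case True
  then obtain u' where u': "u = 3 * u'" by blast
  have "3 dvd u ^ 2" using True by (simp add: power2_eq_square)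
  hence e: "3 dvd a * b * v * w" using dvd_diff[OF _ e2, of "u ^ 2"] by simp
  then obtain k where k: "a * b * v * w = 3 * k" by blast
  have "u ^ 3 + a * b ^ 2 * v ^ 3 + a ^ 2 * b * w ^ 3 - 3 * a * b * u * v * w
     = a * b ^ 2 * v ^ 3 + a ^ 2 * b * w ^ 3 + (u ^ 3 - 3 * u * (a * b * v * w))" by (simp add: algebra_simps)
  also have "u ^ 3 - 3 * u * (a * b * v * w) = 27 * (u' ^ 3 - u' * k)" unfolding k u'
    by (simp add: power3_eq_cube algebra_simps)
  finally have "27 dvd (a * b ^ 2 * v ^ 3 + a ^ 2 * b * w ^ 3) + 27 * (u' ^ 3 - u' * k)"
    using N by (simp only:)
  hence "27 dvd a * b ^ 2 * v ^ 3 + a ^ 2 * b * w ^ 3" by (simp only: dvd_add_left_iff dvd_triv_left)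
  thus ?thesis using three_dvd_sum_cubes[OF ab e] True by blast
next
  case False
  define c d e where "c = a * b ^ 2 * v ^ 3" and "d = a ^ 2 * b * w ^ 3" and "e = a * b * v * w"
  have cd: "c * d = e ^ 3" by (simp add: c_def d_def e_def power2_eq_square power3_eq_cube)
  have "\<not> 3 dvd e"
  proof
    assume "3 dvd e"
    hence "3 dvd u ^ 2" using dvd_add[OF e2, of e] by (simp add: e_def)
    thus False using False by (simp add: power2_eq_square three_dvd_mult)
  qed
  hence nd: "\<not> 3 dvd a * b" "\<not> 3 dvd v" "\<not> 3 dvd w" by (auto simp: e_def three_dvd_mult)
  obtain k' where "u ^ 2 - e = 3 * k'" using e2 by (auto simp: e_def)
  then obtain k where k: "e = u ^ 2 + 3 * k" by (intro that[of "- k'"]) simp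
  obtain j where "u ^ 3 + c + d - 3 * u * e = 27 * j" using N by (auto simp: c_def d_def e_def algebra_simps)
  hence j: "c + d = 2 * u ^ 3 + 9 * u * k + 27 * j"
    by (simp add: k algebra_simps power2_eq_square power3_eq_cube)
  \<comment> \<open>The discriminant of the quadratic with roots \<open>c\<close> and
    \<open>d\<close>. Its sum and product of roots are known up to multiples of 9 and 3 by
    \<open>j\<close> and \<open>k\<close>, and the terms not divisible by 27 cancel. A square
    divisible by 27 has a root divisible by 9, so \<open>c - d\<close> joins the congruence for
    \<open>c + d\<close> to determine both modulo 9.\<close>
  have "(c - d) ^ 2 = (c + d) ^ 2 - 4 * (c * d)" by (simp add: algebra_simps power2_eq_square)
  also have "\<dots> = 27 * (27 * j ^ 2 + 4 * u ^ 3 * j + 18 * u * k * j - u ^ 2 * k ^ 2 - 4 * k ^ 3)"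
    unfolding cd j k by (simp add: algebra_simps power2_eq_square power3_eq_cube)
  finally have sq: "27 dvd (c - d) ^ 2" by simp
  hence "3 dvd (c - d) ^ 2" by (rule dvd_trans[rotated]) simp
  hence "3 dvd c - d" by (simp add: power2_eq_square three_dvd_mult)
  then obtain m where m: "c - d = 3 * m" by blast
  have "9 * 3 dvd 9 * m ^ 2" using sq by (simp add: m power2_eq_square)
  hence "3 dvd m ^ 2" by (simp only: dvd_mult_cancel_left) simp
  hence "3 dvd m" by (simp add: power2_eq_square three_dvd_mult)
  then obtain n where n: "m = 3 * n" by blast
  have "2 * (c - u ^ 3) = 9 * (u * k + 3 * j + n)" "2 * (d - u ^ 3) = 9 * (u * k + 3 * j - n)"
    using j m n by (simp_all add: algebra_simps)
  hence "9 dvd 2 * (c - u ^ 3)" "9 dvd 2 * (d - u ^ 3)" by simp_all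
  hence "9 dvd c - u ^ 3" "9 dvd d - u ^ 3" by presburger+
  thus ?thesis using nd False by (simp add: c_def d_def)
qed

context cubic_root
begin

text \<open>Together with the trace \<open>3 * x\<close>, \<open>e2\<close> and \<open>nrm\<close>
  are the elementary symmetric functions of the three conjugates of \<open>lin x y z\<close>;
  \<open>chi\<close> is the resulting characteristic polynomial.\<close>

definition e2 :: "rat \<Rightarrow> rat \<Rightarrow> rat \<Rightarrow> rat" where
  "e2 x y z = 3 * (x ^ 2 - of_nat a * of_nat b * y * z)"

definition nrm :: "rat \<Rightarrow> rat \<Rightarrow> rat \<Rightarrow> rat" where
  "nrm x y z = x ^ 3 + of_nat a * of_nat b ^ 2 * y ^ 3 + of_nat a ^ 2 * of_nat b * z ^ 3
             - 3 * of_nat a * of_nat b * x * y * z"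

definition chi :: "rat \<Rightarrow> rat \<Rightarrow> rat \<Rightarrow> rat poly" where
  "chi x y z = [:- nrm x y z, e2 x y z, - 3 * x, 1:]"

lemma lin_smult: "of_rat c * lin x y z = lin (c * x) (c * y) (c * z)"
  unfolding of_rat_eq_lin lin_mult by simp

lemma chi_root: "poly (map_poly of_rat (chi x y z)) (lin x y z) = 0"
proof -
  have "poly (map_poly of_rat (chi x y z)) (lin x y z) =
     of_rat (- nrm x y z) + lin x y z * (of_rat (e2 x y z) + lin x y z * (of_rat (- 3 * x) + lin x y z))"
    by (simp add: chi_def map_poly_pCons)
  also have "\<dots> = lin 0 0 0"
    unfolding of_rat_eq_lin lin_add lin_mult lin_eq_iff nrm_def e2_def
    by (simp add: algebra_simps power2_eq_square power3_eq_cube)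
  finally show ?thesis by simp
qed

text \<open>An element outside the rationals has degree 3: eliminating \<open>c1\<close> from the
  \<open>t\<close>- and \<open>u\<close>-coordinates leaves
  \<open>c2 * (a * z ^ 3 - b * y ^ 3) = 0\<close>.\<close>

lemma quadratic_root_trivial:
  assumes "y \<noteq> 0 \<or> z \<noteq> 0" "poly (map_poly of_rat r) (lin x y z) = 0" "Polynomial.degree r < 3"
  shows "r = 0"
proof -
  define c0 c1 c2 where "c0 = poly.coeff r 0" and "c1 = poly.coeff r 1" and "c2 = poly.coeff r 2"
  have r: "r = [:c0, c1, c2:]"
  proof (rule poly_eqI)
    fix n show "poly.coeff r n = poly.coeff [:c0, c1, c2:] n"
    proof (cases "n < 3")
      case True
      hence "n = 0 \<or> n = 1 \<or> n = 2" by linarith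
      thus ?thesis by (auto simp: c0_def c1_def c2_def numeral_2_eq_2)
    next
      case False
      thus ?thesis using assms(3) by (simp add: coeff_eq_0)
    qed
  qed
  have "poly (map_poly of_rat [:c0, c1, c2:]) w = of_rat c0 + w * (of_rat c1 + w * of_rat c2)" for w :: complex
    by (simp only: of_rat_hom.map_poly_pCons_hom poly_pCons map_poly_0 poly_0 mult_zero_right add_0_right)
  hence "of_rat c0 + lin x y z * (of_rat c1 + lin x y z * of_rat c2) = 0"
    using assms(2) r by metis
  hence *: "c0 + x * (c1 + x * c2) + of_nat a * of_nat b * (y * (z * c2) + z * (y * c2)) = 0"
    "x * (y * c2) + y * (c1 + x * c2) + of_nat a * z * (z * c2) = 0"
    "x * (z * c2) + z * (c1 + x * c2) + of_nat b * y * (y * c2) = 0"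
    using lin_eq_0D unfolding of_rat_eq_lin lin_mult lin_add by fastforce+
  have "c2 * (of_nat a * z ^ 3 - of_nat b * y ^ 3) =
     z * (x * (y * c2) + y * (c1 + x * c2) + of_nat a * z * (z * c2))
     - y * (x * (z * c2) + z * (c1 + x * c2) + of_nat b * y * (y * c2))"
    by (simp add: algebra_simps power3_eq_cube)
  also have "\<dots> = 0" unfolding * by simp
  finally have "c2 = 0"
    using assms(1) canonical_pair_no_rat_ratio[OF canon, of y z] by auto
  moreover from this have "c1 = 0" using assms(1) *(2,3) by auto
  ultimately show ?thesis using *(1) by (simp add: r)
qed

text \<open>For irrational elements \<open>chi\<close> is the minimal polynomial, so it divides any
  monic integer polynomial with this root and Gauss's lemma applies. For rational elements
  \<open>chi\<close> is a cube of a linear polynomial, whence the separate case.\<close>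

lemma algebraic_int_lin_iff:
  "algebraic_int (lin x y z) \<longleftrightarrow> 3 * x \<in> \<int> \<and> e2 x y z \<in> \<int> \<and> nrm x y z \<in> \<int>"
proof
  assume *: "3 * x \<in> \<int> \<and> e2 x y z \<in> \<int> \<and> nrm x y z \<in> \<int>"
  show "algebraic_int (lin x y z)"
  proof (rule algebraic_int.intros)
    show "poly (map_poly of_rat (chi x y z)) (lin x y z) = 0" by (rule chi_root)
    show "\<forall>i. poly.coeff (map_poly of_rat (chi x y z)) i \<in> (\<int> :: complex set)"
    proof
      fix i
      have "poly.coeff (chi x y z) i \<in> \<int>"
        using * by (auto simp: chi_def coeff_pCons split: nat.split)
      thus "poly.coeff (map_poly of_rat (chi x y z)) i \<in> (\<int> :: complex set)"
        by (auto simp: coeff_map_poly elim!: Ints_cases)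
    qed
  qed (simp add: chi_def map_poly_pCons)
next
  assume int: "algebraic_int (lin x y z)"
  show "3 * x \<in> \<int> \<and> e2 x y z \<in> \<int> \<and> nrm x y z \<in> \<int>"
  proof (cases "y = 0 \<and> z = 0")
    case True
    hence "lin x y z = of_rat x" by (simp add: of_rat_eq_lin)
    hence "algebraic_int (of_rat x :: complex)" using int by simp
    hence "(of_rat x :: complex) \<in> \<int>" by (rule rational_algebraic_int_is_int) simp
    then obtain n where "of_rat x = (of_int n :: complex)" by (auto elim: Ints_cases)
    hence "of_rat x = (of_rat (of_int n) :: complex)" by simp
    hence "x \<in> \<int>" unfolding of_rat_eq_iff by simp
    thus ?thesis using True by (auto simp: e2_def nrm_def)
  next
    case False
    obtain p where p: "poly (map_poly of_int p) (lin x y z) = 0" "Polynomial.lead_coeff p = 1"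
      using int by (auto simp: algebraic_int_altdef_ipoly)
    define P where "P = (map_poly of_int p :: rat poly)"
    have Pc: "map_poly of_rat P = (map_poly of_int p :: complex poly)"
      unfolding P_def by (subst map_poly_map_poly) (simp_all add: o_def)
    interpret h: map_poly_comm_ring_hom "of_rat :: rat \<Rightarrow> complex" ..
    define r where "r = P mod chi x y z"
    have dchi: "Polynomial.degree (chi x y z) = 3" "Polynomial.lead_coeff (chi x y z) = 1" by (simp_all add: chi_def)
    have "P = P div chi x y z * chi x y z + r" by (simp add: r_def)
    hence "map_poly of_rat P = (map_poly of_rat (P div chi x y z) * map_poly of_rat (chi x y z) + map_poly of_rat r :: complex poly)"
      using h.hom_add h.hom_mult by metis
    from arg_cong[OF this, of "\<lambda>q. poly q (lin x y z)"]
    have "poly (map_poly of_rat r) (lin x y z) = 0"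
      unfolding Pc poly_add poly_mult p(1) chi_root by simp
    moreover have "Polynomial.degree r < 3"
      using degree_mod_less[of "chi x y z" P] dchi unfolding r_def by fastforce
    ultimately have "r = 0" using quadratic_root_trivial False by blast
    hence "map_poly of_int p = chi x y z * (P div chi x y z)" unfolding r_def P_def by auto
    hence "poly.coeff (chi x y z) i \<in> \<int>" for i
      using monic_factor_of_int_poly p(2) dchi(2) by blast
    from this[of 0] this[of 1] this[of 2] show ?thesis
      by (simp_all add: chi_def numeral_2_eq_2)
  qed
qed

end

section \<open>Discriminants\<close>

lemma det_2x2:
  fixes A :: "'a :: comm_ring_1 mat"
  assumes "A \<in> carrier_mat 2 2"
  shows "Determinant.det A = A $$ (0,0) * A $$ (1,1) - A $$ (0,1) * A $$ (1,0)"
proof -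
  have 1: "Determinant.det (mat_delete A i 0) = mat_delete A i 0 $$ (0,0)" for i
    using assms by (intro det_single) (simp add: mat_delete_def)
  have "Determinant.det A = A $$ (0,0) * cofactor A 0 0 + A $$ (1,0) * cofactor A 1 0"
    using laplace_expansion_column[OF assms, of 0] by (simp add: numeral_2_eq_2)
  thus ?thesis using assms unfolding cofactor_def 1 by (simp add: mat_delete_def)
qed

lemma det_3x3:
  fixes A :: "'a :: comm_ring_1 mat"
  assumes "A \<in> carrier_mat 3 3"
  shows "Determinant.det A =
    A $$ (0,0) * (A $$ (1,1) * A $$ (2,2) - A $$ (1,2) * A $$ (2,1))
    - A $$ (1,0) * (A $$ (0,1) * A $$ (2,2) - A $$ (0,2) * A $$ (2,1))
    + A $$ (2,0) * (A $$ (0,1) * A $$ (1,2) - A $$ (0,2) * A $$ (1,1))"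
proof -
  have 2: "Determinant.det (mat_delete A i 0) =
     mat_delete A i 0 $$ (0,0) * mat_delete A i 0 $$ (1,1) - mat_delete A i 0 $$ (0,1) * mat_delete A i 0 $$ (1,0)" for i
    using assms by (intro det_2x2) (simp add: mat_delete_def)
  have "Determinant.det A = A $$ (0,0) * cofactor A 0 0 + A $$ (1,0) * cofactor A 1 0 + A $$ (2,0) * cofactor A 2 0"
    using laplace_expansion_column[OF assms, of 0] by (simp add: numeral_3_eq_3 numeral_2_eq_2)
  hence "Determinant.det A =
    A $$ (0,0) * (A $$ (1,1) * A $$ (2,2) - A $$ (1,2) * A $$ (2,1))
    + A $$ (1,0) * (- (A $$ (0,1) * A $$ (2,2) - A $$ (0,2) * A $$ (2,1)))
    + A $$ (2,0) * (A $$ (0,1) * A $$ (1,2) - A $$ (0,2) * A $$ (1,1))"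
    using assms unfolding cofactor_def 2 by (simp add: mat_delete_def numeral_2_eq_2)
  thus ?thesis by (simp only: mult_minus_right add_uminus_conv_diff)
qed

section \<open>Independence of the discriminant from the integral basis\<close>

lemma integral_basis_coords:
  assumes "integral_basis K \<omega>" "x \<in> ring_of_integers K"
  shows "\<exists>c :: nat \<Rightarrow> int. x = (\<Sum>i<length \<omega>. of_int (c i) * \<omega> ! i)"
proof -
  obtain c :: "int list" where "x = (\<Sum>i<length \<omega>. of_int (c ! i) * \<omega> ! i)"
    using assms unfolding integral_basis_def by blast
  thus ?thesis by (intro exI[of _ "\<lambda>i. c ! i"])
qed

lemma integral_basis_coords_unique:
  fixes c d :: "nat \<Rightarrow> int"
  assumes "integral_basis K \<omega>"
    and "(\<Sum>i<length \<omega>. of_int (c i) * \<omega> ! i) = x" "(\<Sum>i<length \<omega>. of_int (d i) * \<omega> ! i) = x"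
    and "x \<in> ring_of_integers K" "i < length \<omega>"
  shows "c i = d i"
proof -
  let ?P = "\<lambda>c. length c = length \<omega> \<and> x = (\<Sum>i<length \<omega>. of_int (c ! i) * \<omega> ! i)"
  have "\<exists>!c. ?P c" using assms(1,4) unfolding integral_basis_def by blast
  moreover have "?P (map c [0..<length \<omega>])" "?P (map d [0..<length \<omega>])"
    using assms(2,3) by simp_all
  ultimately have "map c [0..<length \<omega>] = map d [0..<length \<omega>]" by blast
  thus ?thesis using assms(5) by simp
qed

lemma integral_basis_nth: "integral_basis K \<omega> \<Longrightarrow> i < length \<omega> \<Longrightarrow> \<omega> ! i \<in> ring_of_integers K"
  unfolding integral_basis_def using nth_mem by blast

text \<open>The predicate \<open>integral_basis\<close> does not fix the length, so the transition
  matrices may a priori be rectangular; both products being identities is what later forces equal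
  lengths.\<close>

lemma integral_basis_change:
  assumes "integral_basis K \<omega>" "integral_basis K \<omega>'"
  shows "\<exists>(A :: nat \<Rightarrow> nat \<Rightarrow> int) (B :: nat \<Rightarrow> nat \<Rightarrow> int).
      (\<forall>j<length \<omega>'. \<omega>' ! j = (\<Sum>i<length \<omega>. of_int (A i j) * \<omega> ! i)) \<and>
      (\<forall>i<length \<omega>. \<forall>k<length \<omega>. (\<Sum>j<length \<omega>'. A i j * B j k) = (if i = k then 1 else 0)) \<and>
      (\<forall>j<length \<omega>'. \<forall>k<length \<omega>'. (\<Sum>i<length \<omega>. B j i * A i k) = (if j = k then 1 else 0))"
proof -
  have inv: "(\<Sum>j<length \<omega>'. A i j * B j k) = (if i = k then 1 else 0)"
    if b: "integral_basis K \<omega>" "integral_basis K \<omega>'"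
    and A: "\<And>j. j < length \<omega>' \<Longrightarrow> \<omega>' ! j = (\<Sum>i<length \<omega>. of_int (A i j) * \<omega> ! i)"
    and B: "\<And>k. k < length \<omega> \<Longrightarrow> \<omega> ! k = (\<Sum>j<length \<omega>'. of_int (B j k) * \<omega>' ! j)"
    and i: "i < length \<omega>" "k < length \<omega>" for \<omega> \<omega>' i k and A B :: "nat \<Rightarrow> nat \<Rightarrow> int"
  proof (rule integral_basis_coords_unique[OF b(1) _ _ integral_basis_nth[OF b(1) i(2)] i(1)])
    have "\<omega> ! k = (\<Sum>j<length \<omega>'. \<Sum>i<length \<omega>. of_int (A i j * B j k) * \<omega> ! i)"
      unfolding B[OF i(2)] using A by (simp add: sum_distrib_left algebra_simps)
    also have "\<dots> = (\<Sum>i<length \<omega>. of_int (\<Sum>j<length \<omega>'. A i j * B j k) * \<omega> ! i)"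
      by (subst sum.swap) (simp add: sum_distrib_right)
    finally show "(\<Sum>i<length \<omega>. of_int (\<Sum>j<length \<omega>'. A i j * B j k) * \<omega> ! i) = \<omega> ! k" ..
    have "(\<Sum>i<length \<omega>. of_int (if i = k then 1 else 0) * \<omega> ! i) = (\<Sum>i<length \<omega>. if i = k then \<omega> ! i else 0)"
      by (rule sum.cong) auto
    thus "(\<Sum>i<length \<omega>. of_int (if i = k then 1 else 0) * \<omega> ! i) = \<omega> ! k"
      using i(2) by simp
  qed
  have "\<forall>j. \<exists>c :: nat \<Rightarrow> int. j < length \<omega>' \<longrightarrow> \<omega>' ! j = (\<Sum>i<length \<omega>. of_int (c i) * \<omega> ! i)"
    using integral_basis_coords[OF assms(1)] integral_basis_nth[OF assms(2)] by blast
  then obtain A :: "nat \<Rightarrow> nat \<Rightarrow> int"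
    where A: "\<And>j. j < length \<omega>' \<Longrightarrow> \<omega>' ! j = (\<Sum>i<length \<omega>. of_int (A j i) * \<omega> ! i)" by metis
  have "\<forall>j. \<exists>c :: nat \<Rightarrow> int. j < length \<omega> \<longrightarrow> \<omega> ! j = (\<Sum>i<length \<omega>'. of_int (c i) * \<omega>' ! i)"
    using integral_basis_coords[OF assms(2)] integral_basis_nth[OF assms(1)] by blast
  then obtain B :: "nat \<Rightarrow> nat \<Rightarrow> int"
    where B: "\<And>k. k < length \<omega> \<Longrightarrow> \<omega> ! k = (\<Sum>j<length \<omega>'. of_int (B k j) * \<omega>' ! j)" by metis
  show ?thesis
    by (rule exI[of _ "\<lambda>i j. A j i"], rule exI[of _ "\<lambda>j k. B k j"])
      (use A inv[OF assms A B] inv[OF assms(2,1) B A] in simp)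
qed

definition gram :: "complex set \<Rightarrow> complex list \<Rightarrow> complex mat" where
  "gram K \<omega> = mat (length \<omega>) (length \<omega>) (\<lambda>(i, j). field_trace K (\<omega> ! i * \<omega> ! j))"

context cubic_root
begin

lemma field_trace_add:
  "v \<in> adjoin t \<Longrightarrow> w \<in> adjoin t \<Longrightarrow> field_trace (adjoin t) (v + w) = field_trace (adjoin t) v + field_trace (adjoin t) w"
  by (elim adjoin_cases) (simp add: lin_add field_trace_lin of_rat_add algebra_simps)

lemma field_trace_of_int_mult:
  "v \<in> adjoin t \<Longrightarrow> field_trace (adjoin t) (of_int c * v) = of_int c * field_trace (adjoin t) v"
proof (elim adjoin_cases)
  fix x y z assume v: "v = lin x y z"
  have "of_int c * v = lin (of_int c * x) (of_int c * y) (of_int c * z)"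
    using lin_smult[of "of_int c" x y z] by (simp add: v)
  thus ?thesis by (simp add: v field_trace_lin of_rat_mult)
qed

lemma adjoin_of_int_mult: "v \<in> adjoin t \<Longrightarrow> of_int c * v \<in> adjoin t"
  using adjoin_mult[OF adjoin_of_rat[of "of_int c"]] by simp

lemma field_trace_sum:
  assumes "finite I" "\<And>i. i \<in> I \<Longrightarrow> v i \<in> adjoin t"
  shows "field_trace (adjoin t) (\<Sum>i\<in>I. of_int (c i) * v i) = (\<Sum>i\<in>I. of_int (c i) * field_trace (adjoin t) (v i))
    \<and> (\<Sum>i\<in>I. of_int (c i) * v i) \<in> adjoin t"
  using assms
proof (induction rule: finite_induct)
  case empty
  show ?case using field_trace_lin[of 0 0 0] lin_in_adjoin[of 0 0 0] by simp
next
  case (insert j I)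
  have IH: "field_trace (adjoin t) (\<Sum>i\<in>I. of_int (c i) * v i) = (\<Sum>i\<in>I. of_int (c i) * field_trace (adjoin t) (v i))"
    "(\<Sum>i\<in>I. of_int (c i) * v i) \<in> adjoin t" and vj: "v j \<in> adjoin t"
    using insert by simp_all
  have cvj: "of_int (c j) * v j \<in> adjoin t" using vj by (rule adjoin_of_int_mult)
  have "field_trace (adjoin t) (of_int (c j) * v j + (\<Sum>i\<in>I. of_int (c i) * v i)) =
      of_int (c j) * field_trace (adjoin t) (v j) + (\<Sum>i\<in>I. of_int (c i) * field_trace (adjoin t) (v i))"
    unfolding field_trace_add[OF cvj IH(2)] IH(1) field_trace_of_int_mult[OF vj] ..
  thus ?case unfolding sum.insert[OF insert.hyps] by (rule conjI[OF _ adjoin_add[OF cvj IH(2)]])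
qed

text \<open>The Gram matrices are congruent by an integer matrix of determinant 1 or -1, whose
  square disappears from the determinant.\<close>

lemma det_gram_unique:
  assumes "integral_basis (adjoin t) \<omega>" "integral_basis (adjoin t) \<omega>'"
  shows "Determinant.det (gram (adjoin t) \<omega>) = Determinant.det (gram (adjoin t) \<omega>')"
proof -
  let ?T = "field_trace (adjoin t)"
  obtain A B :: "nat \<Rightarrow> nat \<Rightarrow> int" where
      AB': "(\<forall>j<length \<omega>'. \<omega>' ! j = (\<Sum>i<length \<omega>. of_int (A i j) * \<omega> ! i)) \<and>
      (\<forall>i<length \<omega>. \<forall>k<length \<omega>. (\<Sum>j<length \<omega>'. A i j * B j k) = (if i = k then 1 else 0)) \<and>
      (\<forall>j<length \<omega>'. \<forall>k<length \<omega>'. (\<Sum>i<length \<omega>. B j i * A i k) = (if j = k then 1 else 0))"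
    using integral_basis_change[OF assms] by (elim exE)
  have A: "\<omega>' ! j = (\<Sum>i<length \<omega>. of_int (A i j) * \<omega> ! i)" if "j < length \<omega>'" for j
    using AB' that by blast
  have AB: "(\<Sum>j<length \<omega>'. A i j * B j k) = (if i = k then 1 else 0)" if "i < length \<omega>" "k < length \<omega>" for i k
    using AB' that by blast
  have BA: "(\<Sum>i<length \<omega>. B j i * A i k) = (if j = k then 1 else 0)" if "j < length \<omega>'" "k < length \<omega>'" for j k
    using AB' that by blast
  \<comment> \<open>Equality of the lengths: the traces of \<open>A B\<close> and \<open>B A\<close>
    agree, and both products are identity matrices.\<close>
  have "int (length \<omega>) = (\<Sum>i<length \<omega>. \<Sum>j<length \<omega>'. A i j * B j i)" by (simp add: AB)
  also have "\<dots> = (\<Sum>j<length \<omega>'. \<Sum>i<length \<omega>. B j i * A i j)"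
    by (subst sum.swap) (simp add: mult.commute)
  also have "\<dots> = int (length \<omega>')" by (simp add: BA)
  finally have len: "length \<omega>' = length \<omega>" by simp
  define n where "n = length \<omega>"
  define MA MB where "MA = mat n n (\<lambda>(i, j). A i j)" and "MB = mat n n (\<lambda>(i, j). B i j)"
  have dims: "MA \<in> carrier_mat n n" "MB \<in> carrier_mat n n" by (simp_all add: MA_def MB_def)
  have "MA * MB = 1\<^sub>m n"
    by (rule eq_matI)
      (use AB len in \<open>simp_all add: MA_def MB_def n_def scalar_prod_def atLeast0LessThan\<close>)
  hence "Determinant.det MA * Determinant.det MB = 1"
    using det_mult[OF dims] by simp
  hence "Determinant.det MA = 1 \<or> Determinant.det MA = -1" by (simp only: zmult_eq_1_iff) blast
  hence sq: "Determinant.det MA * Determinant.det MA = 1" by auto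
  define C where "C = map_mat complex_of_int MA"
  have C: "C \<in> carrier_mat n n" using dims by (simp add: C_def)
  have detC: "Determinant.det C * Determinant.det C = 1"
    unfolding C_def of_int_hom.hom_det of_int_mult[symmetric] sq by simp
  define G where "G = gram (adjoin t) \<omega>"
  have G: "G \<in> carrier_mat n n" by (simp add: G_def gram_def n_def)
  have K: "\<omega> ! i \<in> adjoin t" if "i < n" for i
    using integral_basis_nth[OF assms(1)] that by (simp add: n_def ring_of_integers_def)
  have "gram (adjoin t) \<omega>' = transpose_mat C * (G * C)"
  proof (rule eq_matI)
    fix i j assume "i < dim_row (transpose_mat C * (G * C))" "j < dim_col (transpose_mat C * (G * C))"
    hence ij: "i < n" "j < n" using C by simp_all
    have "gram (adjoin t) \<omega>' $$ (i, j) = ?T (\<omega>' ! i * \<omega>' ! j)"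
      using ij by (simp add: gram_def len n_def)
    also have "\<omega>' ! i * \<omega>' ! j = (\<Sum>k<n. of_int (A k i) * (\<Sum>l<n. of_int (A l j) * (\<omega> ! k * \<omega> ! l)))"
      unfolding A[OF ij(1)[unfolded n_def, folded len]] A[OF ij(2)[unfolded n_def, folded len]]
      unfolding sum_product n_def unfolding sum_distrib_left by (intro sum.cong refl) (simp only: mult_ac)
    also have "?T \<dots> = (\<Sum>k<n. of_int (A k i) * ?T (\<Sum>l<n. of_int (A l j) * (\<omega> ! k * \<omega> ! l)))"
      by (intro conjunct1[OF field_trace_sum] conjunct2[OF field_trace_sum] adjoin_mult K) auto
    also have "\<dots> = (\<Sum>k<n. of_int (A k i) * (\<Sum>l<n. of_int (A l j) * ?T (\<omega> ! k * \<omega> ! l)))"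
    proof (rule sum.cong[OF refl])
      fix k assume "k \<in> {..<n}"
      hence "?T (\<Sum>l<n. of_int (A l j) * (\<omega> ! k * \<omega> ! l)) = (\<Sum>l<n. of_int (A l j) * ?T (\<omega> ! k * \<omega> ! l))"
        by (intro conjunct1[OF field_trace_sum] adjoin_mult K) auto
      thus "of_int (A k i) * ?T (\<Sum>l<n. of_int (A l j) * (\<omega> ! k * \<omega> ! l)) =
        of_int (A k i) * (\<Sum>l<n. of_int (A l j) * ?T (\<omega> ! k * \<omega> ! l))" by simp
    qed
    also have "\<dots> = (transpose_mat C * (G * C)) $$ (i, j)"
      using ij C G by (simp add: C_def MA_def G_def gram_def n_def scalar_prod_def atLeast0LessThan mult.commute)
    finally show "gram (adjoin t) \<omega>' $$ (i, j) = (transpose_mat C * (G * C)) $$ (i, j)" .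
  qed (use C len in \<open>simp_all add: gram_def n_def\<close>)
  hence "Determinant.det (gram (adjoin t) \<omega>') = Determinant.det C * (Determinant.det G * Determinant.det C)"
    using C G by (simp add: det_mult[of _ n] det_transpose)
  also have "\<dots> = (Determinant.det C * Determinant.det C) * Determinant.det G" by (simp only: ac_simps)
  finally show ?thesis unfolding detC G_def by simp
qed

lemma discriminant_eqI:
  assumes "integral_basis (adjoin t) \<omega>" "Determinant.det (gram (adjoin t) \<omega>) = of_int d"
  shows "discriminant (adjoin t) = d"
  unfolding discriminant_def gram_def[symmetric]
proof (rule the_equality)
  show "\<exists>\<omega>. integral_basis (adjoin t) \<omega> \<and> of_int d = Determinant.det (gram (adjoin t) \<omega>)"
    using assms by (intro exI[of _ \<omega>]) simp
next
  fix d' assume "\<exists>\<omega>. integral_basis (adjoin t) \<omega> \<and> of_int d' = Determinant.det (gram (adjoin t) \<omega>)"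
  then obtain \<omega>' where "integral_basis (adjoin t) \<omega>'" "of_int d' = Determinant.det (gram (adjoin t) \<omega>')" by blast
  hence "complex_of_int d' = of_int d" using det_gram_unique[OF assms(1)] assms(2) by simp
  thus "d' = d" by simp
qed

text \<open>Made to cover both types: the first vector is \<open>1\<close> or
  \<open>(1 + s t + r u) / 3\<close>. It alone has a rational coordinate, so \<open>x\<close> being
  nonzero gives uniqueness of the coefficients.\<close>

lemma integral_basisI:
  assumes int: "algebraic_int (lin x y z)" "algebraic_int t" "algebraic_int u"
    and span: "\<And>x' y' z'. algebraic_int (lin x' y' z') \<Longrightarrow>
           \<exists>c0 c1 c2 :: int. x' = of_int c0 * x \<and> y' = of_int c0 * y + of_int c1 \<and> z' = of_int c0 * z + of_int c2"
    and "x \<noteq> 0"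
  shows "integral_basis (adjoin t) [lin x y z, t, u]"
proof -
  have sum: "(\<Sum>i<length [lin x y z, t, u]. of_int (c ! i) * [lin x y z, t, u] ! i) =
     lin (of_int (c ! 0) * x) (of_int (c ! 0) * y + of_int (c ! 1)) (of_int (c ! 0) * z + of_int (c ! 2))" for c :: "int list"
    by (simp add: numeral_3_eq_3 lin_def of_rat_mult of_rat_add algebra_simps numeral_2_eq_2)
  have "set [lin x y z, t, u] \<subseteq> ring_of_integers (adjoin t)"
    using int lin_in_adjoin[of 0 0 1] by (auto simp: ring_of_integers_def u_eq_lin[symmetric])
  moreover have "\<exists>!c :: int list. length c = length [lin x y z, t, u] \<and>
       v = (\<Sum>i<length [lin x y z, t, u]. of_int (c ! i) * [lin x y z, t, u] ! i)"
    if "v \<in> ring_of_integers (adjoin t)" for v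
  proof -
    obtain x' y' z' where v: "v = lin x' y' z'" "algebraic_int (lin x' y' z')"
      using \<open>v \<in> ring_of_integers (adjoin t)\<close> by (auto simp: ring_of_integers_def elim: adjoin_cases)
    then obtain c0 c1 c2 :: int where
      c: "x' = of_int c0 * x" "y' = of_int c0 * y + of_int c1" "z' = of_int c0 * z + of_int c2"
      using span by blast
    show ?thesis unfolding sum v(1) lin_eq_iff
    proof (rule ex1I[of _ "[c0, c1, c2]"])
      fix d :: "int list"
      assume d: "length d = length [lin x y z, t, u] \<and> x' = of_int (d ! 0) * x \<and>
         y' = of_int (d ! 0) * y + of_int (d ! 1) \<and> z' = of_int (d ! 0) * z + of_int (d ! 2)"
      hence "d ! 0 = c0" using \<open>x \<noteq> 0\<close> c(1) by simp
      moreover from this have "d ! 1 = c1" "d ! 2 = c2" using c d by simp_all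
      ultimately show "d = [c0, c1, c2]" using d
        by (auto simp: list_eq_iff_nth_eq less_Suc_eq numeral_2_eq_2)
    qed (simp add: c)
  qed
  ultimately show ?thesis unfolding integral_basis_def by blast
qed

text \<open>Subtracting multiples of \<open>t\<close> and \<open>u\<close> from the first vector
  preserves the determinant, so \<open>x\<close> is what matters: \<open>x = 1\<close> gives the
  factor -27 and \<open>x = 1 / 3\<close> the factor -3.\<close>

lemma det_gram:
  "Determinant.det (gram (adjoin t) [lin x y z, t, u]) = - 27 * of_nat a ^ 2 * of_nat b ^ 2 * of_rat x ^ 2"
proof -
  define l where "l = [lin x y z, t, u]"
  have ind: "gram (adjoin t) l $$ (i, j) = field_trace (adjoin t) (l ! i * l ! j)" if "i < 3" "j < 3" for i j
    using that by (simp add: gram_def l_def)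
  have l: "l ! 0 = lin x y z" "l ! 1 = t" "l ! 2 = u" by (simp_all add: l_def)
  have m: "lin x y z * t = lin (of_nat a * of_nat b * z) x (of_nat b * y)"
    "t * lin x y z = lin (of_nat a * of_nat b * z) x (of_nat b * y)"
    "lin x y z * u = lin (of_nat a * of_nat b * y) (of_nat a * z) x"
    "u * lin x y z = lin (of_nat a * of_nat b * y) (of_nat a * z) x"
    "t * t = lin 0 0 (of_nat b)" "u * u = lin 0 (of_nat a) 0"
    "t * u = lin (of_nat a * of_nat b) 0 0" "u * t = lin (of_nat a * of_nat b) 0 0"
    using lin_mult[of x y z 0 1 0] lin_mult[of x y z 0 0 1]
    by (simp_all flip: t_eq_lin u_eq_lin add: mult.commute tt uu tu lin_def of_rat_mult)
  have e: "gram (adjoin t) l $$ (0,0) = 3 * of_rat (x * x + of_nat a * of_nat b * (y * z + z * y))"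
    "gram (adjoin t) l $$ (0,1) = 3 * of_rat (of_nat a * of_nat b * z)"
    "gram (adjoin t) l $$ (0,2) = 3 * of_rat (of_nat a * of_nat b * y)"
    "gram (adjoin t) l $$ (1,0) = 3 * of_rat (of_nat a * of_nat b * z)"
    "gram (adjoin t) l $$ (1,1) = 3 * of_rat 0"
    "gram (adjoin t) l $$ (1,2) = 3 * of_rat (of_nat a * of_nat b)"
    "gram (adjoin t) l $$ (2,0) = 3 * of_rat (of_nat a * of_nat b * y)"
    "gram (adjoin t) l $$ (2,1) = 3 * of_rat (of_nat a * of_nat b)"
    "gram (adjoin t) l $$ (2,2) = 3 * of_rat 0"
    by (simp_all add: ind l l(2)[simplified] m lin_mult[of x y z x y z] field_trace_lin)
  have c: "gram (adjoin t) l \<in> carrier_mat 3 3" unfolding gram_def l_def by (simp add: numeral_3_eq_3)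
  show ?thesis unfolding l_def[symmetric] det_3x3[OF c] e
    by (simp add: of_rat_mult of_rat_add algebra_simps power2_eq_square)
qed

end

section \<open>Cubes modulo 9 and the two kinds of integral basis\<close>

lemma cube_mod_9:
  fixes x :: int
  assumes "\<not> 3 dvd x"
  shows "9 dvd x ^ 3 - 1 \<and> 3 dvd x - 1 \<or> 9 dvd x ^ 3 + 1 \<and> 3 dvd x + 1"
proof -
  define k where "k = x div 3"
  have "x = 3 * k + 1 \<or> x = 3 * k + 2" using assms unfolding k_def by presburger
  thus ?thesis
  proof
    assume x: "x = 3 * k + 1"
    have "x ^ 3 - 1 = 9 * (3 * k ^ 3 + 3 * k ^ 2 + k)" unfolding x
      by (simp add: algebra_simps power2_eq_square power3_eq_cube)
    thus ?thesis using x by simp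
  next
    assume x: "x = 3 * k + 2"
    have "x ^ 3 + 1 = 9 * (3 * k ^ 3 + 6 * k ^ 2 + 4 * k + 1)" unfolding x
      by (simp add: algebra_simps power2_eq_square power3_eq_cube)
    moreover have "x + 1 = 3 * (k + 1)" by (simp add: x)
    ultimately show ?thesis by (metis dvd_triv_left)
  qed
qed

lemma cube_sign_mod_9:
  fixes x :: int
  assumes "\<not> 3 dvd x"
  obtains s :: int where "s = 1 \<or> s = -1" "9 dvd x ^ 3 - s" "3 dvd x - s"
proof (cases "9 dvd x ^ 3 - 1 \<and> 3 dvd x - 1")
  case True thus ?thesis using that[of 1] by simp
next
  case False
  hence "9 dvd x ^ 3 + 1" "3 dvd x + 1" using cube_mod_9[OF assms] by blast+
  thus ?thesis using that[of "-1"] by simp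
qed

text \<open>Characterizes Type II: the prime \<open>3\<close> is then tamely ramified.\<close>

definition tame_pair :: "int \<Rightarrow> int \<Rightarrow> bool" where
  "tame_pair a b \<longleftrightarrow> \<not> 3 dvd a * b \<and> (9 dvd a - b \<or> 9 dvd a + b)"

text \<open>Multiplied by \<open>b\<close>, the congruence involves only cubes besides
  \<open>a\<close> and \<open>b\<close>; cubes prime to 3 are 1 or -1 modulo 9, so \<open>a\<close>
  and \<open>b\<close> agree up to sign.\<close>

lemma tame_pairI:
  fixes a b u v :: int
  assumes ab: "\<not> 3 dvd a * b" and uv: "\<not> 3 dvd u" "\<not> 3 dvd v" and 9: "9 dvd a * b ^ 2 * v ^ 3 - u ^ 3"
  shows "tame_pair a b"
proof -
  have b: "\<not> 3 dvd b" using ab by (simp add: three_dvd_mult)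
  obtain p where p: "p = 1 \<or> p = -1" "9 dvd u ^ 3 - p" by (rule cube_sign_mod_9[OF uv(1)])
  obtain q where q: "q = 1 \<or> q = -1" "9 dvd v ^ 3 - q" by (rule cube_sign_mod_9[OF uv(2)])
  obtain r where r: "r = 1 \<or> r = -1" "9 dvd b ^ 3 - r" by (rule cube_sign_mod_9[OF b])
  have "9 dvd b * (a * b ^ 2 * v ^ 3 - u ^ 3) + b * (u ^ 3 - p) - a * b ^ 3 * (v ^ 3 - q) - a * q * (b ^ 3 - r)"
    by (rule dvd_diff[OF dvd_diff[OF dvd_add[OF dvd_mult[OF 9] dvd_mult[OF p(2)]] dvd_mult[OF q(2)]] dvd_mult[OF r(2)]])
  also have "b * (a * b ^ 2 * v ^ 3 - u ^ 3) + b * (u ^ 3 - p) - a * b ^ 3 * (v ^ 3 - q) - a * q * (b ^ 3 - r) = a * q * r - b * p"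
    by (simp add: algebra_simps power2_eq_square power3_eq_cube)
  finally have *: "9 dvd a * q * r - b * p" .
  have "9 dvd a - b \<or> 9 dvd a + b"
    using * p(1) q(1) r(1) by (elim disjE) (simp_all, presburger+)
  thus ?thesis using ab by (simp add: tame_pair_def)
qed

text \<open>The signs \<open>s\<close> and \<open>r\<close> are the coefficients of the additional
  integral element \<open>(1 + s t + r u) / 3\<close>.\<close>

lemma tame_pairE:
  assumes "tame_pair a b"
  obtains s r :: int where "s = 1 \<or> s = -1" "r = 1 \<or> r = -1" "9 dvd a * b ^ 2 - s" "9 dvd a ^ 2 * b - r"
proof -
  have ab: "\<not> 3 dvd a * b" "9 dvd a - b \<or> 9 dvd a + b" using assms by (simp_all add: tame_pair_def)
  hence b: "\<not> 3 dvd b" by (simp add: three_dvd_mult)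
  obtain q where q: "q = 1 \<or> q = -1" "9 dvd b ^ 3 - q" by (rule cube_sign_mod_9[OF b])
  from ab(2) show ?thesis
  proof
    assume 9: "9 dvd a - b"
    have "9 dvd b ^ 2 * (a - b) + (b ^ 3 - q)" "9 dvd b * (a + b) * (a - b) + (b ^ 3 - q)"
      by (rule dvd_add[OF dvd_mult[OF 9] q(2)])+
    moreover have "b ^ 2 * (a - b) + (b ^ 3 - q) = a * b ^ 2 - q" "b * (a + b) * (a - b) + (b ^ 3 - q) = a ^ 2 * b - q"
      by (simp_all add: algebra_simps power2_eq_square power3_eq_cube)
    ultimately show ?thesis using that[of q q] q(1) by simp
  next
    assume 9: "9 dvd a + b"
    have "9 dvd b ^ 2 * (a + b) - (b ^ 3 - q)" "9 dvd b * (a - b) * (a + b) + (b ^ 3 - q)"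
      by (rule dvd_diff[OF dvd_mult[OF 9] q(2)], rule dvd_add[OF dvd_mult[OF 9] q(2)])
    moreover have "b ^ 2 * (a + b) - (b ^ 3 - q) = a * b ^ 2 - (- q)" "b * (a - b) * (a + b) + (b ^ 3 - q) = a ^ 2 * b - q"
      by (simp_all add: algebra_simps power2_eq_square power3_eq_cube)
    ultimately show ?thesis using that[of "- q" q] q(1) by auto
  qed
qed

lemma canonical_pair_mod_3:
  assumes "canonical_pair a b"
  shows "\<not> (9::int) dvd int a" "\<not> (9::int) dvd int b" "\<not> ((3::int) dvd int a \<and> 3 dvd int b)"
proof -
  have "\<not> (9::nat) dvd a" "\<not> (9::nat) dvd b"
    using assms squarefreeD[of a 3] squarefreeD[of b 3] by (auto simp: canonical_pair_def)
  thus "\<not> (9::int) dvd int a" "\<not> (9::int) dvd int b"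
    using int_dvd_int_iff[of 9 a] int_dvd_int_iff[of 9 b] by simp_all
  have "\<not> ((3::nat) dvd a \<and> 3 dvd b)"
    using assms coprime_common_divisor_nat[of a b 3] by (auto simp: canonical_pair_def)
  thus "\<not> ((3::int) dvd int a \<and> 3 dvd int b)"
    using int_dvd_int_iff[of 3 a] int_dvd_int_iff[of 3 b] by simp
qed

context cubic_root
begin

lemma algebraic_int_t: "algebraic_int t" and algebraic_int_u: "algebraic_int u"
proof -
  have "algebraic_int (lin 0 1 0)" "algebraic_int (lin 0 0 1)"
    unfolding algebraic_int_lin_iff by (auto simp: e2_def nrm_def)
  thus "algebraic_int t" "algebraic_int u" by (simp_all flip: t_eq_lin u_eq_lin)
qed

text \<open>
  The rational numbers \<open>27 a b\<^sup>2 (3y)\<^sup>3\<close> and \<open>27 a\<^sup>2 b (3z)\<^sup>3\<close> are the roots of a monic integer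
  polynomial, hence integers, and \<open>a b\<^sup>2\<close> is cube-free.
\<close>

lemma algebraic_int_lin_nine:
  assumes "algebraic_int (lin x y z)"
  shows "9 * y \<in> \<int>" "9 * z \<in> \<int>"
proof -
  define p q where "p = 3 * y" and "q = 3 * z"
  define A B where "A = of_nat a * of_nat b ^ 2 * p ^ 3" and "B = of_nat a ^ 2 * of_nat b * q ^ 3"
  have int: "3 * x \<in> \<int>" "e2 x y z \<in> \<int>" "nrm x y z \<in> \<int>"
    using assms unfolding algebraic_int_lin_iff by blast+
  define k where "k = 3 * of_nat a * of_nat b * p * q"
  have "k = (3 * x) ^ 2 * 3 - 9 * e2 x y z" by (simp add: k_def e2_def p_def q_def power2_eq_square algebra_simps)
  hence k: "k \<in> \<int>" using int by (metis Ints_diff Ints_mult Ints_numeral Ints_power)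
  have "A + B = 27 * nrm x y z - (3 * x) ^ 3 + 3 * x * k"
    by (simp add: A_def B_def nrm_def k_def p_def q_def power2_eq_square power3_eq_cube algebra_simps)
  hence AB: "A + B \<in> \<int>" using int k by (metis Ints_diff Ints_add Ints_mult Ints_numeral Ints_power)
  have "27 * (A * B) = k ^ 3"
    by (simp add: A_def B_def k_def power2_eq_square power3_eq_cube algebra_simps)
  hence AB3: "27 * (A * B) \<in> \<int>" using k by simp
  have root: "27 * C \<in> \<int>" if "C = A \<or> C = B" for C
  proof (rule rational_algebraic_int_is_int)
    show "algebraic_int (27 * C)"
    proof (rule algebraic_int.intros[where p = "[: 27 * (27 * (A * B)), - 27 * (A + B), 1 :]"])
      show "poly [: 27 * (27 * (A * B)), - 27 * (A + B), 1 :] (27 * C) = 0"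
        using that by (auto simp: algebra_simps)
      show "\<forall>i. poly.coeff [: 27 * (27 * (A * B)), - 27 * (A + B), 1 :] i \<in> \<int>"
        using AB AB3 Ints_mult[of 27 "27 * (A * B)"] Ints_mult[of "- 27" "A + B"]
        by (auto simp: coeff_pCons split: nat.split)
    qed simp
  qed (auto simp: Rats_def)
  have "(9 * y) ^ 3 * of_nat (a * b ^ 2) = 27 * A" "(9 * z) ^ 3 * of_nat (b * a ^ 2) = 27 * B"
    by (simp_all add: A_def B_def p_def q_def power2_eq_square power3_eq_cube algebra_simps)
  moreover have "d = 1" if "d ^ 3 dvd b * a ^ 2" for d
    using cubefree_mult_square[of b a d] canon that by (auto simp: canonical_pair_def coprime_commute)
  ultimately show "9 * y \<in> \<int>" "9 * z \<in> \<int>"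
    using Ints_of_cube_mult_Ints[of "a * b ^ 2" "9 * y"] Ints_of_cube_mult_Ints[of "b * a ^ 2" "9 * z"]
      canonical_pair_cubefree[OF canon] root[of A] root[of B] by metis+
qed

text \<open>With denominators 9, integrality of \<open>e2\<close> and \<open>nrm\<close> makes the
  numerators \<open>l'\<close> and \<open>m'\<close> satisfy the hypotheses of
  \<open>three_dvd_sum_cubes\<close>, which cancels a factor 3. The two divisibilities are the
  integrality conditions for the new numerators.\<close>

lemma algebraic_int_lin_thirds:
  assumes "algebraic_int (lin x y z)"
  obtains k l m :: int where "x = of_int k / 3" "y = of_int l / 3" "z = of_int m / 3"
    and "3 dvd k ^ 2 - int a * int b * l * m"
    and "27 dvd k ^ 3 + int a * int b ^ 2 * l ^ 3 + int a ^ 2 * int b * m ^ 3 - 3 * int a * int b * k * l * m"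
proof -
  have int: "3 * x \<in> \<int>" "e2 x y z \<in> \<int>" "nrm x y z \<in> \<int>"
    using assms unfolding algebraic_int_lin_iff by blast+
  obtain k where k: "3 * x = of_int k" using int(1) by (auto elim: Ints_cases)
  obtain i where i: "e2 x y z = of_int i" using int(2) by (auto elim: Ints_cases)
  obtain j where j: "nrm x y z = of_int j" using int(3) by (auto elim: Ints_cases)
  obtain l' where l': "9 * y = of_int l'" using algebraic_int_lin_nine[OF assms] by (auto elim: Ints_cases)
  obtain m' where m': "9 * z = of_int m'" using algebraic_int_lin_nine[OF assms] by (auto elim: Ints_cases)
  have x: "x = of_int k / 3" and y: "y = of_int l' / 9" and z: "z = of_int m' / 9"
    using k l' m' by (simp_all add: field_simps)
  have "of_int (9 * k ^ 2 - int a * int b * l' * m') = (of_int (27 * i) :: rat)"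
    using i by (simp add: e2_def x y z field_simps power2_eq_square)
  hence E: "9 * k ^ 2 - int a * int b * l' * m' = 27 * i" by (simp only: of_int_eq_iff)
  have "of_int (27 * k ^ 3 + int a * int b ^ 2 * l' ^ 3 + int a ^ 2 * int b * m' ^ 3 - 9 * int a * int b * k * l' * m')
      = (of_int (729 * j) :: rat)"
    using j by (simp add: nrm_def x y z field_simps power2_eq_square power3_eq_cube)
  hence F: "27 * k ^ 3 + int a * int b ^ 2 * l' ^ 3 + int a ^ 2 * int b * m' ^ 3 - 9 * int a * int b * k * l' * m'
     = 729 * j" by (simp only: of_int_eq_iff)
  have "int a * int b * l' * m' = 9 * (k ^ 2 - 3 * i)" using E by simp
  hence d9: "9 dvd int a * int b * l' * m'" by simp
  have "int a * int b ^ 2 * l' ^ 3 + int a ^ 2 * int b * m' ^ 3 = 27 * (27 * j - k ^ 3 + 3 * k * (k ^ 2 - 3 * i))"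
  proof -
    have "int a * int b ^ 2 * l' ^ 3 + int a ^ 2 * int b * m' ^ 3 = 729 * j - 27 * k ^ 3 + 9 * k * (int a * int b * l' * m')"
      using F by (simp add: algebra_simps)
    thus ?thesis unfolding \<open>int a * int b * l' * m' = 9 * (k ^ 2 - 3 * i)\<close> by (simp add: algebra_simps)
  qed
  hence "27 dvd int a * int b ^ 2 * l' ^ 3 + int a ^ 2 * int b * m' ^ 3" by simp
  moreover have "3 dvd int a * int b * l' * m'" using d9 by (rule dvd_trans[rotated]) simp
  ultimately have "3 dvd l' \<and> 3 dvd m'" by (intro three_dvd_sum_cubes[OF canonical_pair_mod_3[OF canon]])
  then obtain l m where lm: "l' = 3 * l" "m' = 3 * m" by blast
  show ?thesis
  proof (rule that[of k l m])
    have "k ^ 2 - int a * int b * l * m = 3 * i" using E by (simp add: lm)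
    thus "3 dvd k ^ 2 - int a * int b * l * m" by simp
    have "k ^ 3 + int a * int b ^ 2 * l ^ 3 + int a ^ 2 * int b * m ^ 3 - 3 * int a * int b * k * l * m = 27 * j"
      using F by (simp add: lm power3_eq_cube)
    thus "27 dvd k ^ 3 + int a * int b ^ 2 * l ^ 3 + int a ^ 2 * int b * m ^ 3 - 3 * int a * int b * k * l * m" by simp
  qed (simp_all add: x y z lm)
qed

lemma of_int_third: "3 dvd k \<Longrightarrow> \<exists>k'. of_int k / 3 = (of_int k' :: rat)"
  by (auto elim!: dvdE)

text \<open>Without tameness the second alternative of \<open>cubic_norm_mod_27\<close> is
  impossible, so all coordinates of integral elements are integers.\<close>

lemma discriminant_wild:
  assumes "\<not> tame_pair (int a) (int b)"
  shows "discriminant (adjoin t) = - 27 * int a ^ 2 * int b ^ 2"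
proof (rule discriminant_eqI)
  show "integral_basis (adjoin t) [lin 1 0 0, t, u]"
  proof (rule integral_basisI)
    show "algebraic_int (lin 1 0 0)" unfolding algebraic_int_lin_iff by (auto simp: e2_def nrm_def)
    fix x y z assume "algebraic_int (lin x y z)"
    then obtain k l m :: int where xyz: "x = of_int k / 3" "y = of_int l / 3" "z = of_int m / 3"
      and *: "3 dvd k ^ 2 - int a * int b * l * m"
      "27 dvd k ^ 3 + int a * int b ^ 2 * l ^ 3 + int a ^ 2 * int b * m ^ 3 - 3 * int a * int b * k * l * m"
      by (rule algebraic_int_lin_thirds)
    have "3 dvd k \<and> 3 dvd l \<and> 3 dvd m"
      using cubic_norm_mod_27[OF canonical_pair_mod_3[OF canon] *] tame_pairI assms by blast
    then obtain k' l' m' where "x = of_int k'" "y = of_int l'" "z = of_int m'"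
      unfolding xyz using of_int_third by meson
    thus "\<exists>c0 c1 c2. x = of_int c0 * 1 \<and> y = of_int c0 * 0 + of_int c1 \<and> z = of_int c0 * 0 + of_int c2"
      by auto
  qed (simp_all add: algebraic_int_t algebraic_int_u)
qed (simp add: det_gram)

text \<open>One further element \<open>(1 + s t + r u) / 3\<close> is integral, and by the
  congruences modulo 9 it accounts for every integral element with denominator 3; the index 3 lowers
  the discriminant by the factor 9.\<close>

lemma discriminant_tame:
  assumes "tame_pair (int a) (int b)"
  shows "discriminant (adjoin t) = - 3 * int a ^ 2 * int b ^ 2"
proof -
  obtain s r :: int where sr: "s = 1 \<or> s = -1" "r = 1 \<or> r = -1"
    and s9: "9 dvd int a * int b ^ 2 - s" and r9: "9 dvd int a ^ 2 * int b - r"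
    by (rule tame_pairE[OF assms])
  have ab3: "\<not> 3 dvd int a * int b" using assms by (simp add: tame_pair_def)
  have ss: "s * s = 1" "r * r = 1" using sr by auto
  obtain i where "int a * int b ^ 2 - s = 9 * i" using s9 by blast
  hence i: "int a * int b ^ 2 = s + 9 * i" by simp
  obtain j where "int a ^ 2 * int b - r = 9 * j" using r9 by blast
  hence j: "int a ^ 2 * int b = r + 9 * j" by simp
  have ab_cube: "(int a * int b) ^ 3 = (s + 9 * i) * (r + 9 * j)"
    unfolding i[symmetric] j[symmetric] by (simp add: power2_eq_square power3_eq_cube)
  obtain q where q: "q = 1 \<or> q = -1" "9 dvd (int a * int b) ^ 3 - q" "3 dvd int a * int b - q"
    by (rule cube_sign_mod_9[OF ab3])
  \<comment> \<open>\<open>(a b) ^ 3\<close> is the product of \<open>a b ^ 2\<close> and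
    \<open>a ^ 2 b\<close>, and the sign of its residue modulo 9 is the residue of
    \<open>a b\<close> modulo 3.\<close>
  have "q = s * r"
  proof -
    have "9 dvd ((int a * int b) ^ 3 - q) - 9 * (s * j + i * r + 9 * i * j)" by (rule dvd_diff[OF q(2) dvd_triv_left])
    also have "\<dots> = s * r - q" unfolding ab_cube by (simp add: algebra_simps)
    finally show ?thesis using q(1) sr by auto
  qed
  obtain k where "int a * int b - q = 3 * k" using q(3) by blast
  hence k: "int a * int b = s * r + 3 * k" using \<open>q = s * r\<close> by simp
  have eq3: "(s * r + 3 * k) ^ 3 = (s + 9 * i) * (r + 9 * j)" using ab_cube unfolding k .
  \<comment> \<open>Comparing the two expansions of \<open>(a b) ^ 3\<close> modulo 27 shows that 3
    divides \<open>s * j + r * i - k\<close>, exactly what integrality of the norm requires.\<close>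
  have "(s * r + 3 * k) ^ 3 = s * r + 9 * k + 27 * (s * r * k ^ 2 + k ^ 3)"
    using sr by (auto simp: power2_eq_square power3_eq_cube algebra_simps)
  hence "9 * (s * j + r * i - k) = 27 * (s * r * k ^ 2 + k ^ 3 - 3 * i * j)"
    using eq3 by (simp add: algebra_simps)
  hence ijk: "s * j + r * i - k = 3 * (s * r * k ^ 2 + k ^ 3 - 3 * i * j)" by simp
  have "algebraic_int (lin (1 / 3) (of_int s / 3) (of_int r / 3))"
    unfolding algebraic_int_lin_iff
  proof (intro conjI)
    have "e2 (1 / 3) (of_int s / 3) (of_int r / 3) = of_int (1 - (int a * int b) * (s * r)) / 3"
      by (simp add: e2_def power2_eq_square field_simps)
    also have "1 - (int a * int b) * (s * r) = 3 * (- k * s * r)"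
      unfolding k using sr by auto
    finally show "e2 (1 / 3) (of_int s / 3) (of_int r / 3) \<in> \<int>" by simp
    have "nrm (1 / 3) (of_int s / 3) (of_int r / 3) =
        of_int (1 + (int a * int b ^ 2) * (s * s * s) + (int a ^ 2 * int b) * (r * r * r) - 3 * (int a * int b) * (s * r)) / 27"
      by (simp add: nrm_def power2_eq_square power3_eq_cube field_simps)
    also have "1 + (int a * int b ^ 2) * (s * s * s) + (int a ^ 2 * int b) * (r * r * r) - 3 * (int a * int b) * (s * r)
       = 9 * (s * r) * (s * j + r * i - k)"
      unfolding i j k using sr by (auto simp: algebra_simps)
    also have "\<dots> = 27 * (s * r * (s * r * k ^ 2 + k ^ 3 - 3 * i * j))" unfolding ijk by simp
    finally show "nrm (1 / 3) (of_int s / 3) (of_int r / 3) \<in> \<int>" by simp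
  qed simp
  hence "integral_basis (adjoin t) [lin (1 / 3) (of_int s / 3) (of_int r / 3), t, u]"
  proof (rule integral_basisI)
    fix x y z assume "algebraic_int (lin x y z)"
    then obtain k l m :: int where xyz: "x = of_int k / 3" "y = of_int l / 3" "z = of_int m / 3"
      and *: "3 dvd k ^ 2 - int a * int b * l * m"
      "27 dvd k ^ 3 + int a * int b ^ 2 * l ^ 3 + int a ^ 2 * int b * m ^ 3 - 3 * int a * int b * k * l * m"
      by (rule algebraic_int_lin_thirds)
    \<comment> \<open>Replacing the cubes by signs turns the congruence modulo 9 into
      \<open>n = w * k\<close> modulo 3. It is applied to \<open>l\<close> with \<open>s\<close> and
      to \<open>m\<close> with \<open>r\<close>, so that subtracting \<open>k\<close> times the
      first basis vector leaves integer coordinates.\<close>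
    have aux: "3 dvd n - w * k" if 9: "9 dvd c * n ^ 3 - k ^ 3" and c: "9 dvd c - w" and w: "w = 1 \<or> w = -1"
      and nk: "\<not> 3 dvd n" "\<not> 3 dvd k" for n c w :: int
    proof -
      obtain p where p: "p = 1 \<or> p = -1" "9 dvd n ^ 3 - p" "3 dvd n - p" by (rule cube_sign_mod_9[OF nk(1)])
      obtain o' where o': "o' = 1 \<or> o' = -1" "9 dvd k ^ 3 - o'" "3 dvd k - o'" by (rule cube_sign_mod_9[OF nk(2)])
      have "9 dvd (c * n ^ 3 - k ^ 3) - (c - w) * n ^ 3 - w * (n ^ 3 - p) + (k ^ 3 - o')"
        by (rule dvd_add[OF dvd_diff[OF dvd_diff[OF 9 dvd_mult2[OF c]] dvd_mult[OF p(2)]] o'(2)])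
      also have "\<dots> = w * p - o'" by (simp add: algebra_simps)
      finally have "o' = w * p" using w p(1) o'(1) by auto
      have "3 dvd (n - p) - w * (k - o')" by (rule dvd_diff[OF p(3) dvd_mult[OF o'(3)]])
      also have "\<dots> = n - w * k" unfolding \<open>o' = w * p\<close> using w by (auto simp: algebra_simps)
      finally show ?thesis .
    qed
    have "3 dvd l - s * k \<and> 3 dvd m - r * k"
      using cubic_norm_mod_27[OF canonical_pair_mod_3[OF canon] *]
    proof
      assume "3 dvd k \<and> 3 dvd l \<and> 3 dvd m"
      thus ?thesis by simp
    next
      assume "\<not> 3 dvd int a * int b \<and> \<not> 3 dvd k \<and> \<not> 3 dvd l \<and> \<not> 3 dvd m \<and>
        9 dvd int a * int b ^ 2 * l ^ 3 - k ^ 3 \<and> 9 dvd int a ^ 2 * int b * m ^ 3 - k ^ 3"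
      thus ?thesis using aux[OF _ s9 sr(1)] aux[OF _ r9 sr(2)] by blast
    qed
    then obtain l' m' where "l - s * k = 3 * l'" "m - r * k = 3 * m'" by blast
    hence lm: "l = s * k + 3 * l'" "m = r * k + 3 * m'" by simp_all
    show "\<exists>c0 c1 c2. x = of_int c0 * (1 / 3) \<and> y = of_int c0 * (of_int s / 3) + of_int c1 \<and>
       z = of_int c0 * (of_int r / 3) + of_int c2"
      by (intro exI[of _ k] exI[of _ l'] exI[of _ m']) (simp add: xyz lm add_divide_distrib mult.commute)
  qed (simp_all add: algebraic_int_t algebraic_int_u)
  thus ?thesis by (rule discriminant_eqI) (simp add: det_gram power2_eq_square of_rat_divide)
qed

lemma ratio_adjoin: "ratio (adjoin t) = of_nat a / of_nat b"
  by (simp add: ratio_def cubic_params_adjoin)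

text \<open>If 3 does not divide \<open>b\<close>, then \<open>b\<close> is itself an admissible
  denominator, and conversely an admissible denominator is invertible modulo 9.\<close>

lemma rat_cong_9_iff:
  assumes "\<not> 3 dvd int b" "e = 1 \<or> e = -1"
  shows "rat_cong (of_nat a / of_nat b) (of_int e) 9 \<longleftrightarrow> 9 dvd int a - e * int b"
proof
  assume "rat_cong (of_nat a / of_nat b) (of_int e) 9"
  then obtain c d where cd: "coprime d 9" "(of_nat a / of_nat b :: rat) - of_int e = of_int (9 * c) / of_int d"
    by (auto simp: rat_cong_def)
  have "d \<noteq> 0" using cd(1) by auto
  hence "of_int (d * (int a - e * int b)) = (of_int (9 * (c * int b)) :: rat)"
    using cd(2) by (simp add: field_simps)
  hence "d * (int a - e * int b) = 9 * (c * int b)" by (simp only: of_int_eq_iff)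
  hence "9 dvd d * (int a - e * int b)" by simp
  moreover have "coprime 9 d" using cd(1) by (simp add: coprime_commute)
  ultimately show "9 dvd int a - e * int b" by (simp only: coprime_dvd_mult_right_iff)
next
  assume "9 dvd int a - e * int b"
  then obtain c where "int a - e * int b = 9 * c" by blast
  hence "of_int (int a - e * int b) = (of_int (9 * c) :: rat)" by simp
  hence "(of_nat a - of_int e * of_nat b :: rat) / of_nat b = of_int (9 * c) / of_int (int b)" by simp
  moreover have "(of_nat a - of_int e * of_nat b :: rat) / of_nat b = of_nat a / of_nat b - of_int e"
    by (simp add: diff_divide_distrib)
  ultimately have "(of_nat a / of_nat b :: rat) - of_int e = of_int (9 * c) / of_int (int b)" by simp
  moreover have "coprime (int b) 9"
  proof -
    have "coprime (int b) 3" using assms(1) prime_imp_coprime[of 3 "int b"] by (simp add: coprime_commute[of 3])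
    hence "coprime (int b) (3 ^ 2)" by (subst coprime_power_right_iff) simp
    thus ?thesis by simp
  qed
  ultimately show "rat_cong (of_nat a / of_nat b) (of_int e) 9" unfolding rat_cong_def by blast
qed

lemma field_type_adjoin: "field_type (adjoin t) = (if tame_pair (int a) (int b) then TypeII else TypeI)"
proof -
  have "3 dvd a * b ^ 2 \<longleftrightarrow> 3 dvd int a * int b"
    using int_dvd_int_iff[of 3 "a * b ^ 2"] by (simp add: three_dvd_mult power2_eq_square)
  thus ?thesis
    using rat_cong_9_iff[of 1] rat_cong_9_iff[of "-1"]
    by (auto simp: field_type_def cubic_params_adjoin ratio_adjoin tame_pair_def three_dvd_mult)
qed

end

section \<open>Lattice points of bounded ratio\<close>

lemma card_residue_class_interval:
  fixes x y :: real and i q :: nat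
  assumes "i < q" "0 \<le> x" "x \<le> y"
  shows "\<bar>real (card {n. n mod q = i \<and> x \<le> real n \<and> real n < y}) - (y - x) / q\<bar> \<le> 1"
proof -
  define \<alpha> \<beta> where "\<alpha> = (x - i) / q" and "\<beta> = (y - i) / q"
  have q: "q > 0" using assms by simp
  have ab: "\<alpha> \<le> \<beta>" using assms q by (simp add: \<alpha>_def \<beta>_def divide_right_mono)
  \<comment> \<open>This makes every index \<open>k\<close> nonnegative, so \<open>nat\<close> loses
    nothing.\<close>
  have "\<alpha> > -1" using assms q by (simp add: \<alpha>_def field_simps)
  hence c0: "\<lceil>\<alpha>\<rceil> \<ge> 0" by linarith
  have "{n. n mod q = i \<and> x \<le> real n \<and> real n < y} = (\<lambda>k. i + q * nat k) ` {\<lceil>\<alpha>\<rceil>..<\<lceil>\<beta>\<rceil>}"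
  proof (intro equalityI subsetI)
    fix n assume "n \<in> {n. n mod q = i \<and> x \<le> real n \<and> real n < y}"
    hence n: "n mod q = i" "x \<le> real n" "real n < y" by auto
    have eq: "n = i + q * (n div q)" using n(1) by (metis mod_mult_div_eq)
    hence r: "real n = real i + real q * real (n div q)" by (metis of_nat_add of_nat_mult)
    have "\<alpha> \<le> real (n div q)" "real (n div q) < \<beta>"
      using n(2,3) q unfolding r by (simp_all add: \<alpha>_def \<beta>_def field_simps)
    hence "int (n div q) \<in> {\<lceil>\<alpha>\<rceil>..<\<lceil>\<beta>\<rceil>}" by (auto simp: ceiling_le_iff less_ceiling_iff)
    thus "n \<in> (\<lambda>k. i + q * nat k) ` {\<lceil>\<alpha>\<rceil>..<\<lceil>\<beta>\<rceil>}" using eq by (intro image_eqI[of _ _ "int (n div q)"]) simp_all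
  next
    fix n assume "n \<in> (\<lambda>k. i + q * nat k) ` {\<lceil>\<alpha>\<rceil>..<\<lceil>\<beta>\<rceil>}"
    then obtain k where "n = i + q * nat k" "k \<in> {\<lceil>\<alpha>\<rceil>..<\<lceil>\<beta>\<rceil>}" by blast
    hence k: "n = i + q * nat k" "\<lceil>\<alpha>\<rceil> \<le> k" "k < \<lceil>\<beta>\<rceil>" by simp_all
    have k': "\<alpha> \<le> real_of_int k" "real_of_int k < \<beta>" "k \<ge> 0" using k c0 by (simp_all add: ceiling_le_iff less_ceiling_iff)
    hence "x \<le> i + q * real_of_int k" "i + q * real_of_int k < y" using q by (simp_all add: \<alpha>_def \<beta>_def field_simps)
    moreover have "real n = i + q * real_of_int k" using k k'(3) by simp
    ultimately show "n \<in> {n. n mod q = i \<and> x \<le> real n \<and> real n < y}" using k(1) assms(1) by simp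
  qed
  moreover have "inj_on (\<lambda>k. i + q * nat k) {\<lceil>\<alpha>\<rceil>..<\<lceil>\<beta>\<rceil>}"
  proof (rule inj_onI)
    fix k l assume "k \<in> {\<lceil>\<alpha>\<rceil>..<\<lceil>\<beta>\<rceil>}" "l \<in> {\<lceil>\<alpha>\<rceil>..<\<lceil>\<beta>\<rceil>}" "i + q * nat k = i + q * nat l"
    thus "k = l" using q c0 eq_nat_nat_iff[of k l] by simp
  qed
  ultimately have "card {n. n mod q = i \<and> x \<le> real n \<and> real n < y} = nat (\<lceil>\<beta>\<rceil> - \<lceil>\<alpha>\<rceil>)"
    by (simp add: card_image)
  moreover have "\<lceil>\<alpha>\<rceil> \<le> \<lceil>\<beta>\<rceil>" using ab by (rule ceiling_mono)
  moreover have "\<beta> - \<alpha> = (y - x) / q" by (simp add: \<alpha>_def \<beta>_def diff_divide_distrib)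
  ultimately show ?thesis by (simp del: of_nat_diff) linarith
qed

text \<open>
  For \<open>s = b / sqrt N\<close>, the interval of admissible \<open>a\<close> has length \<open>sqrt N * slice_profile r1 r2 s\<close>.
\<close>

definition slice_profile :: "real \<Rightarrow> real \<Rightarrow> real \<Rightarrow> real" where
  "slice_profile r1 r2 s =
    (if s \<le> 1 / sqrt r2 then (r2 - r1) * s else if s \<le> 1 / sqrt r1 then 1 / s - r1 * s else 0)"

locale ratio_range =
  fixes r1 r2 :: real
  assumes r1: "1 \<le> r1" and r12: "r1 < r2"
begin

abbreviation g :: "real \<Rightarrow> real" where "g \<equiv> slice_profile r1 r2"

definition region :: "real \<Rightarrow> (nat \<times> nat) set" where
  "region N = {(a, b). r1 * real b \<le> real a \<and> real a < r2 * real b \<and> real a * real b \<le> N}"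

lemma sqrt_bounds: "0 < 1 / sqrt r2" "1 / sqrt r2 < 1 / sqrt r1" "1 / sqrt r1 \<le> 1"
  using r1 r12 by (simp_all add: frac_less2)

text \<open>The upper bound for \<open>a / sqrt N\<close> is \<open>r2 * s\<close> from the ratio
  and \<open>1 / s\<close> from the product; they meet at \<open>1 / sqrt r2\<close>, and the slice
  becomes empty beyond \<open>1 / sqrt r1\<close>.\<close>

lemma g_alt:
  assumes "s > 0"
  shows "g s = max 0 (min (r2 * s) (1 / s) - r1 * s)"
proof -
  have 2: "s \<le> 1 / sqrt r2 \<longleftrightarrow> r2 * s \<le> 1 / s"
  proof -
    have "s \<le> 1 / sqrt r2 \<longleftrightarrow> s * sqrt r2 \<le> 1" using r1 r12 by (simp add: field_simps)
    also have "\<dots> \<longleftrightarrow> (s * sqrt r2) ^ 2 \<le> 1" using assms r1 r12 by (simp add: power_le_one_iff)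
    also have "\<dots> \<longleftrightarrow> r2 * s \<le> 1 / s" using assms r1 r12 by (simp add: field_simps power2_eq_square)
    finally show ?thesis .
  qed
  have 1: "s \<le> 1 / sqrt r1 \<longleftrightarrow> r1 * s \<le> 1 / s"
  proof -
    have "s \<le> 1 / sqrt r1 \<longleftrightarrow> s * sqrt r1 \<le> 1" using r1 by (simp add: field_simps)
    also have "\<dots> \<longleftrightarrow> (s * sqrt r1) ^ 2 \<le> 1" using assms r1 by (simp add: power_le_one_iff)
    also have "\<dots> \<longleftrightarrow> r1 * s \<le> 1 / s" using assms r1 by (simp add: field_simps power2_eq_square)
    finally show ?thesis .
  qed
  have "r1 * s < r2 * s" using assms r12 by simp
  thus ?thesis unfolding slice_profile_def 1 2
    by (auto simp: min_def max_def algebra_simps)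
qed

lemma g_0 [simp]: "g 0 = 0"
  using sqrt_bounds by (simp add: slice_profile_def)

lemma continuous_on_g: "continuous_on {0..c} g"
proof -
  \<comment> \<open>Truncating the denominator from below gives a formula continuous at 0 as well;
    where the truncation acts, the minimum is \<open>r2 * s\<close> anyway.\<close>
  have eq: "max 0 (min (r2 * s) (1 / max s (1 / sqrt r2)) - r1 * s) = g s" if "s \<in> {0..c}" for s
  proof (cases "s = 0")
    case True thus ?thesis using sqrt_bounds r1 r12 by (simp add: max_def min_def)
  next
    case False
    hence s: "s > 0" using that by simp
    have "min (r2 * s) (1 / s) = min (r2 * s) (1 / max s (1 / sqrt r2))"
    proof (cases "s \<le> 1 / sqrt r2")
      case True
      have "s * sqrt r2 \<le> 1" using True r1 r12 by (simp add: field_simps)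
      hence "r2 * s \<le> sqrt r2" using r1 r12 mult_left_mono[of "s * sqrt r2" 1 "sqrt r2"]
        by (simp add: algebra_simps)
      moreover have "sqrt r2 \<le> 1 / s" using \<open>s * sqrt r2 \<le> 1\<close> s by (simp add: field_simps)
      ultimately show ?thesis using True by (simp add: max_def min_def)
    qed (simp add: max_def)
    thus ?thesis using g_alt[OF s] by simp
  qed
  have "continuous_on {0..c} (\<lambda>s. max 0 (min (r2 * s) (1 / max s (1 / sqrt r2)) - r1 * s))"
    using sqrt_bounds by (intro continuous_intros) (auto simp: max_def)
  thus ?thesis by (rule continuous_on_eq) (rule eq)
qed

text \<open>The area of the normalized region. The quadratic terms cancel since
  \<open>r1 * s1 ^ 2 = r2 * s2 ^ 2 = 1\<close>. The endpoint \<open>c\<close> is left free because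
  the Riemann sums below end somewhere between 1 and 2.\<close>

lemma has_integral_g: "c \<ge> 1 \<Longrightarrow> (g has_integral ln (r2 / r1) / 2) {0..c}"
proof -
  assume c: "c \<ge> 1"
  define s1 s2 where "s1 = 1 / sqrt r1" and "s2 = 1 / sqrt r2"
  have s: "0 < s2" "s2 < s1" "s1 \<le> 1" using sqrt_bounds by (simp_all add: s1_def s2_def)
  have sq: "s1 ^ 2 = 1 / r1" "s2 ^ 2 = 1 / r2" using r1 r12 by (simp_all add: s1_def s2_def power_divide)
  have "((\<lambda>s. (r2 - r1) * s) has_integral (r2 - r1) * s2 ^ 2 / 2 - (r2 - r1) * 0 ^ 2 / 2) {0..s2}"
    using s by (intro fundamental_theorem_of_calculus)
      (auto intro!: derivative_eq_intros simp flip: has_real_derivative_iff_has_vector_derivative)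
  hence "(g has_integral (r2 - r1) * s2 ^ 2 / 2 - (r2 - r1) * 0 ^ 2 / 2) {0..s2}"
    by (rule has_integral_eq[rotated]) (auto simp: slice_profile_def s2_def)
  hence 1: "(g has_integral (r2 - r1) * s2 ^ 2 / 2) {0..s2}" by simp
  have "((\<lambda>s. 1 / s - r1 * s) has_integral (ln s1 - r1 * s1 ^ 2 / 2) - (ln s2 - r1 * s2 ^ 2 / 2)) {s2..s1}"
    using s by (intro fundamental_theorem_of_calculus)
      (auto intro!: derivative_eq_intros simp flip: has_real_derivative_iff_has_vector_derivative)
  hence 2: "(g has_integral (ln s1 - r1 * s1 ^ 2 / 2) - (ln s2 - r1 * s2 ^ 2 / 2)) {s2..s1}"
  proof (rule has_integral_eq[rotated])
    fix s assume "s \<in> {s2..s1}"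
    moreover have "(r2 - r1) * s2 = 1 / s2 - r1 * s2"
      using sq(2) s(1) r1 r12 by (simp add: field_simps power2_eq_square)
    ultimately show "1 / s - r1 * s = g s"
      by (cases "s = s2") (auto simp: slice_profile_def s1_def s2_def)
  qed
  have "((\<lambda>s. 0) has_integral 0) {s1..c}" by simp
  hence 3: "(g has_integral 0) {s1..c}"
  proof (rule has_integral_eq[rotated])
    fix s assume "s \<in> {s1..c}"
    moreover have "1 / s1 - r1 * s1 = 0" using sq(1) s r1 by (simp add: field_simps power2_eq_square)
    ultimately show "0 = g s" using s
      by (cases "s = s1") (auto simp: slice_profile_def s1_def s2_def)
  qed
  have 12: "(g has_integral (r2 - r1) * s2 ^ 2 / 2 + ((ln s1 - r1 * s1 ^ 2 / 2) - (ln s2 - r1 * s2 ^ 2 / 2))) {0..s1}"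
    by (rule has_integral_combine[OF _ _ 1 2]) (use s in auto)
  have "(g has_integral (r2 - r1) * s2 ^ 2 / 2 + ((ln s1 - r1 * s1 ^ 2 / 2) - (ln s2 - r1 * s2 ^ 2 / 2)) + 0) {0..c}"
    by (rule has_integral_combine[OF _ _ 12 3]) (use s c in auto)
  moreover have "ln s1 - ln s2 = ln (r2 / r1) / 2"
    using r1 r12 by (simp add: s1_def s2_def ln_div ln_sqrt)
  moreover have "r2 * s2 ^ 2 = 1" "r1 * s1 ^ 2 = 1" unfolding sq using r1 r12 by simp_all
  moreover have "(r2 - r1) * s2 ^ 2 / 2 + ((ln s1 - r1 * s1 ^ 2 / 2) - (ln s2 - r1 * s2 ^ 2 / 2)) + 0
    = (ln s1 - ln s2) + r2 * s2 ^ 2 / 2 - r1 * s1 ^ 2 / 2"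
    by (simp add: left_diff_distrib diff_divide_distrib add_divide_distrib)
  ultimately show ?thesis by (metis (no_types, lifting) add_diff_cancel_right')
qed

text \<open>One unit of error comes from counting a residue class in an interval, the other from
  rounding the bound \<open>a * b \<le> N\<close>.\<close>

lemma card_slice:
  fixes i q b :: nat
  assumes "i < q" "N > 0"
  shows "\<bar>real (card {a. a mod q = i \<and> (a, b) \<in> region N}) - sqrt N * g (b / sqrt N) / q\<bar> \<le> 2"
proof (cases "b = 0")
  case True
  hence "{a. a mod q = i \<and> (a, b) \<in> region N} = {}" by (auto simp: region_def)
  hence "card {a. a mod q = i \<and> (a, b) \<in> region N} = 0" by (simp only: card.empty)
  thus ?thesis using True by simp
next
  case False
  hence b: "real b > 0" by simp
  have q: "q > 0" using assms by simp
  \<comment> \<open>For integers \<open>a\<close>, the closed condition \<open>a \<le> z\<close>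
    becomes strict with \<open>floor z + 1\<close>, as the half-open interval count expects; this
    moves the endpoint by at most 1. The outer maximum gives empty slices
    \<open>y = x\<close>.\<close>
  define x z y where "x = r1 * b" and "z = N / b" and "y = max x (min (r2 * b) (of_int \<lfloor>z\<rfloor> + 1))"
  have x0: "x \<ge> 0" using r1 by (simp add: x_def)
  have le: "real a * b \<le> N \<longleftrightarrow> real a < of_int \<lfloor>z\<rfloor> + 1" for a
  proof -
    have "real a * b \<le> N \<longleftrightarrow> real a \<le> z" using b by (simp add: z_def field_simps)
    also have "\<dots> \<longleftrightarrow> int a \<le> \<lfloor>z\<rfloor>" by (simp add: le_floor_iff)
    also have "\<dots> \<longleftrightarrow> real a < of_int \<lfloor>z\<rfloor> + 1" by linarith
    finally show ?thesis .
  qed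
  have "{a. a mod q = i \<and> (a, b) \<in> region N} = {n. n mod q = i \<and> x \<le> real n \<and> real n < y}"
    unfolding region_def by (auto simp: le x_def y_def)
  hence "\<bar>real (card {a. a mod q = i \<and> (a, b) \<in> region N}) - (y - x) / q\<bar> \<le> 1"
    using card_residue_class_interval[OF assms(1) x0, of y] by (simp add: y_def)
  moreover have "sqrt N * g (b / sqrt N) = max 0 (min (r2 * b) z - x)"
  proof -
    have sN: "sqrt N > 0" using assms by simp
    have "sqrt N * g (b / sqrt N) = sqrt N * max 0 (min (r2 * (b / sqrt N)) (1 / (b / sqrt N)) - r1 * (b / sqrt N))"
      using g_alt b sN by simp
    also have "\<dots> = max 0 (min (r2 * b) (sqrt N * (sqrt N / b)) - r1 * b)"
      using sN by (simp add: max_mult_distrib_left min_mult_distrib_left right_diff_distrib)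
    also have "sqrt N * (sqrt N / b) = z" using assms by (simp add: z_def)
    finally show ?thesis by (simp add: x_def)
  qed
  moreover have "\<bar>(y - x) - max 0 (min (r2 * b) z - x)\<bar> \<le> 1"
    unfolding y_def using floor_correct[of z] by linarith
  hence "\<bar>(y - x) / q - max 0 (min (r2 * b) z - x) / q\<bar> \<le> 1"
  proof -
    assume *: "\<bar>(y - x) - max 0 (min (r2 * b) z - x)\<bar> \<le> 1"
    have "\<bar>(y - x) / q - max 0 (min (r2 * b) z - x) / q\<bar> = \<bar>(y - x) - max 0 (min (r2 * b) z - x)\<bar> / q"
      unfolding diff_divide_distrib[symmetric] by (simp add: abs_divide)
    also have "\<dots> \<le> 1 / 1" by (rule frac_le) (use * q in auto)
    finally show ?thesis by simp
  qed
  moreover have "\<bar>A - C\<bar> \<le> 2" if "\<bar>A - B\<bar> \<le> 1" "\<bar>B - C\<bar> \<le> 1" for A B C :: real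
    using that by linarith
  ultimately show ?thesis by (simp only:)
qed

lemma region_bounds:
  assumes "(a, b) \<in> region N"
  shows "real b \<le> sqrt N" "real a \<le> r2 * sqrt N" "b > 0" "a > 0"
proof -
  have ab: "r1 * real b \<le> real a" "real a < r2 * real b" "real a * real b \<le> N"
    using assms by (auto simp: region_def)
  have "real b \<le> r1 * real b" using r1 mult_right_mono[of 1 r1 "real b"] by simp
  hence ba: "real b \<le> real a" using ab by linarith
  hence "real b ^ 2 \<le> real a * real b" by (simp add: power2_eq_square mult_right_mono)
  hence "real b ^ 2 \<le> N" using ab by linarith
  thus b: "real b \<le> sqrt N" by (simp add: real_le_rsqrt)
  show "real a \<le> r2 * sqrt N" using ab(2) mult_left_mono[OF b, of r2] r1 r12 by linarith
  show "b > 0" using ab by (cases "b = 0") auto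
  thus "a > 0" using ba by linarith
qed

lemma finite_region: "finite (region N)"
proof -
  have "region N \<subseteq> {..nat \<lfloor>r2 * sqrt N\<rfloor>} \<times> {..nat \<lfloor>sqrt N\<rfloor>}"
  proof
    fix p assume p: "p \<in> region N"
    obtain a b where ab: "p = (a, b)" by fastforce
    thus "p \<in> {..nat \<lfloor>r2 * sqrt N\<rfloor>} \<times> {..nat \<lfloor>sqrt N\<rfloor>}"
      using region_bounds(1,2)[of a b N] p by (simp add: le_nat_floor)
  qed
  thus ?thesis by (rule finite_subset) simp
qed

text \<open>The nodes \<open>(j + q * k) / m\<close> lie one in each cell of width
  \<open>q / m\<close>, and the number of cells is just enough to cover the support of
  \<open>g\<close>. Uniform continuity then compares each term with the integral over its
  cell.\<close>

lemma riemann_sum_g: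
  fixes j q :: nat
  assumes "j < q"
  shows "((\<lambda>m. q / m * (\<Sum>k<nat \<lfloor>m / q\<rfloor> + 1. g ((j + q * k) / m))) \<longlongrightarrow> ln (r2 / r1) / 2) at_top"
proof (rule tendstoI)
  fix e :: real assume e: "e > 0"
  \<comment> \<open>All cells lie in \<open>{0..2}\<close> once their width is below 1, so 3 is a
    comfortable bound.\<close>
  have "uniformly_continuous_on {0..3} g"
    by (rule compact_uniformly_continuous[OF continuous_on_g]) simp
  then obtain d where d: "d > 0" "\<And>x y. x \<in> {0..3} \<Longrightarrow> y \<in> {0..3} \<Longrightarrow> dist y x < d \<Longrightarrow> dist (g y) (g x) < e / 3"
    unfolding uniformly_continuous_on_def using e by (metis divide_pos_pos zero_less_numeral)
  have q: "q > 0" using assms by simp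
  have "eventually (\<lambda>m :: real. m > q / d \<and> m > q) at_top"
    by (intro eventually_conj eventually_gt_at_top)
  thus "eventually (\<lambda>m. dist (q / m * (\<Sum>k<nat \<lfloor>m / q\<rfloor> + 1. g ((j + q * k) / m))) (ln (r2 / r1) / 2) < e) at_top"
  proof eventually_elim
    case (elim m)
    hence m: "m > 0" "q / m < d" "q / m < 1" using q d by (auto simp: field_simps intro: less_trans[of 0 "real q" m])
    define h K where "h = q / m" and "K = nat \<lfloor>m / q\<rfloor> + 1"
    have h: "0 < h" "h < d" "h < 1" using m q by (simp_all add: h_def)
    have Kf: "real K = of_int \<lfloor>m / q\<rfloor> + 1" using m q by (simp add: K_def)
    have "m / q < K" "K \<le> m / q + 1" unfolding Kf by linarith+
    hence Kh: "1 \<le> K * h" "K * h \<le> 2" using m q h by (simp_all add: h_def field_simps)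
    have sub: "real k * h \<le> (j + q * k) / m" "(j + q * k) / m \<le> real (Suc k) * h" for k
      using assms m by (simp_all add: h_def field_simps)
    have int: "g integrable_on {real k * h..real (Suc k) * h}" for k
      using h by (intro integrable_continuous_real continuous_on_subset[OF continuous_on_g[of "real (Suc k) * h"]]) auto
    have step: "\<bar>h * g ((j + q * k) / m) - integral {real k * h..real (Suc k) * h} g\<bar> \<le> e / 3 * h"
      if "k < K" for k
    proof -
      have "real (Suc k) * h \<le> K * h" using that h by (intro mult_right_mono) auto
      hence k3: "real (Suc k) * h \<le> 3" using Kh by linarith
      have kh: "real (Suc k) * h - real k * h = h" by (simp add: algebra_simps)
      have "norm (integral {real k * h..real (Suc k) * h} (\<lambda>s. g ((j + q * k) / m) - g s)) \<le> e / 3 * (real (Suc k) * h - real k * h)"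
      proof (rule integral_bound)
        show "real k * h \<le> real (Suc k) * h" using h by (simp add: algebra_simps)
        show "continuous_on {real k * h..real (Suc k) * h} (\<lambda>s. g ((j + q * k) / m) - g s)"
          using h by (intro continuous_intros continuous_on_subset[OF continuous_on_g[of "real (Suc k) * h"]]) auto
        fix s assume s: "s \<in> {real k * h..real (Suc k) * h}"
        have "real k * h \<ge> 0" using h by simp
        have "dist ((j + q * k) / m) s < d"
          using s sub[of k] kh h unfolding dist_real_def by (auto simp: abs_less_iff)
        hence "dist (g ((j + q * k) / m)) (g s) < e / 3"
          using s sub[of k] k3 \<open>real k * h \<ge> 0\<close> by (intro d(2)) auto
        thus "norm (g ((j + q * k) / m) - g s) \<le> e / 3" by (simp add: dist_real_def)
      qed
      moreover have "integral {real k * h..real (Suc k) * h} (\<lambda>s. g ((j + q * k) / m) - g s) =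
          h * g ((j + q * k) / m) - integral {real k * h..real (Suc k) * h} g"
        using h kh int by (subst integral_diff) (auto simp: algebra_simps)
      ultimately show ?thesis unfolding kh by simp
    qed
    have tot: "(\<Sum>k<n. integral {real k * h..real (Suc k) * h} g) = integral {0..real n * h} g" for n
    proof (induction n)
      case (Suc n)
      have "integral {0..real n * h} g + integral {real n * h..real (Suc n) * h} g = integral {0..real (Suc n) * h} g"
      proof (rule Henstock_Kurzweil_Integration.integral_combine)
        show "g integrable_on {0..real (Suc n) * h}" by (intro integrable_continuous_real continuous_on_g)
      qed (use h in \<open>simp_all add: algebra_simps\<close>)
      thus ?case using Suc by simp
    qed simp
    have "integral {0..real K * h} g = ln (r2 / r1) / 2"
      using has_integral_g[OF Kh(1)] by (rule integral_unique)
    hence "h * (\<Sum>k<K. g ((j + q * k) / m)) - ln (r2 / r1) / 2 =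
      (\<Sum>k<K. h * g ((j + q * k) / m) - integral {real k * h..real (Suc k) * h} g)"
      using tot[of K] by (simp add: sum_subtractf sum_distrib_left)
    also have "\<bar>\<dots>\<bar> \<le> (\<Sum>k<K. e / 3 * h)"
      by (rule order_trans[OF sum_abs sum_mono]) (use step in auto)
    also have "\<dots> = e / 3 * (K * h)" by simp
    also have "\<dots> \<le> e / 3 * 2" using Kh e by (intro mult_left_mono) auto
    also have "\<dots> < e" using e by simp
    finally show ?case by (simp add: dist_real_def h_def K_def)
  qed
qed

text \<open>Summing over the slices \<open>b = j + q * k\<close>: there are about
  \<open>sqrt N / q\<close> of them, each with error at most 2, so the total error is
  \<open>o(N)\<close>. One factor \<open>1 / q\<close> comes from the class of \<open>a\<close>, the
  other from the spacing of the slices.\<close>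

lemma card_region_class:
  fixes i j q :: nat
  assumes i: "i < q" and j: "j < q"
  shows "((\<lambda>N. real (card {(a, b). (a, b) \<in> region N \<and> a mod q = i \<and> b mod q = j}) / N)
            \<longlongrightarrow> ln (r2 / r1) / (2 * real q ^ 2)) at_top"
proof -
  have q: "q > 0" using i by simp
  define S where "S m = q / m * (\<Sum>k<nat \<lfloor>m / q\<rfloor> + 1. g ((j + q * k) / m))" for m
  have bound: "\<bar>real (card {(a, b). (a, b) \<in> region N \<and> a mod q = i \<and> b mod q = j}) / N - S (sqrt N) / q ^ 2\<bar>
      \<le> 2 * (sqrt N / q + 1) / N" if N: "N > 0" for N
  proof -
    define m K where "m = sqrt N" and "K = nat \<lfloor>m / q\<rfloor> + 1"
    have m: "m > 0" "m * m = N" using N by (simp_all add: m_def)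
    have K: "real K \<le> m / q + 1" using m q by (simp add: K_def)
    define A where "A k = {a. a mod q = i \<and> (a, j + q * k) \<in> region N}" for k
    have fin: "finite (A k)" for k
    proof (rule finite_subset)
      show "A k \<subseteq> fst ` region N" by (force simp: A_def)
    qed (simp add: finite_region)
    have "{(a, b). (a, b) \<in> region N \<and> a mod q = i \<and> b mod q = j} = (\<lambda>(k, a). (a, j + q * k)) ` (SIGMA k:{..<K}. A k)"
    proof (intro equalityI subsetI)
      fix p assume "p \<in> {(a, b). (a, b) \<in> region N \<and> a mod q = i \<and> b mod q = j}"
      then obtain a b where p: "p = (a, b)" "(a, b) \<in> region N" "a mod q = i" "b mod q = j" by auto
      have b: "b = j + q * (b div q)" using p(4) by (metis mod_mult_div_eq)
      have "real q * real (b div q) \<le> real b"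
        by (metis of_nat_le_iff of_nat_mult times_div_less_eq_dividend)
      hence "real (b div q) \<le> real b / q" using q by (simp add: field_simps)
      also have "\<dots> \<le> m / q" using region_bounds(1)[OF p(2)] by (simp add: m_def divide_right_mono)
      finally have "b div q < K" by (simp add: K_def le_nat_floor less_Suc_eq_le)
      moreover have "a \<in> A (b div q)" using p b by (simp add: A_def)
      ultimately show "p \<in> (\<lambda>(k, a). (a, j + q * k)) ` (SIGMA k:{..<K}. A k)"
        using p(1) b by (intro image_eqI[of _ _ "(b div q, a)"]) auto
    qed (use j in \<open>auto simp: A_def\<close>)
    moreover have "inj_on (\<lambda>(k, a). (a, j + q * k)) (SIGMA k:{..<K}. A k)"
      using q by (auto intro!: inj_onI)
    ultimately have "card {(a, b). (a, b) \<in> region N \<and> a mod q = i \<and> b mod q = j} = (\<Sum>k<K. card (A k))"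
      using fin by (simp add: card_image)
    hence "real (card {(a, b). (a, b) \<in> region N \<and> a mod q = i \<and> b mod q = j}) - (\<Sum>k<K. m * g ((j + q * k) / m) / q)
       = (\<Sum>k<K. real (card (A k)) - m * g ((j + q * k) / m) / q)"
      by (simp add: sum_subtractf)
    also have "\<bar>\<dots>\<bar> \<le> (\<Sum>k<K. 2)"
      by (rule order_trans[OF sum_abs sum_mono])
        (unfold A_def m_def, rule card_slice[OF i N])
    also have "\<dots> \<le> 2 * (m / q + 1)" using K by simp
    finally have *: "\<bar>real (card {(a, b). (a, b) \<in> region N \<and> a mod q = i \<and> b mod q = j}) - (\<Sum>k<K. m * g ((j + q * k) / m) / q)\<bar> \<le> 2 * (m / q + 1)" .
    have "S m / q ^ 2 = (\<Sum>k<K. m * g ((j + q * k) / m) / q) / N"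
      using m q unfolding S_def K_def[symmetric] m(2)[symmetric]
      by (simp add: sum_divide_distrib sum_distrib_left power2_eq_square mult.commute)
    hence "real (card {(a, b). (a, b) \<in> region N \<and> a mod q = i \<and> b mod q = j}) / N - S m / q ^ 2 =
       (real (card {(a, b). (a, b) \<in> region N \<and> a mod q = i \<and> b mod q = j}) - (\<Sum>k<K. m * g ((j + q * k) / m) / q)) / N"
      by (simp add: diff_divide_distrib)
    also have "\<bar>\<dots>\<bar> \<le> 2 * (m / q + 1) / N"
      unfolding abs_divide using * N by (simp add: divide_right_mono)
    finally show ?thesis by (simp add: m_def)
  qed
  have "((\<lambda>N. S (sqrt N) / q ^ 2) \<longlongrightarrow> ln (r2 / r1) / 2 / q ^ 2) at_top"
    unfolding S_def by (intro tendsto_divide tendsto_const filterlim_compose[OF riemann_sum_g[OF j] sqrt_at_top]) (use q in simp)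
  moreover have "((\<lambda>N. real (card {(a, b). (a, b) \<in> region N \<and> a mod q = i \<and> b mod q = j}) / N - S (sqrt N) / q ^ 2) \<longlongrightarrow> 0) at_top"
  proof (rule Lim_null_comparison)
    show "\<forall>\<^sub>F N in at_top. norm (real (card {(a, b). (a, b) \<in> region N \<and> a mod q = i \<and> b mod q = j}) / N - S (sqrt N) / q ^ 2)
        \<le> 2 * (sqrt N / q + 1) / N"
      using eventually_gt_at_top[of 0] by eventually_elim (use bound in simp)
    show "((\<lambda>N. 2 * (sqrt N / q + 1) / N) \<longlongrightarrow> 0) at_top"
    proof -
      have "((\<lambda>N. 2 / q * (sqrt N / N) + 2 / N) \<longlongrightarrow> 2 / q * 0 + 0) at_top"
        by (intro tendsto_add tendsto_mult tendsto_const) real_asymp+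
      moreover have "2 / q * (sqrt N / N) + 2 / N = 2 * (sqrt N / q + 1) / N" for N
        by (simp add: add_divide_distrib distrib_left)
      ultimately show ?thesis by simp
    qed
  qed
  ultimately have "((\<lambda>N. (real (card {(a, b). (a, b) \<in> region N \<and> a mod q = i \<and> b mod q = j}) / N - S (sqrt N) / q ^ 2)
      + S (sqrt N) / q ^ 2) \<longlongrightarrow> 0 + ln (r2 / r1) / 2 / q ^ 2) at_top"
    by (intro tendsto_add)
  thus ?thesis by simp
qed

end

section \<open>The sieve\<close>

definition residue_count :: "nat \<Rightarrow> (nat \<Rightarrow> nat \<Rightarrow> bool) \<Rightarrow> nat" where
  "residue_count q P = card {(i, j). i < q \<and> j < q \<and> P i j}"

definition periodic :: "nat \<Rightarrow> (nat \<Rightarrow> nat \<Rightarrow> bool) \<Rightarrow> bool" where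
  "periodic q P \<longleftrightarrow> (\<forall>a b. P (a mod q) (b mod q) = P a b)"

lemma periodicD: "periodic q P \<Longrightarrow> P (a mod q) (b mod q) = P a b"
  by (simp add: periodic_def)

lemma finite_residue_pairs [simp]: "finite {(i, j). i < (q::nat) \<and> j < q \<and> P i j}"
  by (rule finite_subset[of _ "{..<q} \<times> {..<q}"]) auto

text \<open>The Chinese remainder theorem in both coordinates.\<close>

lemma residue_count_mult:
  assumes "coprime m n" "m > 0" "n > 0" "periodic m P" "periodic n Q"
  shows "residue_count (m * n) (\<lambda>i j. P i j \<and> Q i j) = residue_count m P * residue_count n Q"
proof -
  define F where "F = (\<lambda>(i, j). ((i mod m, j mod m), (i mod n, j mod n)))"
  have uniq: "x = y" if "x < m * n" "y < m * n" "x mod m = y mod m" "x mod n = y mod n" for x y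
    using binary_chinese_remainder_unique_nat[OF assms(1), of "x mod m" "x mod n"] assms(2,3) that
    by (metis cong_def mod_mod_trivial mult_eq_0_iff neq0_conv)
  have ex: "\<exists>x<m * n. x mod m = i \<and> x mod n = j" if "i < m" "j < n" for i j
    using binary_chinese_remainder_unique_nat[OF assms(1), of i j] assms(2,3) that
    by (metis cong_def mod_less neq0_conv)
  have "bij_betw F {(i, j). i < m * n \<and> j < m * n \<and> P i j \<and> Q i j}
      ({(i, j). i < m \<and> j < m \<and> P i j} \<times> {(i, j). i < n \<and> j < n \<and> Q i j})"
    unfolding bij_betw_def
  proof (intro conjI equalityI subsetI)
    show "inj_on F {(i, j). i < m * n \<and> j < m * n \<and> P i j \<and> Q i j}"
      unfolding F_def by (rule inj_onI) (use uniq in auto)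
  next
    fix p assume "p \<in> F ` {(i, j). i < m * n \<and> j < m * n \<and> P i j \<and> Q i j}"
    thus "p \<in> {(i, j). i < m \<and> j < m \<and> P i j} \<times> {(i, j). i < n \<and> j < n \<and> Q i j}"
      using assms by (auto simp: F_def periodicD)
  next
    fix p assume "p \<in> {(i, j). i < m \<and> j < m \<and> P i j} \<times> {(i, j). i < n \<and> j < n \<and> Q i j}"
    then obtain i j k l where p: "p = ((i, j), (k, l))" "i < m" "j < m" "P i j" "k < n" "l < n" "Q k l" by auto
    obtain x where x: "x < m * n" "x mod m = i" "x mod n = k" using ex p by blast
    obtain y where y: "y < m * n" "y mod m = j" "y mod n = l" using ex p by blast
    have "P x y" "Q x y" using p x y periodicD[OF assms(4), of x y] periodicD[OF assms(5), of x y] by simp_all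
    thus "p \<in> F ` {(i, j). i < m * n \<and> j < m * n \<and> P i j \<and> Q i j}"
      using p x y by (intro image_eqI[of _ _ "(x, y)"]) (auto simp: F_def)
  qed
  hence "card {(i, j). i < m * n \<and> j < m * n \<and> P i j \<and> Q i j} =
    card ({(i, j). i < m \<and> j < m \<and> P i j} \<times> {(i, j). i < n \<and> j < n \<and> Q i j})"
    by (rule bij_betw_same_card)
  thus ?thesis unfolding residue_count_def by (simp add: card_cartesian_product)
qed

lemma periodic_mult1: "periodic m P \<Longrightarrow> periodic (m * n) P"
  unfolding periodic_def by (metis mod_mod_cancel dvd_triv_left)

lemma periodic_mult2: "periodic n P \<Longrightarrow> periodic (m * n) P"
  unfolding periodic_def by (metis mod_mod_cancel dvd_triv_right)

lemma periodic_conj: "periodic n P \<Longrightarrow> periodic n Q \<Longrightarrow> periodic n (\<lambda>i j. P i j \<and> Q i j)"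
  unfolding periodic_def by blast

definition good_at :: "nat \<Rightarrow> nat \<Rightarrow> nat \<Rightarrow> bool" where
  "good_at p a b \<longleftrightarrow> \<not> p ^ 2 dvd a \<and> \<not> p ^ 2 dvd b \<and> \<not> (p dvd a \<and> p dvd b)"

lemma periodic_good_at: "periodic (p ^ 2) (good_at p)"
  unfolding periodic_def good_at_def
  by (simp add: dvd_mod_iff power2_eq_square)

text \<open>The bad pairs have a coordinate 0, which happens \<open>2 * p ^ 2 - 1\<close> times, or
  two nonzero coordinates divisible by \<open>p\<close>, which happens \<open>(p - 1) ^ 2\<close>
  times: together \<open>3 * p ^ 2 - 2 * p\<close>. The additive form avoids truncated
  subtraction.\<close>

lemma residue_count_good_at:
  assumes "p > 0"
  shows "residue_count (p ^ 2) (good_at p) + 3 * p ^ 2 = p ^ 4 + 2 * p"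
proof -
  define M where "M = {k * p |k. k < p}"
  have cardM: "card M = p"
  proof -
    have "M = (\<lambda>k. k * p) ` {..<p}" by (auto simp: M_def)
    moreover have "inj_on (\<lambda>k. k * p) {..<p}" using assms by (auto intro: inj_onI)
    ultimately show ?thesis by (simp add: card_image)
  qed
  have M: "{i. i < p ^ 2 \<and> p dvd i} = M" and finM: "finite M"
  proof -
    show "{i. i < p ^ 2 \<and> p dvd i} = M" using assms
      by (auto simp: M_def power2_eq_square elim!: dvdE)
    show "finite M" unfolding M_def by simp
  qed
  have M0: "0 \<in> M" using assms by (auto simp: M_def)
  define U where "U = {..<p ^ 2} \<times> {..<p ^ 2}"
  define B where "B = (M - {0}) \<times> (M - {0}) \<union> ({0} \<times> {..<p ^ 2} \<union> ({..<p ^ 2} - {0}) \<times> {0})"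
  have sub: "B \<subseteq> U" using assms M by (auto simp: B_def U_def)
  have dvd0: "p ^ 2 dvd i \<longleftrightarrow> i = 0" if "i < p ^ 2" for i
    using that nat_dvd_not_less by (cases "i = 0") auto
  have "{(i, j). i < p ^ 2 \<and> j < p ^ 2 \<and> good_at p i j} = U - B"
    using dvd0 assms unfolding B_def U_def good_at_def M[symmetric] by auto
  hence "residue_count (p ^ 2) (good_at p) = card (U - B)" by (simp add: residue_count_def)
  also have "\<dots> = card U - card B" using sub by (intro card_Diff_subset) (auto simp: U_def intro: finite_subset)
  finally have 1: "residue_count (p ^ 2) (good_at p) = p ^ 4 - card B"
    by (simp add: U_def card_cartesian_product flip: power_add)
  have "card B = card ((M - {0}) \<times> (M - {0})) + card ({0} \<times> {..<p ^ 2} \<union> ({..<p ^ 2} - {0}) \<times> {0})"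
    unfolding B_def using finM by (intro card_Un_disjoint) auto
  also have "card ({0} \<times> {..<p ^ 2} \<union> ({..<p ^ 2} - {0}) \<times> {0}) = card ({0::nat} \<times> {..<p ^ 2}) + card (({..<p ^ 2} - {0}) \<times> {0::nat})"
    by (intro card_Un_disjoint) auto
  finally have 2: "card B = (p - 1) * (p - 1) + (p ^ 2 + (p ^ 2 - 1))"
    using M0 cardM finM assms by (simp add: card_cartesian_product card_Diff_singleton)
  have 3: "card B \<le> p ^ 4" using card_mono[OF _ sub] by (simp add: U_def card_cartesian_product flip: power_add)
  obtain r where r: "p = Suc r" using assms by (cases p) auto
  have "card B + 2 * p = 3 * p ^ 2" unfolding 2 by (simp add: r power2_eq_square)
  thus ?thesis using 1 3 by linarith
qed

definition euler_factor :: "nat \<Rightarrow> real" where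
  "euler_factor p = 1 - 3 / real p ^ 2 + 2 / real p ^ 3"

lemma residue_density_good_at:
  "p > 0 \<Longrightarrow> real (residue_count (p ^ 2) (good_at p)) / real (p ^ 2) ^ 2 = euler_factor p"
proof -
  assume p: "p > 0"
  have "real (residue_count (p ^ 2) (good_at p)) = real p ^ 4 + 2 * real p - 3 * real p ^ 2"
    using arg_cong[OF residue_count_good_at[OF p], of real] by simp
  moreover have "(x ^ 4 + 2 * x - 3 * x ^ 2) / (x ^ 2) ^ 2 = 1 - 3 / x ^ 2 + 2 / x ^ 3" if "x > 0" for x :: real
    using that by (simp add: divide_simps power_numeral_reduce) (simp add: algebra_simps)
  ultimately show ?thesis using p by (simp add: euler_factor_def)
qed

text \<open>\<open>W\<close> carries the conditions at a modulus prime to \<open>F\<close>, in the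
  application those modulo 9. Periodicity is proved in the same induction because the product
  formula needs it for the conjunction built so far.\<close>

lemma residue_density_good_primes:
  assumes "finite F" "\<And>p. p \<in> F \<Longrightarrow> Factorial_Ring.prime p" "q > 0" "periodic q W" "\<And>p. p \<in> F \<Longrightarrow> coprime p q"
  shows "real (residue_count (q * (\<Prod>p\<in>F. p ^ 2)) (\<lambda>i j. W i j \<and> (\<forall>p\<in>F. good_at p i j))) / real (q * (\<Prod>p\<in>F. p ^ 2)) ^ 2
     = real (residue_count q W) / real q ^ 2 * (\<Prod>p\<in>F. euler_factor p)
    \<and> periodic (q * (\<Prod>p\<in>F. p ^ 2)) (\<lambda>i j. W i j \<and> (\<forall>p\<in>F. good_at p i j))"
  using assms(1,2,5)
proof (induction F rule: finite_induct)
  case empty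
  thus ?case using assms by simp
next
  case (insert p F)
  define m where "m = q * (\<Prod>p\<in>F. p ^ 2)"
  define V where "V = (\<lambda>i j. W i j \<and> (\<forall>p\<in>F. good_at p i j))"
  have p: "p > 0" using insert.prems by (simp add: prime_gt_0_nat)
  have IH: "real (residue_count m V) / real m ^ 2 = real (residue_count q W) / real q ^ 2 * (\<Prod>p\<in>F. euler_factor p)"
    "periodic m V" using insert unfolding m_def V_def by simp_all
  have mpos: "m > 0" using assms(3) insert unfolding m_def by (auto intro!: prod_pos simp: prime_gt_0_nat)
  have "coprime (p ^ 2) r" if "r \<in> F" for r
    using insert.prems(1) insert.hyps(2) that by (auto intro: primes_coprime)
  hence "coprime (p ^ 2) m" unfolding m_def using insert.prems(2)
    by (auto intro!: prod_coprime_right)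
  hence cop: "coprime m (p ^ 2)" by (simp only: coprime_commute)
  have "residue_count (m * p ^ 2) (\<lambda>i j. V i j \<and> good_at p i j) = residue_count m V * residue_count (p ^ 2) (good_at p)"
    by (rule residue_count_mult[OF cop mpos _ IH(2) periodic_good_at]) (use p in simp)
  moreover have "periodic (m * p ^ 2) (\<lambda>i j. V i j \<and> good_at p i j)"
    by (intro periodic_conj periodic_mult1[OF IH(2)] periodic_mult2 periodic_good_at)
  moreover have e1: "q * (\<Prod>p\<in>insert p F. p ^ 2) = m * p ^ 2" using insert.hyps by (simp add: m_def ac_simps)
  moreover have e2: "(\<lambda>i j. W i j \<and> (\<forall>p\<in>insert p F. good_at p i j)) = (\<lambda>i j. V i j \<and> good_at p i j)"
    by (auto simp: V_def)
  moreover have "real (residue_count m V * residue_count (p ^ 2) (good_at p)) / real (m * p ^ 2) ^ 2 =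
    real (residue_count m V) / real m ^ 2 * (real (residue_count (p ^ 2) (good_at p)) / real (p ^ 2) ^ 2)"
    by (simp add: power_mult_distrib)
  ultimately show ?case
    unfolding e1 e2 IH(1) residue_density_good_at[OF p] using insert.hyps by (simp add: ac_simps)
qed

context ratio_range
begin

lemma card_region_periodic:
  assumes q: "q > 0" and P: "periodic q P"
  shows "((\<lambda>N. real (card {(a, b). (a, b) \<in> region N \<and> P a b}) / N)
            \<longlongrightarrow> ln (r2 / r1) / 2 * (real (residue_count q P) / real q ^ 2)) at_top"
proof -
  define C where "C N i j = {(a, b). (a, b) \<in> region N \<and> a mod q = i \<and> b mod q = j}" for N i j
  define I where "I = {(i, j). i < q \<and> j < q \<and> P i j}"
  have fin: "finite (C N i j)" for N i j
    by (rule finite_subset[OF _ finite_region[of N]]) (auto simp: C_def)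
  have "{(a, b). (a, b) \<in> region N \<and> P a b} = (\<Union>(i, j)\<in>I. C N i j)" for N
    using q periodicD[OF P] by (auto simp: C_def I_def)
  moreover have "card (\<Union>(i, j)\<in>I. C N i j) = (\<Sum>(i, j)\<in>I. card (C N i j))" for N
    unfolding case_prod_unfold
    by (rule card_UN_disjoint) (auto simp: I_def fin, auto simp: C_def)
  ultimately have eq: "real (card {(a, b). (a, b) \<in> region N \<and> P a b}) / N = (\<Sum>(i, j)\<in>I. real (card (C N i j)) / N)" for N
    by (simp add: case_prod_unfold sum_divide_distrib)
  have "((\<lambda>N. \<Sum>(i, j)\<in>I. real (card (C N i j)) / N) \<longlongrightarrow> (\<Sum>(i, j)\<in>I. ln (r2 / r1) / (2 * real q ^ 2))) at_top"
    unfolding case_prod_unfold C_def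
    by (intro tendsto_sum card_region_class[unfolded case_prod_unfold]) (auto simp: I_def)
  thus ?thesis unfolding eq by (simp add: residue_count_def I_def mult.commute)
qed

definition good_pairs :: "(nat \<Rightarrow> nat \<Rightarrow> bool) \<Rightarrow> real \<Rightarrow> (nat \<times> nat) set" where
  "good_pairs W N = {(a, b). (a, b) \<in> region N \<and> W a b \<and> (\<forall>p. Factorial_Ring.prime p \<longrightarrow> good_at p a b)}"

definition sifted_pairs :: "(nat \<Rightarrow> nat \<Rightarrow> bool) \<Rightarrow> nat \<Rightarrow> real \<Rightarrow> (nat \<times> nat) set" where
  "sifted_pairs W z N = {(a, b). (a, b) \<in> region N \<and> W a b \<and> (\<forall>p\<le>z. Factorial_Ring.prime p \<longrightarrow> good_at p a b)}"

lemma card_multiples: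
  assumes "d > 0" "x \<ge> 0"
  shows "real (card {n. 0 < n \<and> d dvd n \<and> real n \<le> x}) \<le> x / d"
proof -
  have "{n. 0 < n \<and> d dvd n \<and> real n \<le> x} = (\<lambda>k. d * k) ` {0<..nat \<lfloor>x / d\<rfloor>}"
  proof (intro equalityI subsetI)
    fix n assume "n \<in> {n. 0 < n \<and> d dvd n \<and> real n \<le> x}"
    then obtain k where k: "n = d * k" "0 < n" "real n \<le> x" by auto
    hence "real k \<le> x / d" using assms by (simp add: field_simps)
    thus "n \<in> (\<lambda>k. d * k) ` {0<..nat \<lfloor>x / d\<rfloor>}" using k by (auto simp: le_nat_floor)
  next
    fix n assume "n \<in> (\<lambda>k. d * k) ` {0<..nat \<lfloor>x / d\<rfloor>}"
    then obtain k where "n = d * k" "k \<in> {0<..nat \<lfloor>x / d\<rfloor>}" by blast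
    hence k: "n = d * k" "0 < k" "k \<le> nat \<lfloor>x / d\<rfloor>" by simp_all
    have "real k \<le> x / d" using k(3) assms by (simp add: le_nat_iff le_floor_iff)
    thus "n \<in> {n. 0 < n \<and> d dvd n \<and> real n \<le> x}" using k assms by (simp add: field_simps)
  qed
  hence "card {n. 0 < n \<and> d dvd n \<and> real n \<le> x} \<le> nat \<lfloor>x / d\<rfloor>"
    using card_image_le[of "{0<..nat \<lfloor>x / d\<rfloor>}" "\<lambda>k. d * k"] by simp
  hence "real (card {n. 0 < n \<and> d dvd n \<and> real n \<le> x}) \<le> real (nat \<lfloor>x / d\<rfloor>)" by simp
  also have "\<dots> \<le> x / d" using assms by simp
  finally show ?thesis .
qed

text \<open>Each of the three ways to fail at \<open>p\<close> confines \<open>(a, b)\<close> to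
  multiples in a box with sides \<open>r2 * sqrt N\<close> and \<open>sqrt N\<close>. Counting
  positive multiples only leaves no rounding term, so the bound remains useful for \<open>p\<close>
  beyond \<open>sqrt N\<close> and can be summed over all large primes.\<close>

lemma card_bad_at:
  assumes "p > 0" "N > 0"
  shows "real (card {(a, b). (a, b) \<in> region N \<and> \<not> good_at p a b}) \<le> 3 * r2 * N / real p ^ 2"
proof -
  define M where "M d x = {n. 0 < n \<and> d dvd n \<and> real n \<le> x}" for d :: nat and x :: real
  have finM: "finite (M d x)" for d x
    by (rule finite_subset[of _ "{..nat \<lfloor>x\<rfloor>}"]) (auto simp: M_def le_nat_floor)
  define m where "m = sqrt N"
  have m: "m > 0" "m * m = N" using assms by (simp_all add: m_def)
  have r2: "r2 > 0" using r1 r12 by linarith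
  have bnd: "real (card (M d (r2 * m) \<times> M e m)) \<le> r2 * N / (real d * real e)" if "d > 0" "e > 0" for d e
  proof -
    have "real (card (M d (r2 * m))) * real (card (M e m)) \<le> (r2 * m / d) * (m / e)"
      using card_multiples[OF that(1), of "r2 * m"] card_multiples[OF that(2), of m] m r2 that
      by (intro mult_mono) (auto simp: M_def)
    thus ?thesis by (simp add: card_cartesian_product m(2)[symmetric])
  qed
  define S1 S2 S3 where "S1 = M (p ^ 2) (r2 * m) \<times> M 1 m" and "S2 = M 1 (r2 * m) \<times> M (p ^ 2) m"
    and "S3 = M p (r2 * m) \<times> M p m"
  have "{(a, b). (a, b) \<in> region N \<and> \<not> good_at p a b} \<subseteq> S1 \<union> (S2 \<union> S3)"
  proof
    fix x assume "x \<in> {(a, b). (a, b) \<in> region N \<and> \<not> good_at p a b}"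
    then obtain a b where x: "x = (a, b)" and ab: "(a, b) \<in> region N" "\<not> good_at p a b" by blast
    note bounds = region_bounds[OF ab(1), folded m_def]
    consider "p ^ 2 dvd a" | "p ^ 2 dvd b" | "p dvd a" "p dvd b" using ab(2) unfolding good_at_def by blast
    thus "x \<in> S1 \<union> (S2 \<union> S3)"
      by cases (use bounds in \<open>simp_all add: x S1_def S2_def S3_def M_def\<close>)
  qed
  hence "card {(a, b). (a, b) \<in> region N \<and> \<not> good_at p a b} \<le> card (S1 \<union> (S2 \<union> S3))"
    by (rule card_mono[rotated]) (simp add: S1_def S2_def S3_def finM)
  also have "\<dots> \<le> card S1 + (card S2 + card S3)"
    by (meson add_left_mono card_Un_le order_trans)
  finally have "real (card {(a, b). (a, b) \<in> region N \<and> \<not> good_at p a b}) \<le> real (card S1) + real (card S2) + real (card S3)"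
    by linarith
  also have "\<dots> \<le> r2 * N / real p ^ 2 + r2 * N / real p ^ 2 + r2 * N / real p ^ 2"
    using bnd[of "p ^ 2" 1] bnd[of 1 "p ^ 2"] bnd[of p p] assms(1)
    unfolding S1_def S2_def S3_def by (intro add_mono) (simp_all add: power2_eq_square)
  also have "\<dots> = 3 * r2 * N / real p ^ 2" by simp
  finally show ?thesis .
qed

lemma sum_inverse_squares_tail: "z > 0 \<Longrightarrow> (\<Sum>n\<in>{z<..m}. 1 / real n ^ 2) \<le> 1 / real z"
proof -
  assume z: "z > 0"
  \<comment> \<open>The subtracted term makes the telescoping induction go through; the maximum
    covers the empty sums with \<open>m \<le> z\<close>.\<close>
  have "(\<Sum>n\<in>{z<..m}. 1 / real n ^ 2) \<le> 1 / real z - 1 / real (max z m)"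
  proof (induction m)
    case (Suc m)
    show ?case
    proof (cases "z < Suc m")
      case True
      hence "{z<..Suc m} = insert (Suc m) {z<..m}" by auto
      hence "(\<Sum>n\<in>{z<..Suc m}. 1 / real n ^ 2) = 1 / real (Suc m) ^ 2 + (\<Sum>n\<in>{z<..m}. 1 / real n ^ 2)" by simp
      moreover have "m > 0" "max z m = m" "max z (Suc m) = Suc m" using True z by auto
      moreover have "1 / real (Suc m) ^ 2 \<le> 1 / real m - 1 / real (Suc m)"
      proof -
        have "1 / real (Suc m) ^ 2 \<le> 1 / (real m * real (Suc m))"
          using \<open>m > 0\<close> by (intro divide_left_mono) (auto simp: power2_eq_square simp del: of_nat_Suc intro!: mult_right_mono)
        also have "\<dots> = 1 / real m - 1 / real (Suc m)" using \<open>m > 0\<close> by (simp add: field_simps)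
        finally show ?thesis .
      qed
      ultimately show ?thesis using Suc by simp
    qed auto
  qed (use z in simp)
  thus ?thesis by (rule order_trans) simp
qed

text \<open>A pair surviving up to \<open>z\<close> but bad at a larger prime \<open>p\<close> has
  \<open>p\<close> dividing \<open>a\<close> or \<open>b\<close>, so
  \<open>p \<le> r2 * sqrt N\<close>. Only finitely many primes arise, and the bounds
  \<open>3 * r2 * N / p ^ 2\<close> sum to the stated tail.\<close>

lemma good_vs_sifted:
  assumes "N > 0" "z > 0"
  shows "card (good_pairs W N) \<le> card (sifted_pairs W z N)"
    and "real (card (sifted_pairs W z N)) \<le> real (card (good_pairs W N)) + 3 * r2 * N / z"
proof -
  have fin: "finite (sifted_pairs W z N)"
    by (rule finite_subset[OF _ finite_region[of N]]) (auto simp: sifted_pairs_def)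
  have sub: "good_pairs W N \<subseteq> sifted_pairs W z N"
    by (auto simp: good_pairs_def sifted_pairs_def)
  show "card (good_pairs W N) \<le> card (sifted_pairs W z N)" by (rule card_mono[OF fin sub])
  define B where "B p = {(a, b). (a, b) \<in> region N \<and> \<not> good_at p a b}" for p
  have finB: "finite (B p)" for p
    by (rule finite_subset[OF _ finite_region[of N]]) (auto simp: B_def)
  define m where "m = nat \<lfloor>r2 * sqrt N\<rfloor>"
  have "sifted_pairs W z N - good_pairs W N \<subseteq> (\<Union>p\<in>{z<..m}. B p)"
  proof
    fix x assume x: "x \<in> sifted_pairs W z N - good_pairs W N"
    obtain a b where ab: "x = (a, b)" by fastforce
    have reg: "(a, b) \<in> region N" using x ab by (auto simp: sifted_pairs_def)
    obtain p where p: "Factorial_Ring.prime p" "\<not> good_at p a b" "p > z"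
    proof -
      have 1: "(a, b) \<in> region N" "W a b" "\<forall>p\<le>z. Factorial_Ring.prime p \<longrightarrow> good_at p a b"
        using x unfolding ab sifted_pairs_def by blast+
      moreover have "(a, b) \<notin> good_pairs W N" using x ab by blast
      ultimately obtain p where "Factorial_Ring.prime p" "\<not> good_at p a b" unfolding good_pairs_def by blast
      thus ?thesis using 1(3) that[of p] not_le by blast
    qed
    have r2: "r2 \<ge> 1" using r1 r12 by linarith
    have le: "a \<le> m" "b \<le> m"
    proof -
      show "a \<le> m" unfolding m_def by (rule le_nat_floor) (rule region_bounds(2)[OF reg])
      have "real b \<le> 1 * sqrt N" using region_bounds(1)[OF reg] by simp
      also have "\<dots> \<le> r2 * sqrt N" using r2 assms by (intro mult_right_mono) auto
      finally show "b \<le> m" unfolding m_def by (rule le_nat_floor)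
    qed
    have "p dvd a \<or> p dvd b" using p(2) unfolding good_at_def by (meson dvd_power dvd_trans zero_less_numeral)
    hence "p \<le> a \<or> p \<le> b" using region_bounds(3,4)[OF reg] dvd_imp_le by blast
    hence "p \<in> {z<..m}" using le p by auto
    thus "x \<in> (\<Union>p\<in>{z<..m}. B p)" using p ab reg by (auto simp: B_def)
  qed
  hence "card (sifted_pairs W z N - good_pairs W N) \<le> card (\<Union>p\<in>{z<..m}. B p)"
    by (rule card_mono[rotated]) (simp add: finB)
  also have "\<dots> \<le> (\<Sum>p\<in>{z<..m}. card (B p))" by (rule card_UN_le) simp
  finally have "real (card (sifted_pairs W z N - good_pairs W N)) \<le> (\<Sum>p\<in>{z<..m}. real (card (B p)))"
    by (metis of_nat_le_iff of_nat_sum)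
  also have "\<dots> \<le> (\<Sum>p\<in>{z<..m}. 3 * r2 * N * (1 / real p ^ 2))"
    using card_bad_at assms by (intro sum_mono) (auto simp: B_def)
  also have "\<dots> \<le> 3 * r2 * N * (1 / z)"
    unfolding sum_distrib_left[symmetric]
    using sum_inverse_squares_tail[OF assms(2), of m] assms r1 r12 by (intro mult_left_mono) auto
  finally have "real (card (sifted_pairs W z N - good_pairs W N)) \<le> 3 * r2 * N / z" by simp
  moreover have "card (sifted_pairs W z N) = card (good_pairs W N) + card (sifted_pairs W z N - good_pairs W N)"
    using card_Diff_subset[OF finite_subset[OF sub fin] sub] card_mono[OF fin sub] by simp
  ultimately show "real (card (sifted_pairs W z N)) \<le> real (card (good_pairs W N)) + 3 * r2 * N / z" by simp
qed

end

section \<open>The Euler product and the limit\<close>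

definition euler_term :: "nat \<Rightarrow> real" where
  "euler_term p = (if Factorial_Ring.prime p then euler_factor p else 1)"

lemma euler_factor_pos: "p \<ge> 2 \<Longrightarrow> euler_factor p > 0"
proof -
  assume "p \<ge> 2"
  hence "(2 :: real) ^ 2 \<le> real p ^ 2" by (intro power_mono) auto
  hence "3 / real p ^ 2 \<le> 3 / 2 ^ 2" using \<open>p \<ge> 2\<close> by (intro divide_left_mono) auto
  also have "3 / 2 ^ 2 = (3 / 4 :: real)" by simp
  finally have "3 / real p ^ 2 \<le> 3 / 4" .
  moreover have "2 / real p ^ 3 > 0" using \<open>p \<ge> 2\<close> by simp
  ultimately show ?thesis unfolding euler_factor_def by linarith
qed

lemma convergent_prod_euler_term: "convergent_prod euler_term"
proof (rule abs_convergent_prod_imp_convergent_prod)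
  have "summable (\<lambda>p. norm (euler_term p - 1))"
  proof (rule summable_comparison_test')
    \<comment> \<open>The constant is \<open>3 + 2\<close>, since
      \<open>1 / p ^ 3 \<le> 1 / p ^ 2\<close>.\<close>
    show "summable (\<lambda>p. 5 * (1 / real p ^ 2))"
      using inverse_power_summable[of 2, where 'a = real] by (intro summable_mult) (simp add: field_simps)
    fix p :: nat assume "p \<ge> 1"
    have "2 / real p ^ 3 \<le> 2 / real p ^ 2"
      using \<open>p \<ge> 1\<close> by (intro divide_left_mono power_increasing mult_pos_pos zero_less_power) auto
    moreover have "2 / real p ^ 2 = 2 * (1 / real p ^ 2)" "3 / real p ^ 2 = 3 * (1 / real p ^ 2)" by simp_all
    moreover have "0 \<le> 2 / real p ^ 3" "0 \<le> 1 / real p ^ 2" by simp_all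
    ultimately have "\<bar>euler_factor p - 1\<bar> \<le> 5 * (1 / real p ^ 2)" "0 \<le> 5 * (1 / real p ^ 2)"
      unfolding euler_factor_def by linarith+
    thus "norm (norm (euler_term p - 1)) \<le> 5 * (1 / real p ^ 2)"
      by (simp only: euler_term_def real_norm_def abs_abs split: if_splits) simp
  qed
  thus "abs_convergent_prod euler_term" by (simp add: abs_convergent_prod_conv_summable)
qed

lemma euler_const_eq: "euler_const = prodinf euler_term"
  unfolding euler_const_def by (rule arg_cong[of _ _ prodinf]) (auto simp: euler_term_def euler_factor_def)

text \<open>Needed to divide by \<open>type_const\<close>. An absolutely convergent product vanishes
  only through a zero factor, and the factors at primes are positive.\<close>

lemma euler_const_nonzero: "euler_const \<noteq> 0"
  unfolding euler_const_eq
  by (rule prodinf_nonzero[OF convergent_prod_euler_term])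
    (auto simp: euler_term_def dest!: euler_factor_pos[OF prime_ge_2_nat])

lemma euler_product_tendsto:
  "(\<lambda>z. \<Prod>p | Factorial_Ring.prime p \<and> p \<le> z. euler_factor p) \<longlonglongrightarrow> euler_const"
proof -
  have "(\<Prod>p\<le>z. euler_term p) = (\<Prod>p | Factorial_Ring.prime p \<and> p \<le> z. euler_factor p)" for z
    by (rule prod.mono_neutral_cong_right) (auto simp: euler_term_def)
  thus ?thesis using convergent_prod_LIMSEQ[OF convergent_prod_euler_term] euler_const_eq by simp
qed

context ratio_range
begin

text \<open>The prime 3 is taken out of the product, since its condition and the type are both
  conditions modulo 9. Dividing by 60 restores its factor \<open>60 / 81\<close>;
  \<open>z \<ge> 3\<close> ensures that this factor is present.\<close>

lemma card_sifted_pairs_limit: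
  assumes "periodic 9 W" "z \<ge> 3"
  shows "((\<lambda>N. real (card (sifted_pairs W z N)) / N) \<longlongrightarrow>
     ln (r2 / r1) / 2 * (real (residue_count 9 (\<lambda>i j. W i j \<and> good_at 3 i j)) / 60)
       * (\<Prod>p | Factorial_Ring.prime p \<and> p \<le> z. euler_factor p)) at_top"
proof -
  define F where "F = {p. Factorial_Ring.prime p \<and> p \<le> z} - {3}"
  define V where "V = (\<lambda>i j. W i j \<and> good_at 3 i j)"
  have F: "finite F" "\<And>p. p \<in> F \<Longrightarrow> Factorial_Ring.prime p" by (auto simp: F_def)
  have insF: "{p. Factorial_Ring.prime p \<and> p \<le> z} = insert 3 F" "3 \<notin> F" using assms(2) by (auto simp: F_def)
  have V: "periodic 9 V"
    unfolding V_def using assms(1) periodic_good_at[of 3] by (intro periodic_conj) simp_all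
  have cop: "coprime p 9" if "p \<in> F" for p
  proof -
    have "coprime p 3" using that by (intro primes_coprime) (auto simp: F_def)
    hence "coprime p (3 ^ 2)" by (subst coprime_power_right_iff) simp
    thus ?thesis by simp
  qed
  define q where "q = 9 * (\<Prod>p\<in>F. p ^ 2)"
  have q: "q > 0" using F by (auto simp: q_def prime_gt_0_nat intro!: prod_pos)
  have dens: "real (residue_count q (\<lambda>i j. V i j \<and> (\<forall>p\<in>F. good_at p i j))) / real q ^ 2 =
      real (residue_count 9 V) / real 9 ^ 2 * (\<Prod>p\<in>F. euler_factor p)"
    "periodic q (\<lambda>i j. V i j \<and> (\<forall>p\<in>F. good_at p i j))"
    using residue_density_good_primes[OF F(1) F(2) zero_less_numeral V cop] unfolding q_def by blast+
  have "(\<forall>p\<in>insert 3 F. good_at p i j) \<longleftrightarrow> (\<forall>p\<le>z. Factorial_Ring.prime p \<longrightarrow> good_at p i j)" for i j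
    unfolding insF(1)[symmetric] by blast
  hence sieve: "W i j \<and> (\<forall>p\<le>z. Factorial_Ring.prime p \<longrightarrow> good_at p i j) \<longleftrightarrow> V i j \<and> (\<forall>p\<in>F. good_at p i j)" for i j
    unfolding V_def by (metis insert_iff)
  have "((\<lambda>N. real (card (sifted_pairs W z N)) / N)
            \<longlongrightarrow> ln (r2 / r1) / 2 * (real (residue_count 9 V) / real 9 ^ 2 * (\<Prod>p\<in>F. euler_factor p))) at_top"
    using card_region_periodic[OF q dens(2)] unfolding dens(1) sifted_pairs_def sieve .
  moreover have "euler_factor 3 = 60 / 81" by (simp add: euler_factor_def)
  hence prod: "(\<Prod>p | Factorial_Ring.prime p \<and> p \<le> z. euler_factor p) = 60 / 81 * (\<Prod>p\<in>F. euler_factor p)"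
    using insF F by simp
  have "ln (r2 / r1) / 2 * (real (residue_count 9 V) / real 9 ^ 2 * (\<Prod>p\<in>F. euler_factor p)) =
     ln (r2 / r1) / 2 * (real (residue_count 9 V) / 60) * (60 / 81 * (\<Prod>p\<in>F. euler_factor p))" by simp
  ultimately show ?thesis unfolding prod V_def by (simp only:)
qed

lemma card_good_pairs_limit:
  assumes "periodic 9 W"
  shows "((\<lambda>N. real (card (good_pairs W N)) / N) \<longlongrightarrow>
     ln (r2 / r1) / 2 * (real (residue_count 9 (\<lambda>i j. W i j \<and> good_at 3 i j)) / 60) * euler_const) at_top"
proof (rule tendstoI)
  fix e :: real assume e: "e > 0"
  define c where "c = ln (r2 / r1) / 2 * (real (residue_count 9 (\<lambda>i j. W i j \<and> good_at 3 i j)) / 60)"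
  define P where "P z = (\<Prod>p | Factorial_Ring.prime p \<and> p \<le> z. euler_factor p)" for z :: nat
  have "(\<lambda>z. c * P z) \<longlonglongrightarrow> c * euler_const"
    unfolding P_def by (intro tendsto_mult tendsto_const euler_product_tendsto)
  hence "\<forall>\<^sub>F z in sequentially. dist (c * P z) (c * euler_const) < e / 3" using e by (intro tendstoD) auto
  moreover have "(\<lambda>z. 3 * r2 / real z) \<longlonglongrightarrow> 0" by real_asymp
  hence "\<forall>\<^sub>F z in sequentially. dist (3 * r2 / real z) 0 < e / 3" using e by (intro tendstoD) auto
  moreover have "\<forall>\<^sub>F z in sequentially. z \<ge> (3::nat)" by (rule eventually_ge_at_top)
  ultimately have "\<forall>\<^sub>F z in sequentially. dist (c * P z) (c * euler_const) < e / 3 \<and> dist (3 * r2 / real z) 0 < e / 3 \<and> z \<ge> 3"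
    by (intro eventually_conj)
  then obtain z where z: "dist (c * P z) (c * euler_const) < e / 3" "dist (3 * r2 / real z) 0 < e / 3" "z \<ge> 3"
    using eventually_happens by fastforce
  have "\<forall>\<^sub>F N in at_top. dist (real (card (sifted_pairs W z N)) / N) (c * P z) < e / 3"
    using card_sifted_pairs_limit[OF assms z(3)] e unfolding c_def P_def by (intro tendstoD) auto
  moreover have "\<forall>\<^sub>F N in at_top. (N::real) > 0" by (rule eventually_gt_at_top)
  ultimately have "\<forall>\<^sub>F N in at_top. dist (real (card (good_pairs W N)) / N) (c * euler_const) < e"
  proof eventually_elim
    case (elim N)
    have "z > 0" using z by simp
    note gs = good_vs_sifted[OF elim(2) \<open>z > 0\<close>, of W]
    have "real (card (good_pairs W N)) / N \<le> real (card (sifted_pairs W z N)) / N"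
      using gs(1) elim by (intro divide_right_mono) auto
    moreover have "real (card (sifted_pairs W z N)) / N \<le> (real (card (good_pairs W N)) + 3 * r2 * N / z) / N"
      using gs(2) elim by (intro divide_right_mono) auto
    moreover have "(real (card (good_pairs W N)) + 3 * r2 * N / z) / N = real (card (good_pairs W N)) / N + 3 * r2 / z"
      using elim by (simp add: add_divide_distrib)
    ultimately show ?case using z(1,2) elim(1) unfolding dist_real_def by linarith
  qed
  thus "\<forall>\<^sub>F N in at_top. dist (real (card (good_pairs W N)) / N) (ln (r2 / r1) / 2 * (real (residue_count 9 (\<lambda>i j. W i j \<and> good_at 3 i j)) / 60) * euler_const) < e"
    by (simp only: c_def)
qed

text \<open>The conditions at all primes mean squarefree and coprime, and the region gives
  \<open>b \<le> a\<close> because \<open>r1 \<ge> 1\<close>. Equality leaves only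
  \<open>(1, 1)\<close>, which accounts for the 1.\<close>

lemma good_pairs_vs_canonical:
  "card {(a, b). canonical_pair a b \<and> (a, b) \<in> region N \<and> W a b} \<le> card (good_pairs W N)"
  "card (good_pairs W N) \<le> card {(a, b). canonical_pair a b \<and> (a, b) \<in> region N \<and> W a b} + 1"
proof -
  let ?C = "{(a, b). canonical_pair a b \<and> (a, b) \<in> region N \<and> W a b}"
  have fin: "finite (good_pairs W N)" "finite ?C"
    by (rule finite_subset[OF _ finite_region[of N]]; auto simp: good_pairs_def)+
  have "good_at p a b" if "canonical_pair a b" "Factorial_Ring.prime p" for p a b
  proof -
    have "\<not> p dvd 1" using that(2) not_prime_unit by blast
    thus ?thesis using that(1) squarefreeD[of a p] squarefreeD[of b p] coprime_common_divisor[of a b p]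
      unfolding good_at_def canonical_pair_def by blast
  qed
  hence "?C \<subseteq> good_pairs W N" by (auto simp: good_pairs_def)
  thus "card ?C \<le> card (good_pairs W N)" by (rule card_mono[OF fin(1)])
  have "good_pairs W N \<subseteq> insert (1, 1) ?C"
  proof
    fix x assume "x \<in> good_pairs W N"
    then obtain a b where x: "x = (a, b)" and reg: "(a, b) \<in> region N" and W: "W a b"
      and good: "\<And>p. Factorial_Ring.prime p \<Longrightarrow> good_at p a b" by (auto simp: good_pairs_def)
    have pos: "a > 0" "b > 0" using region_bounds[OF reg] by auto
    have "1 * real b \<le> r1 * real b" using r1 by (intro mult_right_mono) auto
    hence "b \<le> a" using reg by (simp add: region_def)
    have sq: "squarefree a" "squarefree b"
      using good pos unfolding good_at_def by (auto simp: squarefree_factorial_semiring)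
    have cop: "coprime a b"
    proof (rule ccontr)
      assume "\<not> coprime a b"
      hence "gcd a b \<noteq> 1" by (simp add: coprime_iff_gcd_eq_1)
      then obtain p where "Factorial_Ring.prime p" "p dvd gcd a b" using prime_factor_nat by blast
      thus False using good[of p] by (simp add: good_at_def)
    qed
    show "x \<in> insert (1, 1) ?C"
    proof (cases "a = b")
      case True
      thus ?thesis using cop x by simp
    next
      case False
      thus ?thesis using x reg W sq cop pos \<open>b \<le> a\<close> by (simp add: canonical_pair_def)
    qed
  qed
  hence "card (good_pairs W N) \<le> card (insert (1, 1) ?C)" by (rule card_mono[rotated]) (use fin in simp)
  also have "\<dots> \<le> card ?C + 1" using fin by (simp add: card_insert_if)
  finally show "card (good_pairs W N) \<le> card ?C + 1" .
qed

lemma card_canonical_pairs_limit: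
  assumes "periodic 9 W"
  shows "((\<lambda>N. real (card {(a, b). canonical_pair a b \<and> (a, b) \<in> region N \<and> W a b}) / N) \<longlongrightarrow>
     ln (r2 / r1) / 2 * (real (residue_count 9 (\<lambda>i j. W i j \<and> good_at 3 i j)) / 60) * euler_const) at_top"
proof -
  let ?C = "\<lambda>N. {(a, b). canonical_pair a b \<and> (a, b) \<in> region N \<and> W a b}"
  have "((\<lambda>N. real (card (?C N)) / N - real (card (good_pairs W N)) / N) \<longlongrightarrow> 0) at_top"
  proof (rule Lim_null_comparison)
    show "\<forall>\<^sub>F N in at_top. norm (real (card (?C N)) / N - real (card (good_pairs W N)) / N) \<le> 1 / N"
      using eventually_gt_at_top[of 0]
    proof eventually_elim
      case (elim N)
      have "\<bar>real (card (?C N)) - real (card (good_pairs W N))\<bar> \<le> 1"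
        using good_pairs_vs_canonical[where N = N and W = W] by linarith
      hence "\<bar>real (card (?C N)) - real (card (good_pairs W N))\<bar> / N \<le> 1 / N"
        using elim by (intro divide_right_mono) auto
      thus ?case using elim by (simp add: diff_divide_distrib[symmetric] abs_divide)
    qed
    show "((\<lambda>N::real. 1 / N) \<longlongrightarrow> 0) at_top" by real_asymp
  qed
  from tendsto_add[OF this card_good_pairs_limit[OF assms]] show ?thesis by simp
qed

end

section \<open>The types as residue classes modulo 9\<close>

lemma tame_pair_mod_9: "tame_pair (a mod 9) (b mod 9) = tame_pair a b"
proof -
  have "9 dvd a mod 9 - b mod 9 \<longleftrightarrow> 9 dvd a - b" "9 dvd a mod 9 + b mod 9 \<longleftrightarrow> 9 dvd a + b"
    "3 dvd a mod 9 \<longleftrightarrow> 3 dvd a" "3 dvd b mod 9 \<longleftrightarrow> 3 dvd b" by presburger+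
  thus ?thesis by (simp add: tame_pair_def three_dvd_mult)
qed

definition pair_type :: "nat \<Rightarrow> nat \<Rightarrow> cubic_type" where
  "pair_type a b = (if tame_pair (int a) (int b) then TypeII else TypeI)"

lemma periodic_pair_type: "periodic 9 (\<lambda>a b. pair_type a b = t)"
  unfolding periodic_def pair_type_def
  using tame_pair_mod_9 by (simp add: zmod_int)

text \<open>Replaces the set by an explicit list, so that the 81 residue pairs modulo 9 can be
  evaluated.\<close>

lemma residue_count_code:
  "residue_count q P = length (filter (\<lambda>(i, j). P i j) (List.product [0..<q] [0..<q]))"
proof -
  have "{(i, j). i < q \<and> j < q \<and> P i j} = set (filter (\<lambda>(i, j). P i j) (List.product [0..<q] [0..<q]))"
    by auto
  moreover have "distinct (filter (\<lambda>(i, j). P i j) (List.product [0..<q] [0..<q]))"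
    by (intro distinct_filter distinct_product) auto
  ultimately show ?thesis unfolding residue_count_def by (simp only: distinct_card)
qed

text \<open>For Type II, \<open>i\<close> is one of the six units modulo 9 and \<open>j\<close> is
  \<open>i\<close> or \<open>- i\<close>: 12 pairs out of the 60 admissible ones.\<close>

lemma residue_count_pair_type:
  "residue_count 9 (\<lambda>i j. pair_type i j = t \<and> good_at 3 i j) = (if t = TypeI then 48 else 12)"
proof (cases t)
  case TypeI
  have "length (filter (\<lambda>(i, j). pair_type i j = TypeI \<and> good_at 3 i j) (List.product [0..<9] [0..<9])) = 48"
    unfolding pair_type_def good_at_def tame_pair_def by code_simp
  thus ?thesis unfolding residue_count_code TypeI by simp
next
  case TypeII
  have "length (filter (\<lambda>(i, j). pair_type i j = TypeII \<and> good_at 3 i j) (List.product [0..<9] [0..<9])) = 12"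
    unfolding pair_type_def good_at_def tame_pair_def by code_simp
  thus ?thesis unfolding residue_count_code TypeII by simp
qed

section \<open>From shapes and discriminants to pairs\<close>

fun type_disc :: "cubic_type \<Rightarrow> real" where
  "type_disc TypeI = 27"
| "type_disc TypeII = 3"

context cubic_root
begin

lemma field_type_eq_pair_type: "field_type (adjoin t) = pair_type a b"
  by (simp add: field_type_adjoin pair_type_def)

lemma abs_discriminant:
  "\<bar>real_of_int (discriminant (adjoin t))\<bar> = type_disc (pair_type a b) * (real a * real b) ^ 2"
  by (cases "tame_pair (int a) (int b)")
    (simp_all add: discriminant_wild discriminant_tame pair_type_def power_mult_distrib abs_mult)

lemma shape_adjoin: "shape (adjoin t) = shape_point (pair_type a b) (root 3 (real a / real b))"
  by (simp add: shape_def field_type_eq_pair_type ratio_adjoin of_rat_divide)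

end

lemma inj_shape_point: "shape_point t y = shape_point t y' \<longleftrightarrow> y = y'"
  by (cases t) (auto simp: complex_eq_iff)

lemma root_3_interval:
  assumes "1 \<le> R1" "R1 < R2" "b > 0"
  shows "R1 \<le> root 3 (real a / real b) \<and> root 3 (real a / real b) < R2 \<longleftrightarrow>
    R1 ^ 3 * real b \<le> real a \<and> real a < R2 ^ 3 * real b"
proof -
  have "R1 \<le> root 3 (real a / real b) \<longleftrightarrow> root 3 (R1 ^ 3) \<le> root 3 (real a / real b)"
    using assms by (simp add: real_root_power_cancel)
  moreover have "root 3 (real a / real b) < R2 \<longleftrightarrow> root 3 (real a / real b) < root 3 (R2 ^ 3)"
    using assms by (simp add: real_root_power_cancel)
  ultimately show ?thesis using assms by (simp add: field_simps)
qed

text \<open>The absolute discriminant is \<open>type_disc t * (a b) ^ 2\<close>, so its bound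
  becomes a bound on \<open>a b\<close>; cubing the bounds on the shape coordinate gives bounds on
  the ratio.\<close>

lemma shape_count_eq:
  assumes "1 \<le> R1" "R1 < R2" "x \<ge> 0"
  shows "shape_count t R1 R2 x = card {(a, b). canonical_pair a b \<and>
     (a, b) \<in> ratio_range.region (R1 ^ 3) (R2 ^ 3) (sqrt (x / type_disc t)) \<and> pair_type a b = t}"
proof -
  interpret ratio_range "R1 ^ 3" "R2 ^ 3"
    using assms by unfold_locales (auto intro: power_strict_mono one_le_power)
  define P where "P = (\<lambda>(a, b). (a, b) \<in> region (sqrt (x / type_disc t)) \<and> pair_type a b = t)"
  have key: "field_type K = t \<and> \<bar>real_of_int (discriminant K)\<bar> \<le> x \<and> shape K \<in> shape_interval t R1 R2
      \<longleftrightarrow> P (cubic_params K)" if K: "pure_cubic_field K" for K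
  proof -
    obtain a b s where s: "cubic_root a b s" "K = adjoin s" using K unfolding pure_cubic_field_iff by blast
    interpret cubic_root a b s by fact
    have d: "type_disc t > 0" by (cases t) auto
    have "type_disc t * (real a * real b) ^ 2 \<le> x \<longleftrightarrow> (real a * real b) ^ 2 \<le> x / type_disc t"
      using d by (simp add: field_simps)
    also have "\<dots> \<longleftrightarrow> real a * real b \<le> sqrt (x / type_disc t)"
    proof
      assume "real a * real b \<le> sqrt (x / type_disc t)"
      hence "(real a * real b) ^ 2 \<le> sqrt (x / type_disc t) ^ 2" by (intro power_mono) auto
      thus "(real a * real b) ^ 2 \<le> x / type_disc t" using d assms(3) by simp
    qed (rule real_le_rsqrt)
    finally have 1: "type_disc t * (real a * real b) ^ 2 \<le> x \<longleftrightarrow> real a * real b \<le> sqrt (x / type_disc t)" .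
    have 2: "shape_point t y \<in> shape_interval t R1 R2 \<longleftrightarrow> R1 \<le> y \<and> y < R2" for y
      by (auto simp: shape_interval_def inj_shape_point)
    show ?thesis
    proof (cases "pair_type a b = t")
      case True
      thus ?thesis
        unfolding s(2) field_type_eq_pair_type abs_discriminant shape_adjoin cubic_params_adjoin P_def
        using 1 2 root_3_interval[OF assms(1,2) ab_pos(2)] by (auto simp: region_def)
    qed (simp add: s(2) field_type_eq_pair_type cubic_params_adjoin P_def)
  qed
  have "{K. pure_cubic_field K \<and> field_type K = t \<and> \<bar>real_of_int (discriminant K)\<bar> \<le> x \<and>
               shape K \<in> shape_interval t R1 R2} = {K. pure_cubic_field K \<and> P (cubic_params K)}"
    using key by blast
  thus ?thesis unfolding shape_count_def using card_pure_cubic_quotient[of P] by (simp add: P_def)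
qed

text \<open>The ratio is the cube of the shape coordinate, so the area is
  \<open>(3 / 2) * ln (R2 / R1)\<close>. With shares \<open>48 / 60\<close> and
  \<open>12 / 60\<close> and with \<open>N\<close> equal to \<open>sqrt (x / 27)\<close> and
  \<open>sqrt (x / 3)\<close>, the coefficients of \<open>euler_const\<close> are
  \<open>(3 / 2) * (4 / 5) / (3 * sqrt 3) = 2 * sqrt 3 / 15\<close> and
  \<open>(3 / 2) * (1 / 5) / sqrt 3 = sqrt 3 / 10\<close>.\<close>

lemma shape_count_limit:
  assumes "1 \<le> R1" "R1 < R2"
  shows "((\<lambda>x. real (shape_count t R1 R2 x) / (type_const t * sqrt x)) \<longlongrightarrow> ln (R2 / R1)) at_top"
proof -
  interpret ratio_range "R1 ^ 3" "R2 ^ 3"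
    using assms by unfold_locales (auto intro: power_strict_mono one_le_power)
  define C where "C N = real (card {(a, b). canonical_pair a b \<and> (a, b) \<in> region N \<and> pair_type a b = t})" for N
  define k where "k = real (if t = TypeI then 48 else 12)"
  have d: "type_disc t > 0" by (cases t) auto
  have lnR: "ln (R2 ^ 3 / R1 ^ 3) = 3 * ln (R2 / R1)"
    using assms ln_realpow[of "R2 / R1" 3] by (simp add: power_divide)
  have "((\<lambda>N. C N / N) \<longlongrightarrow> 3 * ln (R2 / R1) / 2 * (k / 60) * euler_const) at_top"
    using card_canonical_pairs_limit[OF periodic_pair_type[of t]]
    unfolding residue_count_pair_type lnR C_def k_def .
  moreover have "filterlim (\<lambda>x. sqrt (x / type_disc t)) at_top at_top"
    using d by (intro filterlim_compose[OF sqrt_at_top]) real_asymp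
  ultimately have "((\<lambda>x. C (sqrt (x / type_disc t)) / sqrt (x / type_disc t)) \<longlongrightarrow> 3 * ln (R2 / R1) / 2 * (k / 60) * euler_const) at_top"
    by (rule filterlim_compose)
  hence "((\<lambda>x. C (sqrt (x / type_disc t)) / sqrt (x / type_disc t) / (type_const t * sqrt (type_disc t)))
      \<longlongrightarrow> 3 * ln (R2 / R1) / 2 * (k / 60) * euler_const / (type_const t * sqrt (type_disc t))) at_top"
    by (rule tendsto_divide[OF _ tendsto_const]) (use euler_const_nonzero in \<open>cases t; simp\<close>)
  also have "3 * ln (R2 / R1) / 2 * (k / 60) * euler_const / (type_const t * sqrt (type_disc t)) = ln (R2 / R1)"
  proof -
    have s27: "sqrt 27 = 3 * sqrt 3" using real_sqrt_mult[of 9 3] by simp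
    have s: "sqrt 3 * sqrt 3 = 3" by simp
    show ?thesis
    proof (cases t)
      case TypeI
      have "type_const t * sqrt (type_disc t) = 6 / 5 * euler_const"
        using s by (simp add: TypeI s27 algebra_simps)
      thus ?thesis using euler_const_nonzero by (simp add: TypeI k_def)
    next
      case TypeII
      have "type_const t * sqrt (type_disc t) = 3 / 10 * euler_const"
        using s by (simp add: TypeII algebra_simps)
      thus ?thesis using euler_const_nonzero by (simp add: TypeII k_def)
    qed
  qed
  finally show ?thesis
  proof (rule Lim_transform_eventually)
    show "\<forall>\<^sub>F x in at_top. C (sqrt (x / type_disc t)) / sqrt (x / type_disc t) / (type_const t * sqrt (type_disc t))
        = real (shape_count t R1 R2 x) / (type_const t * sqrt x)"
      using eventually_ge_at_top[of 0]
    proof eventually_elim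
      case (elim x)
      have "sqrt (x / type_disc t) * (type_const t * sqrt (type_disc t)) = type_const t * sqrt x"
        using d by (simp add: real_sqrt_divide)
      thus ?case using shape_count_eq[OF assms elim] by (simp add: C_def)
    qed
  qed
qed

section \<open>The measure of an interval of shapes\<close>

lemma shape_point_measurable [measurable]: "shape_point t \<in> borel_measurable borel"
proof -
  have "continuous_on UNIV (shape_point t)" by (cases t) (simp_all, (intro continuous_intros; simp)+)
  thus ?thesis by (rule borel_measurable_continuous_onI)
qed

lemma shape_interval_borel: "shape_interval t R1 R2 \<in> sets borel"
proof -
  have "shape_interval TypeI R1 R2 = {z. Re z = 0 \<and> R1 \<le> Im z \<and> Im z < R2}"
    by (auto simp: shape_interval_def complex_eq_iff)
  moreover have "shape_interval TypeII R1 R2 = {z. Re z = 1 / 3 \<and> R1 \<le> 3 * Im z \<and> 3 * Im z < R2}"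
  proof (intro equalityI subsetI)
    fix z assume z: "z \<in> {z. Re z = 1 / 3 \<and> R1 \<le> 3 * Im z \<and> 3 * Im z < R2}"
    hence "z = shape_point TypeII (3 * Im z)" by (simp add: complex_eq_iff)
    thus "z \<in> shape_interval TypeII R1 R2" using z unfolding shape_interval_def by blast
  next
    fix z assume "z \<in> shape_interval TypeII R1 R2"
    then obtain y where y: "z = shape_point TypeII y" "R1 \<le> y" "y < R2" unfolding shape_interval_def by blast
    have "Re z = 1 / 3" "Im z = y / 3" unfolding y(1) by simp_all
    thus "z \<in> {z. Re z = 1 / 3 \<and> R1 \<le> 3 * Im z \<and> 3 * Im z < R2}" using y(2,3) by simp
  qed
  ultimately show ?thesis by (cases t) simp_all
qed

lemma nn_integral_inverse:
  assumes "1 \<le> R1" "R1 < R2"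
  shows "(\<integral>\<^sup>+y. ennreal (1 / y) * indicator {R1..<R2} y \<partial>lborel) = ennreal (ln (R2 / R1))"
proof -
  \<comment> \<open>The endpoint \<open>R2\<close> is a null set; closing the interval allows the
    fundamental theorem of calculus.\<close>
  have "(\<integral>\<^sup>+y. ennreal (1 / y) * indicator {R1..<R2} y \<partial>lborel) = (\<integral>\<^sup>+y. ennreal (1 / y) * indicator {R1..R2} y \<partial>lborel)"
    using AE_lborel_singleton[of R2]
    by (intro nn_integral_cong_AE) (auto simp: indicator_def elim!: eventually_mono)
  also have "\<dots> = ennreal (ln R2 - ln R1)"
    using assms by (intro nn_integral_FTC_Icc) (auto intro!: derivative_eq_intros)
  finally show ?thesis using assms by (simp add: ln_div)
qed

text \<open>The pushforward is pulled back to the coordinate \<open>y\<close>, where the preimage of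
  the interval is \<open>{R1..<R2}\<close>; \<open>R1 \<ge> 1\<close> places it inside the half-line
  carrying the measure.\<close>

lemma shape_interval_measure:
  assumes "1 \<le> R1" "R1 < R2"
  shows "(LINT z:shape_interval t R1 R2|shape_measure t. 1) = ln (R2 / R1)"
proof -
  define D where "D = density (restrict_space lborel {1..}) (\<lambda>y. ennreal (1 / y :: real))"
  have spD: "space D = {1..}" by (simp add: D_def space_restrict_space)
  have "shape_point t \<in> borel_measurable (restrict_space lborel {1..})"
    by (rule measurable_restrict_space1) simp
  hence "shape_point t \<in> borel_measurable D" by (simp add: D_def)
  hence meas: "shape_point t \<in> measurable D (restrict_space borel (shape_space t))"
    by (rule measurable_restrict_space2[rotated]) (auto simp: spD shape_space_def)
  have sub: "shape_interval t R1 R2 \<subseteq> shape_space t"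
    using assms unfolding shape_interval_def shape_space_def by (auto intro: order_trans)
  have A: "shape_interval t R1 R2 \<in> sets (restrict_space borel (shape_space t))"
    using shape_interval_borel sub unfolding sets_restrict_space by (metis Int_absorb1 imageI)
  have pre: "shape_point t -` shape_interval t R1 R2 \<inter> space D = {R1..<R2}"
    using assms by (auto simp: spD shape_interval_def inj_shape_point)
  have "emeasure (shape_measure t) (shape_interval t R1 R2) = emeasure D {R1..<R2}"
    unfolding shape_measure_def D_def[symmetric] emeasure_distr[OF meas A] pre ..
  also have "\<dots> = (\<integral>\<^sup>+y. ennreal (1 / y) * indicator {R1..<R2} y \<partial>restrict_space lborel {1..})"
    unfolding D_def
  proof (rule emeasure_density)
    show "(\<lambda>y. ennreal (1 / y)) \<in> borel_measurable (restrict_space lborel {1..})"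
      by (rule measurable_restrict_space1) simp
    show "{R1..<R2} \<in> sets (restrict_space lborel {1..})"
      using assms by (subst sets_restrict_space_iff) auto
  qed
  also have "\<dots> = (\<integral>\<^sup>+y. ennreal (1 / y) * indicator {R1..<R2} y * indicator {1..} y \<partial>lborel)"
    by (rule nn_integral_restrict_space) simp
  also have "\<dots> = (\<integral>\<^sup>+y. ennreal (1 / y) * indicator {R1..<R2} y \<partial>lborel)"
    using assms by (intro nn_integral_cong) (auto simp: indicator_def)
  also have "\<dots> = ennreal (ln (R2 / R1))" by (rule nn_integral_inverse[OF assms])
  finally have "measure (shape_measure t) (shape_interval t R1 R2) = ln (R2 / R1)"
    using assms by (simp add: measure_def)
  moreover have "space (shape_measure t) = shape_space t"
    by (simp add: shape_measure_def space_restrict_space)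
  ultimately show ?thesis using sub by (simp add: set_lebesgue_integral_def Int_absorb2)
qed

theorem theoremC:
  fixes t :: cubic_type and R1 R2 :: real
  assumes "1 \<le> R1" and "R1 < R2"
  shows "((\<lambda>x. real (shape_count t R1 R2 x) / (type_const t * sqrt x))
            \<longlongrightarrow> (LINT z:shape_interval t R1 R2|shape_measure t. 1)) at_top
         \<and> (LINT z:shape_interval t R1 R2|shape_measure t. 1) = ln (R2 / R1)"
  using shape_count_limit[OF assms] shape_interval_measure[OF assms] by simp

end
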